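(* A formal Laurent series $\sum_{\mathbf{k}\in\mathbb{Z}^{\{\alpha\}}\times\mathbb{N}^{\Phi^+\setminus\{\alpha\}}}c_{\mathbf{k}}\mathbf{b}^{\mathbf{k}}$ ($c_{\mathbf k}\in K$) belongs to $$\mathcal{R}(N_1,\ell)=\bigcup_{t\in T_+}\Big\{\sum_{\mathbf{k}}c_{\mathbf{k}}\mathbf{b}^{\mathbf{k}}\ \Big|\ \sum_{\mathbf{k}}c_{\mathbf{k}}\varphi_t(\mathbf{b})^{\mathbf{k}}\text{ is convergent in }\mathfrak{R}_0(N_0,\alpha)\Big\}$$ if and only if there exist $p^{-1}<\rho_2<1$ and an integer $r\ge1$ such that the Laurent series $\sum_{\mathbf k}c_{\mathbf k}\prod_{\beta\in\Phi^+}z_\beta^{k_\beta}$ converges on $$\left\{\rho_2<|z_\alpha|<1,\ |z_\beta|\le|z_\alpha|^r\text{ for }\beta\in\Phi^+\setminus\{\alpha\}\right\}.$$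
   Context: Setting. $G$ is the group of $\mathbb{Q}_p$-points of a $\mathbb{Q}_p$-split connected reductive group with connected centre, $P=TN$ a Borel subgroup with split maximal torus $T$ and unipotent radical $N$, $\Phi^+\supseteq\Delta$ the positive and simple roots, $N_\beta$ the root subgroups. $N_0\subseteq N$ is a compact open subgroup with $N_0=\prod_{\beta\in\Phi^+}(N_0\cap N_\beta)$ for any ordering of $\Phi^+$, assumed to be a uniform pro-$p$ group. $T_+=\{t\in T\mid tN_0t^{-1}\subseteq N_0\}$. Fix $\alpha\in\Delta$ and $\iota_\alpha\colon N_\alpha\cong\mathbb{Q}_p$ with $\iota_\alpha(tnt^{-1})=\alpha(t)\iota_\alpha(n)$ and $\iota_\alpha(N_0\cap N_\alpha)=\mathbb{Z}_p$; $\ell\colon N\to N/[N,N]\to\prod_{\beta\in\Delta}N_\beta\to N_\alpha\cong\mathbb{Q}_p$; $N_1=\ker(\ell|_{N_0})$. For $t\in T_+$ let $\varphi_t\colon N_0\to N_0$, $n\mapsto tnt^{-1}$. Choose topological generators $n_\beta$ of $N_0\cap N_\beta$ with $\ell(n_\alpha)=1$; $b_\beta:=n_\beta-1$, $\varphi_t(b_\beta):=\varphi_t(n_\beta)-1$. $K/\mathbb{Q}_p$ is a finite extension, $|p|=p^{-1}$. The radii $\rho,\rho_1,\rho_2$ used in the definitions below lie in $p^{\mathbb{Q}}\cap(p^{-1},1)$. Monomials $\mathbf{b}^{\mathbf{k}}=\prod_\beta b_\beta^{k_\beta}$ and $\varphi_t(\mathbf{b})^{\mathbf{k}}=\prod_\beta\varphi_t(b_\beta)^{k_\beta}$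 are taken in a fixed order of $\Phi^+$. The $z_\beta$ range over $\mathbb{C}_p$. $D(N_0,K)$ is the algebra of $K$-valued locally analytic distributions on $N_0$, i.e. the series $\sum_{\mathbf{k}\in\mathbb{N}^{\Phi^+}}d_{\mathbf{k}}\mathbf{b}^{\mathbf{k}}$ with $\{|d_{\mathbf{k}}|\rho^{|\mathbf{k}|}\}$ bounded for all $0<\rho<1$, where $|\mathbf k|=\sum_\beta k_\beta$. The norm $\|\sum d_{\mathbf{k}}\mathbf{b}^{\mathbf{k}}\|_\rho:=\sup|d_{\mathbf{k}}|\rho^{|\mathbf{k}|}$ is multiplicative; $D_{[0,\rho]}(N_0,K)$ is the completion. For $\rho_1<\rho_2$, $D_{[\rho_1,\rho_2]}(N_0,K,\alpha)$ is the generalized microlocalization at the powers of $b_\alpha$: the (unique) Banach algebra containing $D_{[0,\rho_2]}(N_0,K)$ in which $b_\alpha$ is invertible, to which $\|\cdot\|_{\rho_1},\|\cdot\|_{\rho_2}$ extend multiplicatively, whose topology is defined by $\max(\|\cdot\|_{\rho_1},\|\cdot\|_{\rho_2})$, and in which the elements $b_\alpha^{-l}x$ ($l\ge0$, $x\in D_{[0,\rho_2]}(N_0,K)$) are dense. $D_{[\rho_1,1)}(N_0,K,\alpha):=\varprojlim_{\rho_2\to1}D_{[\rho_1,\rho_2]}(N_0,K,\alpha)$ and $\mathfrak{R}_0(N_0,\alpha):=\varinjlim_{\rho_1\to1}D_{[\rho_1,1)}(N_0,K,\alpha)$. For $t\in T_+$, $\varphi_t(b_\alpha)$ is invertible in $D_{[\rho_1,1)}(N_0,K,\alpha)$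 for $\rho_1$ close enough to $1$; convergence of $\sum_{\mathbf{k}}c_{\mathbf{k}}\varphi_t(\mathbf{b})^{\mathbf{k}}$ in $\mathfrak{R}_0(N_0,\alpha)$ means (unconditional) convergence in $D_{[\rho_1,1)}(N_0,K,\alpha)$ for some $\rho_1<1$. The displayed equality in the claim is the paper's parametrization of the ring $\mathcal{R}(N_1,\ell)$ by Laurent series and may be taken as the definition of its underlying set. *)

theory Defs
  imports "HOL-Analysis.Analysis" "HOL-Computational_Algebra.Polynomial" "HOL-Algebra.Ring" "HOL-Algebra.Solvable_Groups"
begin

section \<open>The fields\<close>

text \<open>
  The library has no p-adic numbers.  The type \<open>'c\<close> plays the role of \<open>C_p\<close>, which is determined up
  to isometric isomorphism by: it is algebraically closed and complete for a non-archimedean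
  absolute value with \<open>|p| = 1/p\<close>, and the elements algebraic over the closure of the rationals are
  dense in it.  The absolute value is the distance to \<open>0\<close>: the library's \<open>norm\<close> is tied to real
  vector spaces.
\<close>

abbreviation vabs :: "'c::{zero, metric_space} \<Rightarrow> real" where
  "vabs x \<equiv> dist x 0"

definition Qp :: "'c::{field_char_0, metric_space} set" where
  "Qp = closure (range of_rat)"

definition Zp :: "'c::{field_char_0, metric_space} set" where
  "Zp = {x \<in> Qp. vabs x \<le> 1}"

definition is_Cp :: "nat \<Rightarrow> 'c::{alg_closed_field, field_char_0, complete_space} itself \<Rightarrow> bool" where
  "is_Cp p TC \<longleftrightarrow>
     prime p \<and>
     (\<forall>x y :: 'c. dist x y = vabs (x - y)) \<and>
     (\<forall>x y :: 'c. vabs (x * y) = vabs x * vabs y) \<and>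
     (\<forall>x y :: 'c. vabs (x + y) \<le> max (vabs x) (vabs y)) \<and>
     vabs (of_nat p :: 'c) = 1 / real p \<and>
     closure {x :: 'c. \<exists>q. q \<noteq> 0 \<and> (\<forall>i. coeff q i \<in> Qp) \<and> poly q x = 0} = UNIV"

definition finite_extension_of_Qp :: "'c::{field_char_0, metric_space} set \<Rightarrow> bool" where
  "finite_extension_of_Qp K \<longleftrightarrow>
     Qp \<subseteq> K \<and>
     (\<forall>x\<in>K. \<forall>y\<in>K. x + y \<in> K \<and> x * y \<in> K) \<and>
     (\<forall>x\<in>K. - x \<in> K \<and> inverse x \<in> K) \<and>
     (\<exists>B. finite B \<and> B \<subseteq> K \<and> (\<forall>x\<in>K. \<exists>a. (\<forall>b\<in>B. a b \<in> Qp) \<and> x = (\<Sum>b\<in>B. a b * b)))"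

text \<open>The admissible radii, i.e. the intersection of \<open>p^Q\<close> and the open interval from \<open>1/p\<close> to \<open>1\<close>.\<close>

definition radii :: "nat \<Rightarrow> real set" where
  "radii p = {\<rho>. 1 / real p < \<rho> \<and> \<rho> < 1 \<and> (\<exists>q\<in>\<rat>. \<rho> = real p powr q)}"


section \<open>Linear algebraic groups\<close>

text \<open>
  Linear algebraic groups are Zariski closed subgroups of \<open>GL_n\<close> over the algebraically closed field
  \<open>'c\<close>.  In characteristic 0, such a group is defined over a subfield \<open>F\<close> as soon as it is
  the zero set of polynomials with coefficients in \<open>F\<close>.
\<close>

definition GL :: "('c::field ^ 'n::finite ^ 'n) monoid" where
  "GL = \<lparr>carrier = {A. invertible A}, mult = (**), one = mat 1\<rparr>"

text \<open>The \<open>F\<close>-algebra of functions generated by a set \<open>X\<close> of functions.\<close>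

inductive_set poly_funs :: "'c::field set \<Rightarrow> ('x \<Rightarrow> 'c) set \<Rightarrow> ('x \<Rightarrow> 'c) set"
  for F X where
    const: "a \<in> F \<Longrightarrow> (\<lambda>_. a) \<in> poly_funs F X"
  | gen: "f \<in> X \<Longrightarrow> f \<in> poly_funs F X"
  | add: "f \<in> poly_funs F X \<Longrightarrow> g \<in> poly_funs F X \<Longrightarrow> (\<lambda>x. f x + g x) \<in> poly_funs F X"
  | mult: "f \<in> poly_funs F X \<Longrightarrow> g \<in> poly_funs F X \<Longrightarrow> (\<lambda>x. f x * g x) \<in> poly_funs F X"

definition entry_funs :: "('c::field ^ 'n::finite ^ 'n \<Rightarrow> 'c) set" where
  "entry_funs = {f. \<exists>i j. f = (\<lambda>A. A $ i $ j)}"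

definition GL_coords :: "('c::field ^ 'n::finite ^ 'n \<Rightarrow> 'c) set" where
  "GL_coords = insert (\<lambda>A. inverse (det A)) entry_funs"

definition zariski_closed :: "'c::field set \<Rightarrow> ('c ^ 'n::finite ^ 'n) set \<Rightarrow> bool" where
  "zariski_closed F S \<longleftrightarrow>
     (\<exists>E \<subseteq> poly_funs F entry_funs. S = {A \<in> carrier GL. \<forall>f\<in>E. f A = 0})"

definition alg_subgroup :: "'c::field set \<Rightarrow> ('c ^ 'n::finite ^ 'n) set \<Rightarrow> bool" where
  "alg_subgroup F H \<longleftrightarrow> subgroup H GL \<and> zariski_closed F H"

definition zariski_connected :: "('c::field ^ 'n::finite ^ 'n) set \<Rightarrow> bool" where
  "zariski_connected H \<longleftrightarrow>
     \<not> (\<exists>S1 S2. zariski_closed UNIV S1 \<and> zariski_closed UNIV S2 \<and> S1 \<noteq> {} \<and> S2 \<noteq> {} \<and>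
          S1 \<inter> S2 = {} \<and> S1 \<union> S2 = H)"

text \<open>\<open>H(Q_p)\<close>\<close>

definition Qp_points :: "('c::{field_char_0, metric_space} ^ 'n::finite ^ 'n) set \<Rightarrow> ('c ^ 'n ^ 'n) set" where
  "Qp_points H = {A \<in> H. \<forall>i j. A $ i $ j \<in> Qp}"

text \<open>
  Isomorphisms over \<open>F\<close> of algebraic groups \<open>D\<close> and \<open>E\<close> whose coordinate rings are generated by
  (the restrictions of) the functions \<open>X\<close> and \<open>Y\<close>.
\<close>

definition alg_iso :: "'c::field set \<Rightarrow> 'x monoid \<Rightarrow> ('x \<Rightarrow> 'c) set \<Rightarrow> 'y monoid \<Rightarrow> ('y \<Rightarrow> 'c) set \<Rightarrow> ('x \<Rightarrow> 'y) \<Rightarrow> bool" where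
  "alg_iso F D X E Y \<theta> \<longleftrightarrow>
     \<theta> \<in> iso D E \<and>
     (\<forall>f\<in>Y. \<exists>g\<in>poly_funs F X. \<forall>x\<in>carrier D. f (\<theta> x) = g x) \<and>
     (\<forall>g\<in>X. \<exists>f\<in>poly_funs F Y. \<forall>x\<in>carrier D. g x = f (\<theta> x))"

definition Ga :: "'c::field monoid" where
  "Ga = \<lparr>carrier = UNIV, mult = (+), one = 0\<rparr>"

text \<open>The \<open>d\<close>-fold power of \<open>G_m\<close>; tuples are padded with \<open>1\<close>.\<close>

definition Gm :: "nat \<Rightarrow> (nat \<Rightarrow> 'c::field) monoid" where
  "Gm d = \<lparr>carrier = {z. \<forall>i. z i \<noteq> 0 \<and> (d \<le> i \<longrightarrow> z i = 1)}, mult = (\<lambda>z w i. z i * w i), one = (\<lambda>_. 1)\<rparr>"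

definition Gm_coords :: "nat \<Rightarrow> ((nat \<Rightarrow> 'c::field) \<Rightarrow> 'c) set" where
  "Gm_coords d = (\<Union>i<d. {\<lambda>z. z i, \<lambda>z. inverse (z i)})"

text \<open>A torus over \<open>F\<close> that is split over \<open>F\<close>.\<close>

definition split_torus :: "'c::field set \<Rightarrow> ('c ^ 'n::finite ^ 'n) set \<Rightarrow> bool" where
  "split_torus F T \<longleftrightarrow> alg_subgroup F T \<and>
     (\<exists>d \<theta>. alg_iso F (Gm d) (Gm_coords d) (GL\<lparr>carrier := T\<rparr>) GL_coords \<theta>)"

text \<open>Over the algebraically closed field \<open>'c\<close> every torus is split, hence \<open>split_torus UNIV\<close> below.\<close>

definition maximal_split_torus :: "('c::{field_char_0, metric_space} ^ 'n::finite ^ 'n) set \<Rightarrow> ('c ^ 'n ^ 'n) set \<Rightarrow> bool" where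
  "maximal_split_torus G T \<longleftrightarrow> split_torus Qp T \<and> T \<subseteq> G \<and>
     (\<forall>T'. split_torus UNIV T' \<and> T' \<subseteq> G \<and> T \<subseteq> T' \<longrightarrow> T' = T)"

definition borel_subgroup :: "('c::field ^ 'n::finite ^ 'n) set \<Rightarrow> ('c ^ 'n ^ 'n) set \<Rightarrow> bool" where
  "borel_subgroup G P \<longleftrightarrow>
     (let solv = (\<lambda>H. alg_subgroup UNIV H \<and> H \<subseteq> G \<and> zariski_connected H \<and> solvable (GL\<lparr>carrier := H\<rparr>))
      in solv P \<and> (\<forall>H. solv H \<and> P \<subseteq> H \<longrightarrow> H = P))"

definition unipotent :: "'c::field ^ 'n::finite ^ 'n \<Rightarrow> bool" where
  "unipotent A \<longleftrightarrow> (\<exists>m::nat. (((**) (A - mat 1)) ^^ m) (mat 1) = 0)"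

definition unipotent_radical :: "('c::field ^ 'n::finite ^ 'n) set \<Rightarrow> ('c ^ 'n ^ 'n) set \<Rightarrow> bool" where
  "unipotent_radical H N \<longleftrightarrow>
     (let nu = (\<lambda>M. alg_subgroup UNIV M \<and> zariski_connected M \<and> M \<lhd> GL\<lparr>carrier := H\<rparr> \<and> (\<forall>A\<in>M. unipotent A))
      in nu N \<and> (\<forall>M. nu M \<longrightarrow> M \<subseteq> N))"

definition connected_reductive :: "('c::field ^ 'n::finite ^ 'n) set \<Rightarrow> bool" where
  "connected_reductive G \<longleftrightarrow> alg_subgroup UNIV G \<and> zariski_connected G \<and> unipotent_radical G {mat 1}"

definition group_centre :: "('c::field ^ 'n::finite ^ 'n) set \<Rightarrow> ('c ^ 'n ^ 'n) set" where
  "group_centre G = {A \<in> G. \<forall>B\<in>G. A ** B = B ** A}"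

text \<open>
  The Lie algebra: the tangent space at \<open>1\<close>, cut out by the differentials at \<open>1\<close> of the polynomials
  that vanish on \<open>H\<close>.  The differential of \<open>f\<close> in direction \<open>X\<close> is the linear coefficient of the
  polynomial \<open>s \<mapsto> f (1 + s X)\<close>.
\<close>

definition lie_algebra :: "('c::field_char_0 ^ 'n::finite ^ 'n) set \<Rightarrow> ('c ^ 'n ^ 'n) set" where
  "lie_algebra H =
     {X. \<forall>f\<in>poly_funs UNIV entry_funs. (\<forall>A\<in>H. f A = 0) \<longrightarrow>
          (\<forall>q. (\<forall>s. poly q s = f (\<chi> i j. mat 1 $ i $ j + s * X $ i $ j)) \<longrightarrow> coeff q 1 = 0)}"

text \<open>Algebraic characters of \<open>T\<close>, extensional on \<open>T\<close> so that equality of characters is equality in HOL.\<close>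

definition characters :: "('c::field ^ 'n::finite ^ 'n) set \<Rightarrow> ('c ^ 'n ^ 'n \<Rightarrow> 'c) set" where
  "characters T =
     {c \<in> extensional T. (\<forall>t\<in>T. c t \<noteq> 0) \<and> (\<forall>s\<in>T. \<forall>t\<in>T. c (s ** t) = c s * c t) \<and>
        (\<exists>f\<in>poly_funs UNIV GL_coords. \<forall>t\<in>T. c t = f t)}"

text \<open>The nonzero weights of \<open>T\<close> on \<open>Lie H\<close>.  For a Borel subgroup \<open>H\<close> these are the positive roots.\<close>

definition roots_of :: "('c::field_char_0 ^ 'n::finite ^ 'n) set \<Rightarrow> ('c ^ 'n ^ 'n) set \<Rightarrow> ('c ^ 'n ^ 'n \<Rightarrow> 'c) set" where
  "roots_of H T =
     {c \<in> characters T. (\<exists>t\<in>T. c t \<noteq> 1) \<and>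
        (\<exists>X\<in>lie_algebra H. X \<noteq> 0 \<and> (\<forall>t\<in>T. t ** X ** matrix_inv t = (\<chi> i j. c t * X $ i $ j)))}"

text \<open>
  \<open>\<Delta>\<close> is the base of the root system whose positive roots are \<open>\<Phi>\<close>: linearly independent in the
  character group, with every positive root an \<open>\<nat>\<close>-combination of elements of \<open>\<Delta>\<close>.  The last clause is
  the axiom that the root system is reduced; it holds for every split reductive group, so it does not
  restrict the setting.
\<close>

definition simple_roots ::
  "('c::field ^ 'n::finite ^ 'n) set \<Rightarrow> ('c ^ 'n ^ 'n \<Rightarrow> 'c) set \<Rightarrow> ('c ^ 'n ^ 'n \<Rightarrow> 'c) set \<Rightarrow> bool" where
  "simple_roots T \<Phi> \<Delta> \<longleftrightarrow>
     \<Delta> \<subseteq> \<Phi> \<and>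
     (\<forall>e :: _ \<Rightarrow> int. (\<forall>t\<in>T. (\<Prod>\<delta>\<in>\<Delta>. \<delta> t powi e \<delta>) = 1) \<longrightarrow> (\<forall>\<delta>\<in>\<Delta>. e \<delta> = 0)) \<and>
     (\<forall>\<beta>\<in>\<Phi>. \<exists>m :: _ \<Rightarrow> nat. \<forall>t\<in>T. \<beta> t = (\<Prod>\<delta>\<in>\<Delta>. \<delta> t ^ m \<delta>)) \<and>
     (\<forall>\<beta>\<in>\<Phi>. \<forall>\<gamma>\<in>\<Phi>. \<forall>m::nat. (\<forall>t\<in>T. \<gamma> t = \<beta> t ^ m) \<longrightarrow> m = 1)"

text \<open>The root subgroup of \<open>\<beta>\<close> is the image of an algebraic \<open>u\<close> with \<open>t u(x) t\<^sup>-\<^sup>1 = u(\<beta>(t) x)\<close>.\<close>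

definition root_subgroup ::
  "('c::{field_char_0, metric_space} ^ 'n::finite ^ 'n) set \<Rightarrow> ('c ^ 'n ^ 'n) set \<Rightarrow> ('c ^ 'n ^ 'n \<Rightarrow> 'c) \<Rightarrow> ('c ^ 'n ^ 'n) set \<Rightarrow> bool" where
  "root_subgroup H T \<beta> U \<longleftrightarrow> alg_subgroup Qp U \<and> U \<subseteq> H \<and>
     (\<exists>u. alg_iso Qp Ga {\<lambda>x. x} (GL\<lparr>carrier := U\<rparr>) GL_coords u \<and>
          (\<forall>t\<in>T. \<forall>x. t ** u x ** matrix_inv t = u (\<beta> t * x)))"

text \<open>Product in a fixed order.\<close>

definition ordprod :: "('a, 'm) monoid_scheme \<Rightarrow> ('r \<Rightarrow> 'a) \<Rightarrow> 'r list \<Rightarrow> 'a" where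
  "ordprod M f bs = foldr (\<lambda>\<beta> acc. f \<beta> \<otimes>\<^bsub>M\<^esub> acc) bs \<one>\<^bsub>M\<^esub>"

text \<open>
  The standing setting.  \<open>G\<close>, \<open>T\<close>, \<open>P\<close>, \<open>N\<close> and the \<open>U \<beta>\<close> are algebraic groups; the groups of
  \<open>Q_p\<close>-points are obtained with \<open>Qp_points\<close>.
\<close>

definition split_reductive_setting ::
  "('c::{field_char_0, metric_space} ^ 'n::finite ^ 'n) set \<Rightarrow> ('c ^ 'n ^ 'n) set \<Rightarrow> ('c ^ 'n ^ 'n) set \<Rightarrow> ('c ^ 'n ^ 'n) set \<Rightarrow>
   ('c ^ 'n ^ 'n \<Rightarrow> 'c) set \<Rightarrow> ('c ^ 'n ^ 'n \<Rightarrow> 'c) set \<Rightarrow> (('c ^ 'n ^ 'n \<Rightarrow> 'c) \<Rightarrow> ('c ^ 'n ^ 'n) set) \<Rightarrow> bool" where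
  "split_reductive_setting G T P N \<Phi> \<Delta> U \<longleftrightarrow>
     alg_subgroup Qp G \<and> connected_reductive G \<and> zariski_connected (group_centre G) \<and>
     maximal_split_torus G T \<and>
     alg_subgroup Qp P \<and> borel_subgroup G P \<and> T \<subseteq> P \<and>
     unipotent_radical P N \<and> P = T <#>\<^bsub>GL\<^esub> N \<and>
     \<Phi> = roots_of P T \<and> simple_roots T \<Phi> \<Delta> \<and>
     (\<forall>\<beta>\<in>\<Phi>. root_subgroup N T \<beta> (U \<beta>))"

text \<open>\<open>\<iota>\<close> is the coordinate \<open>\<iota>_\<alpha>\<close> on \<open>U(Q_p)\<close>, with \<open>U\<close> the root subgroup of \<open>\<alpha>\<close>.\<close>

definition root_coordinate ::
  "('c::{field_char_0, metric_space} ^ 'n::finite ^ 'n) set \<Rightarrow> ('c ^ 'n ^ 'n \<Rightarrow> 'c) \<Rightarrow> ('c ^ 'n ^ 'n) set \<Rightarrow> ('c ^ 'n ^ 'n) set \<Rightarrow> ('c ^ 'n ^ 'n \<Rightarrow> 'c) \<Rightarrow> bool" where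
  "root_coordinate T \<alpha> U N0 \<iota> \<longleftrightarrow>
     bij_betw \<iota> (Qp_points U) Qp \<and>
     continuous_on (Qp_points U) \<iota> \<and> continuous_on Qp (inv_into (Qp_points U) \<iota>) \<and>
     (\<forall>x\<in>Qp_points U. \<forall>y\<in>Qp_points U. \<iota> (x ** y) = \<iota> x + \<iota> y) \<and>
     (\<forall>t\<in>Qp_points T. \<forall>x\<in>Qp_points U. \<iota> (t ** x ** matrix_inv t) = \<alpha> t * \<iota> x) \<and>
     \<iota> ` (N0 \<inter> U) = Zp"

text \<open>
  \<open>\<ell>\<close> is the composite of \<open>N \<rightarrow> N/[N,N]\<close>, the identification of \<open>N/[N,N]\<close> with the product of the simple
  root subgroups, the projection to the root subgroup of \<open>\<alpha>\<close>, and \<open>\<iota>\<close>.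
\<close>

definition ell_map ::
  "('c::{field_char_0, metric_space} ^ 'n::finite ^ 'n) set \<Rightarrow> ('c ^ 'n ^ 'n \<Rightarrow> 'c) set \<Rightarrow> (('c ^ 'n ^ 'n \<Rightarrow> 'c) \<Rightarrow> ('c ^ 'n ^ 'n) set) \<Rightarrow>
   ('c ^ 'n ^ 'n \<Rightarrow> 'c) \<Rightarrow> ('c ^ 'n ^ 'n \<Rightarrow> 'c) \<Rightarrow> ('c ^ 'n ^ 'n \<Rightarrow> 'c) \<Rightarrow> bool" where
  "ell_map N \<Delta> U \<alpha> \<iota> l \<longleftrightarrow>
     (\<forall>x\<in>Qp_points N. \<forall>y\<in>Qp_points N. l (x ** y) = l x + l y) \<and>
     (\<forall>x\<in>derived GL (Qp_points N). l x = 0) \<and>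
     (\<forall>\<beta>\<in>\<Delta> - {\<alpha>}. \<forall>x\<in>Qp_points (U \<beta>). l x = 0) \<and>
     (\<forall>x\<in>Qp_points (U \<alpha>). l x = \<iota> x)"


section \<open>Uniform pro-p groups\<close>

definition topological_group :: "'g::topological_space monoid \<Rightarrow> bool" where
  "topological_group M \<longleftrightarrow> group M \<and>
     continuous_on (carrier M \<times> carrier M) (\<lambda>(x, y). x \<otimes>\<^bsub>M\<^esub> y) \<and>
     continuous_on (carrier M) (\<lambda>x. inv\<^bsub>M\<^esub> x)"

definition pro_p_group :: "nat \<Rightarrow> 'g::topological_space monoid \<Rightarrow> bool" where
  "pro_p_group p M \<longleftrightarrow> topological_group M \<and> compact (carrier M) \<and>
     (\<forall>S \<subseteq> carrier M. connected S \<longrightarrow> (\<exists>x. S \<subseteq> {x})) \<and>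
     (\<forall>H. H \<lhd> M \<and> openin (top_of_set (carrier M)) H \<longrightarrow> (\<exists>m. card (rcosets\<^bsub>M\<^esub> H) = p ^ m))"

definition closed_gen :: "'g::topological_space monoid \<Rightarrow> 'g set \<Rightarrow> 'g set" where
  "closed_gen M S = carrier M \<inter> closure (generate M S)"

primrec lower_p_series :: "nat \<Rightarrow> 'g::topological_space monoid \<Rightarrow> nat \<Rightarrow> 'g set" where
  "lower_p_series p M 0 = carrier M"
| "lower_p_series p M (Suc i) =
     closed_gen M ({x [^]\<^bsub>M\<^esub> p |x. x \<in> lower_p_series p M i} \<union>
        {x \<otimes>\<^bsub>M\<^esub> y \<otimes>\<^bsub>M\<^esub> inv\<^bsub>M\<^esub> x \<otimes>\<^bsub>M\<^esub> inv\<^bsub>M\<^esub> y |x y. x \<in> lower_p_series p M i \<and> y \<in> carrier M})"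

definition uniform_pro_p_group :: "nat \<Rightarrow> 'g::topological_space monoid \<Rightarrow> bool" where
  "uniform_pro_p_group p M \<longleftrightarrow> pro_p_group p M \<and>
     (\<exists>S. finite S \<and> S \<subseteq> carrier M \<and> closed_gen M S = carrier M) \<and>
     derived M (carrier M) \<subseteq> closed_gen M {x [^]\<^bsub>M\<^esub> (if p = 2 then 4 else p) |x. x \<in> carrier M} \<and>
     (\<forall>i. card (rcosets\<^bsub>M\<lparr>carrier := lower_p_series p M i\<rparr>\<^esub> (lower_p_series p M (Suc i))) =
          card (rcosets\<^bsub>M\<^esub> (lower_p_series p M 1)))"

definition standard_open_subgroup ::
  "nat \<Rightarrow> ('c::{field_char_0, metric_space} ^ 'n::finite ^ 'n) set \<Rightarrow> 'r set \<Rightarrow> ('r \<Rightarrow> ('c ^ 'n ^ 'n) set) \<Rightarrow> ('c ^ 'n ^ 'n) set \<Rightarrow> bool" where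
  "standard_open_subgroup p N \<Phi> U N0 \<longleftrightarrow>
     subgroup N0 GL \<and> N0 \<subseteq> Qp_points N \<and> compact N0 \<and> openin (top_of_set (Qp_points N)) N0 \<and>
     (\<forall>bs. distinct bs \<and> set bs = \<Phi> \<longrightarrow>
        bij_betw (\<lambda>f. ordprod GL f bs) (\<Pi>\<^sub>E \<beta>\<in>\<Phi>. N0 \<inter> U \<beta>) N0) \<and>
     uniform_pro_p_group p (GL\<lparr>carrier := N0\<rparr>)"

definition T_plus ::
  "('c::{field_char_0, metric_space} ^ 'n::finite ^ 'n) set \<Rightarrow> ('c ^ 'n ^ 'n) set \<Rightarrow> ('c ^ 'n ^ 'n) set" where
  "T_plus T N0 = {t \<in> Qp_points T. (\<lambda>x. t ** x ** matrix_inv t) ` N0 \<subseteq> N0}"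


section \<open>Distribution algebras\<close>

text \<open>
  From here on \<open>bs\<close> is the list of positive roots in the fixed order and \<open>gen \<beta>\<close> is the topological
  generator \<open>n_\<beta>\<close>.  Multi-indices are functions on all of \<open>'r\<close> that vanish outside \<open>set bs\<close>, and a
  series in the monomials \<open>b^k\<close> is given by its coefficient function.
\<close>

text \<open>The p-adic power \<open>g^x\<close>: the limit of \<open>g^m\<close> for natural numbers \<open>m\<close> tending to \<open>x\<close>.\<close>

definition padic_power :: "'c::{field_char_0, metric_space} ^ 'n::finite ^ 'n \<Rightarrow> 'c \<Rightarrow> 'c ^ 'n ^ 'n" where
  "padic_power g x = Lim (filtercomap of_nat (nhds x)) (\<lambda>m::nat. g [^]\<^bsub>GL\<^esub> m)"

text \<open>Coordinates of the second kind: \<open>g\<close> is the ordered product of the \<open>n_\<beta>^x_\<beta>\<close>.\<close>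

definition coords ::
  "'r list \<Rightarrow> ('r \<Rightarrow> 'c::{field_char_0, metric_space} ^ 'n::finite ^ 'n) \<Rightarrow> 'c ^ 'n ^ 'n \<Rightarrow> 'r \<Rightarrow> 'c" where
  "coords bs gen g = (THE x. (\<forall>\<beta>\<in>set bs. x \<beta> \<in> Zp) \<and> (\<forall>\<beta>. \<beta> \<notin> set bs \<longrightarrow> x \<beta> = 0) \<and>
      g = ordprod GL (\<lambda>\<beta>. padic_power (gen \<beta>) (x \<beta>)) bs)"

definition indices :: "'r list \<Rightarrow> ('r \<Rightarrow> nat) set" where
  "indices bs = {k. \<forall>\<beta>. \<beta> \<notin> set bs \<longrightarrow> k \<beta> = 0}"

definition total_degree :: "'r list \<Rightarrow> ('r \<Rightarrow> nat) \<Rightarrow> nat" where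
  "total_degree bs k = (\<Sum>\<beta>\<in>set bs. k \<beta>)"

text \<open>The Dirac distribution of \<open>g\<close>, expanded by \<open>n_\<beta>^x = (1 + b_\<beta>)^x\<close>.\<close>

definition dirac ::
  "'r list \<Rightarrow> ('r \<Rightarrow> 'c::{field_char_0, metric_space} ^ 'n::finite ^ 'n) \<Rightarrow> 'c ^ 'n ^ 'n \<Rightarrow> ('r \<Rightarrow> nat) \<Rightarrow> 'c" where
  "dirac bs gen g = (\<lambda>k. if k \<in> indices bs then \<Prod>\<beta>\<in>set bs. coords bs gen g \<beta> gchoose k \<beta> else 0)"

definition scalar :: "'c::zero \<Rightarrow> ('r \<Rightarrow> nat) \<Rightarrow> 'c" where
  "scalar a = (\<lambda>k. if k = (\<lambda>_. 0) then a else 0)"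

definition generator_power ::
  "'r list \<Rightarrow> ('r \<Rightarrow> 'c::field ^ 'n::finite ^ 'n) \<Rightarrow> ('r \<Rightarrow> nat) \<Rightarrow> 'c ^ 'n ^ 'n" where
  "generator_power bs gen k = ordprod GL (\<lambda>\<beta>. gen \<beta> [^]\<^bsub>GL\<^esub> k \<beta>) bs"

text \<open>The coefficient of \<open>n^i\<close> in the binomial expansion of \<open>b^k\<close>, \<open>b_\<beta> = n_\<beta> - 1\<close>.\<close>

definition binomial_coeff :: "'r list \<Rightarrow> ('r \<Rightarrow> nat) \<Rightarrow> ('r \<Rightarrow> nat) \<Rightarrow> 'c::comm_ring_1" where
  "binomial_coeff bs k i = (\<Prod>\<beta>\<in>set bs. (- 1) ^ (k \<beta> - i \<beta>) * of_nat (k \<beta> choose i \<beta>))"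

text \<open>
  The product \<open>b^k b^l\<close>, obtained by expanding both factors in Dirac distributions and multiplying
  these in the group ring of \<open>N_0\<close>.
\<close>

definition monomial_product ::
  "'r list \<Rightarrow> ('r \<Rightarrow> 'c::{field_char_0, metric_space} ^ 'n::finite ^ 'n) \<Rightarrow> ('r \<Rightarrow> nat) \<Rightarrow> ('r \<Rightarrow> nat) \<Rightarrow> ('r \<Rightarrow> nat) \<Rightarrow> 'c" where
  "monomial_product bs gen k l m =
     (\<Sum>i\<in>{..k}. \<Sum>j\<in>{..l}. binomial_coeff bs k i * binomial_coeff bs l j *
        dirac bs gen (generator_power bs gen i ** generator_power bs gen j) m)"

definition convolution ::
  "'r list \<Rightarrow> ('r \<Rightarrow> 'c::{field_char_0, metric_space} ^ 'n::finite ^ 'n) \<Rightarrow> (('r \<Rightarrow> nat) \<Rightarrow> 'c) \<Rightarrow> (('r \<Rightarrow> nat) \<Rightarrow> 'c) \<Rightarrow> ('r \<Rightarrow> nat) \<Rightarrow> 'c" where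
  "convolution bs gen d e m =
     infsum (\<lambda>(k, l). d k * e l * monomial_product bs gen k l m) (indices bs \<times> indices bs)"

definition coeff_families :: "'c::zero set \<Rightarrow> 'r list \<Rightarrow> (('r \<Rightarrow> nat) \<Rightarrow> 'c) set" where
  "coeff_families K bs = {d. (\<forall>k. d k \<in> K) \<and> (\<forall>k. k \<notin> indices bs \<longrightarrow> d k = 0)}"

definition bounded_at :: "'r list \<Rightarrow> real \<Rightarrow> (('r \<Rightarrow> nat) \<Rightarrow> 'c::{zero, metric_space}) \<Rightarrow> bool" where
  "bounded_at bs \<rho> d \<longleftrightarrow> bdd_above ((\<lambda>k. vabs (d k) * \<rho> ^ total_degree bs k) ` indices bs)"

definition dist_rnorm :: "'r list \<Rightarrow> real \<Rightarrow> (('r \<Rightarrow> nat) \<Rightarrow> 'c::{zero, metric_space}) \<Rightarrow> real" where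
  "dist_rnorm bs \<rho> d = (SUP k\<in>indices bs. vabs (d k) * \<rho> ^ total_degree bs k)"

text \<open>\<open>D(N_0, K)\<close>\<close>

definition distributions :: "'c::{zero, metric_space} set \<Rightarrow> 'r list \<Rightarrow> (('r \<Rightarrow> nat) \<Rightarrow> 'c) set" where
  "distributions K bs = {d \<in> coeff_families K bs. \<forall>\<rho>. 0 < \<rho> \<and> \<rho> < 1 \<longrightarrow> bounded_at bs \<rho> d}"

text \<open>
  \<open>D_[0,\<rho>](N_0, K)\<close>: the completion is realized as the closure of \<open>D(N_0, K)\<close> in the Banach space of all
  families that are bounded at \<open>\<rho>\<close>.
\<close>

definition distribution_ring ::
  "'c::{field_char_0, metric_space} set \<Rightarrow> 'r list \<Rightarrow> ('r \<Rightarrow> 'c ^ 'n::finite ^ 'n) \<Rightarrow> real \<Rightarrow> (('r \<Rightarrow> nat) \<Rightarrow> 'c) ring" where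
  "distribution_ring K bs gen \<rho> =
     \<lparr>carrier = {d \<in> coeff_families K bs. bounded_at bs \<rho> d \<and>
         (\<forall>\<epsilon>>0. \<exists>d'\<in>distributions K bs. dist_rnorm bs \<rho> (\<lambda>k. d k - d' k) < \<epsilon>)},
      mult = convolution bs gen, one = scalar 1, zero = (\<lambda>_. 0), add = (\<lambda>d e k. d k + e k)\<rparr>"

text \<open>\<open>\<phi>_t(b_\<beta>) = t n_\<beta> t\<^sup>-\<^sup>1 - 1\<close>; the case \<open>t = 1\<close> is \<open>b_\<beta>\<close>.\<close>

definition phi_b ::
  "'r list \<Rightarrow> ('r \<Rightarrow> 'c::{field_char_0, metric_space} ^ 'n::finite ^ 'n) \<Rightarrow> 'c ^ 'n ^ 'n \<Rightarrow> 'r \<Rightarrow> ('r \<Rightarrow> nat) \<Rightarrow> 'c" where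
  "phi_b bs gen t \<beta> = (\<lambda>k. dirac bs gen (t ** gen \<beta> ** matrix_inv t) k - scalar 1 k)"


section \<open>Generalized microlocalizations\<close>

record 'a normed_ring = "'a ring" +
  rnorm :: "real \<Rightarrow> 'a \<Rightarrow> real"

definition multiplicative_rnorm :: "'a normed_ring \<Rightarrow> real \<Rightarrow> bool" where
  "multiplicative_rnorm A \<rho> \<longleftrightarrow>
     (\<forall>x\<in>carrier A. 0 \<le> rnorm A \<rho> x \<and> (rnorm A \<rho> x = 0 \<longleftrightarrow> x = \<zero>\<^bsub>A\<^esub>)) \<and>
     (\<forall>x\<in>carrier A. \<forall>y\<in>carrier A. rnorm A \<rho> (x \<oplus>\<^bsub>A\<^esub> y) \<le> max (rnorm A \<rho> x) (rnorm A \<rho> y) \<and>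
        rnorm A \<rho> (x \<otimes>\<^bsub>A\<^esub> y) = rnorm A \<rho> x * rnorm A \<rho> y)"

text \<open>The value outside the carrier is irrelevant; \<open>0\<close> is what the locale \<open>Metric_space\<close> needs.\<close>

definition max_dist :: "'a normed_ring \<Rightarrow> real \<Rightarrow> real \<Rightarrow> 'a \<Rightarrow> 'a \<Rightarrow> real" where
  "max_dist A \<rho>1 \<rho>2 x y =
     (if x \<in> carrier A \<and> y \<in> carrier A
      then max (rnorm A \<rho>1 (x \<ominus>\<^bsub>A\<^esub> y)) (rnorm A \<rho>2 (x \<ominus>\<^bsub>A\<^esub> y)) else 0)"

definition max_topology :: "'a normed_ring \<Rightarrow> real \<Rightarrow> real \<Rightarrow> 'a topology" where
  "max_topology A \<rho>1 \<rho>2 = Metric_space.mtopology (carrier A) (max_dist A \<rho>1 \<rho>2)"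

text \<open>
  \<open>A\<close> is \<open>D_[\<rho>1,\<rho>2](N_0, K, \<alpha>)\<close>, where \<open>emb\<close> is the inclusion of \<open>D_[0,\<rho>2](N_0, K)\<close>.  The \<open>K\<close>-algebra
  structure is multiplication by the images of scalars: these are central by density, and the norms
  are homogeneous because they are multiplicative.
\<close>

definition microlocalization ::
  "'c::{field_char_0, metric_space} set \<Rightarrow> 'r list \<Rightarrow> ('r \<Rightarrow> 'c ^ 'n::finite ^ 'n) \<Rightarrow> 'r \<Rightarrow> real \<Rightarrow> real \<Rightarrow>
   'a normed_ring \<Rightarrow> ((('r \<Rightarrow> nat) \<Rightarrow> 'c) \<Rightarrow> 'a) \<Rightarrow> bool" where
  "microlocalization K bs gen \<alpha> \<rho>1 \<rho>2 A emb \<longleftrightarrow>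
     (let D = distribution_ring K bs gen \<rho>2; b\<alpha> = emb (phi_b bs gen (mat 1) \<alpha>) in
      ring A \<and> emb \<in> ring_hom D A \<and> inj_on emb (carrier D) \<and>
      b\<alpha> \<in> Units A \<and>
      (\<forall>\<rho>\<in>{\<rho>1, \<rho>2}. multiplicative_rnorm A \<rho> \<and> (\<forall>d\<in>carrier D. rnorm A \<rho> (emb d) = dist_rnorm bs \<rho> d)) \<and>
      Metric_space.mcomplete (carrier A) (max_dist A \<rho>1 \<rho>2) \<and>
      max_topology A \<rho>1 \<rho>2 closure_of {inv\<^bsub>A\<^esub> b\<alpha> [^]\<^bsub>A\<^esub> l \<otimes>\<^bsub>A\<^esub> emb d |(l::nat) d. d \<in> carrier D} = carrier A)"

text \<open>
  A choice \<open>A \<rho>1 \<rho>2\<close> of all these algebras (each unique up to unique isomorphism), together with the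
  transition maps \<open>res \<rho>1 \<rho>2 \<rho>3\<close> from \<open>D_[\<rho>1,\<rho>3]\<close> to \<open>D_[\<rho>1,\<rho>2]\<close>, the continuous extensions of the
  inclusion of \<open>D_[0,\<rho>3]\<close> in \<open>D_[0,\<rho>2]\<close>.
\<close>

definition microlocalization_system ::
  "nat \<Rightarrow> 'c::{field_char_0, metric_space} set \<Rightarrow> 'r list \<Rightarrow> ('r \<Rightarrow> 'c ^ 'n::finite ^ 'n) \<Rightarrow> 'r \<Rightarrow>
   (real \<Rightarrow> real \<Rightarrow> 'a normed_ring) \<Rightarrow> (real \<Rightarrow> real \<Rightarrow> (('r \<Rightarrow> nat) \<Rightarrow> 'c) \<Rightarrow> 'a) \<Rightarrow>
   (real \<Rightarrow> real \<Rightarrow> real \<Rightarrow> 'a \<Rightarrow> 'a) \<Rightarrow> bool" where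
  "microlocalization_system p K bs gen \<alpha> A emb res \<longleftrightarrow>
     (\<forall>\<rho>1\<in>radii p. \<forall>\<rho>2\<in>radii p. \<rho>1 < \<rho>2 \<longrightarrow>
        microlocalization K bs gen \<alpha> \<rho>1 \<rho>2 (A \<rho>1 \<rho>2) (emb \<rho>1 \<rho>2)) \<and>
     (\<forall>\<rho>1\<in>radii p. \<forall>\<rho>2\<in>radii p. \<forall>\<rho>3\<in>radii p. \<rho>1 < \<rho>2 \<and> \<rho>2 < \<rho>3 \<longrightarrow>
        res \<rho>1 \<rho>2 \<rho>3 \<in> ring_hom (A \<rho>1 \<rho>3) (A \<rho>1 \<rho>2) \<and>
        continuous_map (max_topology (A \<rho>1 \<rho>3) \<rho>1 \<rho>3) (max_topology (A \<rho>1 \<rho>2) \<rho>1 \<rho>2) (res \<rho>1 \<rho>2 \<rho>3) \<and>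
        (\<forall>d\<in>carrier (distribution_ring K bs gen \<rho>3). res \<rho>1 \<rho>2 \<rho>3 (emb \<rho>1 \<rho>3 d) = emb \<rho>1 \<rho>2 d))"

definition radii_above :: "nat \<Rightarrow> real \<Rightarrow> real set" where
  "radii_above p \<rho>1 = {\<rho>2 \<in> radii p. \<rho>1 < \<rho>2}"

text \<open>The projective limit \<open>D_[\<rho>1,1)(N_0, K, \<alpha>)\<close>, as a ring and with its topology.\<close>

definition limit_ring ::
  "nat \<Rightarrow> (real \<Rightarrow> real \<Rightarrow> 'a normed_ring) \<Rightarrow> (real \<Rightarrow> real \<Rightarrow> real \<Rightarrow> 'a \<Rightarrow> 'a) \<Rightarrow> real \<Rightarrow> (real \<Rightarrow> 'a) ring" where
  "limit_ring p A res \<rho>1 =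
     \<lparr>carrier = {x \<in> \<Pi>\<^sub>E \<rho>2\<in>radii_above p \<rho>1. carrier (A \<rho>1 \<rho>2).
         \<forall>\<rho>2\<in>radii_above p \<rho>1. \<forall>\<rho>3\<in>radii_above p \<rho>1. \<rho>2 < \<rho>3 \<longrightarrow> res \<rho>1 \<rho>2 \<rho>3 (x \<rho>3) = x \<rho>2},
      mult = (\<lambda>x y. \<lambda>\<rho>2\<in>radii_above p \<rho>1. x \<rho>2 \<otimes>\<^bsub>A \<rho>1 \<rho>2\<^esub> y \<rho>2),
      one = (\<lambda>\<rho>2\<in>radii_above p \<rho>1. \<one>\<^bsub>A \<rho>1 \<rho>2\<^esub>),
      zero = (\<lambda>\<rho>2\<in>radii_above p \<rho>1. \<zero>\<^bsub>A \<rho>1 \<rho>2\<^esub>),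
      add = (\<lambda>x y. \<lambda>\<rho>2\<in>radii_above p \<rho>1. x \<rho>2 \<oplus>\<^bsub>A \<rho>1 \<rho>2\<^esub> y \<rho>2)\<rparr>"

definition limit_topology ::
  "nat \<Rightarrow> (real \<Rightarrow> real \<Rightarrow> 'a normed_ring) \<Rightarrow> (real \<Rightarrow> real \<Rightarrow> real \<Rightarrow> 'a \<Rightarrow> 'a) \<Rightarrow> real \<Rightarrow> (real \<Rightarrow> 'a) topology" where
  "limit_topology p A res \<rho>1 =
     subtopology (product_topology (\<lambda>\<rho>2. max_topology (A \<rho>1 \<rho>2) \<rho>1 \<rho>2) (radii_above p \<rho>1))
       (carrier (limit_ring p A res \<rho>1))"

definition limit_emb ::
  "nat \<Rightarrow> (real \<Rightarrow> real \<Rightarrow> (('r \<Rightarrow> nat) \<Rightarrow> 'c) \<Rightarrow> 'a) \<Rightarrow> real \<Rightarrow> (('r \<Rightarrow> nat) \<Rightarrow> 'c) \<Rightarrow> real \<Rightarrow> 'a" where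
  "limit_emb p emb \<rho>1 d = (\<lambda>\<rho>2\<in>radii_above p \<rho>1. emb \<rho>1 \<rho>2 d)"

definition unconditionally_convergent :: "('a, 'm) ring_scheme \<Rightarrow> 'a topology \<Rightarrow> ('i \<Rightarrow> 'a) \<Rightarrow> 'i set \<Rightarrow> bool" where
  "unconditionally_convergent R X f I \<longleftrightarrow>
     (\<exists>s. limitin X (\<lambda>F. finsum R f F) s (finite_subsets_at_top I))"


section \<open>Laurent series\<close>

definition laurent_indices :: "'r list \<Rightarrow> 'r \<Rightarrow> ('r \<Rightarrow> int) set" where
  "laurent_indices bs \<alpha> = {k. (\<forall>\<beta>\<in>set bs - {\<alpha>}. 0 \<le> k \<beta>) \<and> (\<forall>\<beta>. \<beta> \<notin> set bs \<longrightarrow> k \<beta> = 0)}"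

definition laurent_series :: "'c::zero set \<Rightarrow> 'r list \<Rightarrow> 'r \<Rightarrow> (('r \<Rightarrow> int) \<Rightarrow> 'c) set" where
  "laurent_series K bs \<alpha> = {c. (\<forall>k. c k \<in> K) \<and> (\<forall>k. k \<notin> laurent_indices bs \<alpha> \<longrightarrow> c k = 0)}"

text \<open>
  The term \<open>c_k \<phi>_t(b)^k\<close> in \<open>D_[\<rho>1,1)(N_0, K, \<alpha>)\<close>.  A negative power occurs only for \<open>\<alpha>\<close> and
  is meaningful only where \<open>\<phi>_t(b_\<alpha>)\<close> is invertible, which the next definition demands.
\<close>

definition laurent_term ::
  "nat \<Rightarrow> 'r list \<Rightarrow> ('r \<Rightarrow> 'c::{field_char_0, metric_space} ^ 'n::finite ^ 'n) \<Rightarrow>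
   (real \<Rightarrow> real \<Rightarrow> 'a normed_ring) \<Rightarrow> (real \<Rightarrow> real \<Rightarrow> (('r \<Rightarrow> nat) \<Rightarrow> 'c) \<Rightarrow> 'a) \<Rightarrow>
   (real \<Rightarrow> real \<Rightarrow> real \<Rightarrow> 'a \<Rightarrow> 'a) \<Rightarrow> real \<Rightarrow> 'c ^ 'n ^ 'n \<Rightarrow> (('r \<Rightarrow> int) \<Rightarrow> 'c) \<Rightarrow> ('r \<Rightarrow> int) \<Rightarrow> real \<Rightarrow> 'a" where
  "laurent_term p bs gen A emb res \<rho>1 t c k =
     (let R = limit_ring p A res \<rho>1 in
      limit_emb p emb \<rho>1 (scalar (c k)) \<otimes>\<^bsub>R\<^esub>
        ordprod R (\<lambda>\<beta>. limit_emb p emb \<rho>1 (phi_b bs gen t \<beta>) [^]\<^bsub>R\<^esub> k \<beta>) bs)"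

definition converges_in_R0 ::
  "nat \<Rightarrow> 'r list \<Rightarrow> ('r \<Rightarrow> 'c::{field_char_0, metric_space} ^ 'n::finite ^ 'n) \<Rightarrow> 'r \<Rightarrow>
   (real \<Rightarrow> real \<Rightarrow> 'a normed_ring) \<Rightarrow> (real \<Rightarrow> real \<Rightarrow> (('r \<Rightarrow> nat) \<Rightarrow> 'c) \<Rightarrow> 'a) \<Rightarrow>
   (real \<Rightarrow> real \<Rightarrow> real \<Rightarrow> 'a \<Rightarrow> 'a) \<Rightarrow> 'c ^ 'n ^ 'n \<Rightarrow> (('r \<Rightarrow> int) \<Rightarrow> 'c) \<Rightarrow> bool" where
  "converges_in_R0 p bs gen \<alpha> A emb res t c \<longleftrightarrow>
     (\<exists>\<rho>1\<in>radii p.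
        limit_emb p emb \<rho>1 (phi_b bs gen t \<alpha>) \<in> Units (limit_ring p A res \<rho>1) \<and>
        unconditionally_convergent (limit_ring p A res \<rho>1) (limit_topology p A res \<rho>1)
          (laurent_term p bs gen A emb res \<rho>1 t c) (laurent_indices bs \<alpha>))"

text \<open>The underlying set of \<open>\<R>(N_1, \<ell>)\<close>; \<open>T\<close> and \<open>N0\<close> enter through \<open>T_+\<close>.\<close>

definition Robba_N1_ell ::
  "nat \<Rightarrow> 'c::{field_char_0, metric_space} set \<Rightarrow> ('c ^ 'n::finite ^ 'n) set \<Rightarrow> ('c ^ 'n ^ 'n) set \<Rightarrow>
   'r list \<Rightarrow> ('r \<Rightarrow> 'c ^ 'n ^ 'n) \<Rightarrow> 'r \<Rightarrow>
   (real \<Rightarrow> real \<Rightarrow> 'a normed_ring) \<Rightarrow> (real \<Rightarrow> real \<Rightarrow> (('r \<Rightarrow> nat) \<Rightarrow> 'c) \<Rightarrow> 'a) \<Rightarrow>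
   (real \<Rightarrow> real \<Rightarrow> real \<Rightarrow> 'a \<Rightarrow> 'a) \<Rightarrow> (('r \<Rightarrow> int) \<Rightarrow> 'c) set" where
  "Robba_N1_ell p K T N0 bs gen \<alpha> A emb res =
     (\<Union>t\<in>T_plus T N0. {c \<in> laurent_series K bs \<alpha>. converges_in_R0 p bs gen \<alpha> A emb res t c})"

end

theory Submission
  imports Defs
begin

text \<open>
  For \<open>t\<close> in \<open>T_+\<close> one has \<open>\<phi>_t(b_\<beta>) = (1 + b_\<beta>)^x - 1\<close> with \<open>x = \<beta>(t)\<close> a nonzero p-adic integer, so the
  \<open>\<rho>\<close>-norm of \<open>\<phi>_t(b_\<beta>)\<close> is the supremum of \<open>\<bar>x choose n\<bar> \<rho>^n\<close> over \<open>n > 0\<close>.  It is at most \<open>\<rho>\<close>, and at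
  least \<open>\<rho>^q\<close> for \<open>q = 1 / \<bar>x\<bar>\<close>, because \<open>x choose q\<close> is a unit.  The norms being multiplicative,
  unconditional convergence means that \<open>\<bar>c_k\<bar>\<close> times the product of the \<open>\<parallel>\<phi>_t(b_\<beta>)\<parallel>_\<rho> ^ k_\<beta>\<close> tends to \<open>0\<close>
  for all \<open>\<rho>\<close> close to \<open>1\<close>.

  If this holds for some \<open>t\<close> and if \<open>r\<close> is large, then every monomial at a point \<open>z\<close> of the region is
  dominated by the maximum of the terms at two radii \<open>\<rho>\<close>, chosen such that
  \<open>\<parallel>\<phi>_t(b_\<alpha>)\<parallel>_\<rho>\<close> lies below \<open>\<bar>z_\<alpha>\<bar>\<close> for one and above it for the other.  Conversely, linear
  independence of the simple roots yields \<open>t\<close> with \<open>\<alpha>(t) = 1\<close> and \<open>\<beta>(t) = p^m\<close>, \<open>m \<ge> r\<close>, for the other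
  positive roots.  Then \<open>\<phi>_t(b_\<alpha>) = b_\<alpha>\<close> has norm \<open>\<rho>\<close>, and since \<open>p\<close> divides \<open>p^m choose n\<close> for
  \<open>0 < n < p^m\<close>, the norm of \<open>\<phi>_t(b_\<beta>)\<close> is at most \<open>\<rho>^r\<close> for \<open>\<rho>\<close> close to \<open>1\<close>; so the terms are
  dominated by the Laurent series at \<open>z_\<beta> = z_\<alpha>^r\<close> with \<open>\<bar>z_\<alpha>\<bar> = \<rho>\<close>.
\<close>

section \<open>The field of p-adic complex numbers\<close>

text \<open>The algebras D_[rho1,rho2] are given only by their characterizing properties, so no
  expansion of a general element is at hand. What is at hand suffices: the two norms are
  multiplicative and known on distributions. Hence the norm of c_k phi_t(b)^k is a product of real
  numbers, although the factors do not commute, and a negative power of phi_t(b_\<alpha>) is covered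
  because the norm of an inverse is the inverse of the norm. In complete ultrametric groups
  unconditional summability means that the terms tend to 0, on the side of the rings as well as for
  the series in z, so the claim compares two families of real numbers.

  A single radius cannot serve in the forward direction: k_\<alpha> may have either sign, and the
  norm of phi_t(b_\<alpha>) is only known to lie between rho^q and rho. Two radii bracket
  |z_\<alpha>|, and the exponent r absorbs the same uncertainty for the other roots. Backwards,
  \<alpha>(t) = 1 fixes the norm of phi_t(b_\<alpha>) exactly, so one radius is enough; the work
  moves to finding t, which is the value at p of a suitable cocharacter.\<close>

locale Cp_field =
  fixes p :: nat and TC :: "'c::{alg_closed_field, field_char_0, complete_space} itself"
  assumes is_Cp: "is_Cp p TC"
begin

lemma prime_p: "prime p"
  using is_Cp by (simp add: is_Cp_def)

lemma p_gt_1: "1 < real p"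
  using prime_gt_1_nat[OF prime_p] by simp

lemma dist_eq_vabs: "dist x y = vabs (x - y)" for x y :: 'c
  using is_Cp unfolding is_Cp_def by blast

lemma vabs_mult: "vabs (x * y) = vabs x * vabs y" for x y :: 'c
  using is_Cp unfolding is_Cp_def by blast

lemma vabs_add_le: "vabs (x + y) \<le> max (vabs x) (vabs y)" for x y :: 'c
  using is_Cp unfolding is_Cp_def by blast

lemma vabs_p: "vabs (of_nat p :: 'c) = 1 / real p"
  using is_Cp unfolding is_Cp_def by blast

lemma vabs_1: "vabs (1 :: 'c) = 1"
proof -
  have "vabs (1::'c) * vabs (1::'c) = vabs (1::'c)"
    using vabs_mult[of 1 1] by simp
  moreover have "vabs (1::'c) \<noteq> 0"
    by simp
  ultimately show ?thesis
    by (metis mult_cancel_right1)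
qed

lemma vabs_minus: "vabs (- x) = vabs x" for x :: 'c
  using dist_eq_vabs[of 0 x] by (simp add: dist_commute)

lemma vabs_diff_le: "vabs (x - y) \<le> max (vabs x) (vabs y)" for x y :: 'c
  using vabs_add_le[of x "- y"] by (simp add: vabs_minus)

lemma vabs_add_less: "vabs x < e \<Longrightarrow> vabs y < e \<Longrightarrow> vabs (x + y) < e" for x y :: 'c
  using vabs_add_le[of x y] by simp

text \<open>The isosceles triangle principle of ultrametric spaces.\<close>

lemma vabs_eq_of_close: "vabs (x - y) < vabs x \<Longrightarrow> vabs y = vabs x" for x y :: 'c
  using vabs_diff_le[of x "x - y"] vabs_add_le[of "x - y" y] by (simp add: max_def split: if_splits)

lemma vabs_sum_le:
  assumes "finite I" "0 \<le> e" "\<And>i. i \<in> I \<Longrightarrow> vabs (f i) \<le> e"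
  shows "vabs (\<Sum>i\<in>I. f i :: 'c) \<le> e"
  using assms
proof (induction I rule: finite_induct)
  case (insert i I)
  then show ?case
    using vabs_add_le[of "f i" "\<Sum>i\<in>I. f i"] by (smt (verit) insert_iff sum.insert)
qed simp

lemma vabs_power: "vabs (x ^ n) = vabs x ^ n" for x :: 'c
  by (induction n) (simp_all add: vabs_mult vabs_1)

lemma vabs_inverse: "vabs (inverse x) = inverse (vabs x)" for x :: 'c
proof (cases "x = 0")
  case False
  then have "vabs x * vabs (inverse x) = 1"
    using vabs_mult[of x "inverse x"] by (simp add: vabs_1)
  then show ?thesis
    by (metis inverse_unique)
qed simp

lemma vabs_powi: "vabs (x powi n) = vabs x powi n" for x :: 'c
  by (simp add: power_int_def vabs_power vabs_inverse)

lemma vabs_prod: "vabs (\<Prod>i\<in>I. f i) = (\<Prod>i\<in>I. vabs (f i :: 'c))"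
  by (induction I rule: infinite_finite_induct) (simp_all add: vabs_1 vabs_mult)

lemma vabs_of_nat_le: "vabs (of_nat n :: 'c) \<le> 1"
proof (induction n)
  case (Suc n)
  then show ?case
    using vabs_add_le[of 1 "of_nat n"] by (simp add: vabs_1)
qed simp

lemma vabs_of_int_le: "vabs (of_int n :: 'c) \<le> 1"
  by (cases n rule: int_cases2) (simp_all add: vabs_minus vabs_of_nat_le)

lemma vabs_of_nat_dvd: 
  assumes "p dvd n"
  shows "vabs (of_nat n :: 'c) \<le> 1 / real p"
proof -
  obtain m where n: "n = p * m"
    using assms by blast
  have "1 / real p * vabs (of_nat m :: 'c) \<le> 1 / real p * 1"
    by (intro mult_left_mono vabs_of_nat_le) simp
  then show ?thesis
    by (simp add: n vabs_mult vabs_p)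
qed

lemma vabs_of_int_dvd: 
  assumes "int p dvd n"
  shows "vabs (of_int n :: 'c) \<le> 1 / real p"
  using assms by (cases n rule: int_cases2) (auto simp add: vabs_minus intro: vabs_of_nat_dvd)

text \<open>By Bezout, 1 = p u + n v. The first summand is too small to have absolute value 1, so n
  v must supply it, and both of its factors have absolute value at most 1.\<close>

lemma vabs_of_int_not_dvd:
  assumes "\<not> int p dvd n"
  shows "vabs (of_int n :: 'c) = 1"
proof -
  have "coprime (int p) n"
    using prime_p assms by (simp add: prime_imp_coprime)
  then obtain u v where uv: "int p * u + n * v = 1"
    using bezout_int[of "int p" n] by (auto simp: algebra_simps)
  have "1 = vabs (of_int (int p * u) + of_int (n * v) :: 'c)"
    using uv by (metis of_int_1 of_int_add vabs_1)
  also have "\<dots> \<le> max (vabs (of_int (int p * u) :: 'c)) (vabs (of_int (n * v) :: 'c))"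
    by (rule vabs_add_le)
  also have "vabs (of_int (int p * u) :: 'c) \<le> 1 / real p"
    by (rule vabs_of_int_dvd) simp
  then have "max (vabs (of_int (int p * u) :: 'c)) (vabs (of_int (n * v) :: 'c)) \<le>
      max (1 / real p) (vabs (of_int (n * v) :: 'c))"
    by (rule max.mono) simp
  finally have "1 \<le> vabs (of_int (n * v) :: 'c)"
    using p_gt_1 by (simp add: max_def split: if_splits)
  also have "\<dots> = vabs (of_int n :: 'c) * vabs (of_int v :: 'c)"
    by (simp add: vabs_mult)
  also have "\<dots> \<le> vabs (of_int n :: 'c) * 1"
    by (intro mult_left_mono vabs_of_int_le) simp
  finally show ?thesis
    using vabs_of_int_le[of n] by simp
qed

lemma vabs_of_nat_not_dvd: "\<not> p dvd n \<Longrightarrow> vabs (of_nat n :: 'c) = 1"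
  using vabs_of_int_not_dvd[of "int n"] by simp

lemma vabs_of_nat_mult_power: 
  "\<not> p dvd u \<Longrightarrow> vabs (of_nat (p ^ m * u) :: 'c) = (1 / real p) ^ m"
  by (simp add: vabs_mult vabs_power vabs_p vabs_of_nat_not_dvd)

lemma nat_eq_power_mult:
  assumes "n \<noteq> 0"
  obtains m u where "n = p ^ m * u" "\<not> p dvd u"
  using multiplicity_decompose'[OF assms, of p] prime_p by (metis not_prime_unit)

subsection \<open>Continuity of the field operations\<close>

text \<open>The field structure and the metric of \<open>'c\<close> are linked only through
  \<open>is_Cp\<close>, so each limit law comes from an explicit estimate of distances; this is the
  common pattern.\<close>

lemma tendsto_of_dist_le:
  fixes f :: "'x \<Rightarrow> 'y::metric_space"
  assumes "(h \<longlongrightarrow> (0::real)) F" "\<And>x. dist (f x) a \<le> h x"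
  shows "(f \<longlongrightarrow> a) F"
proof (rule metric_tendsto_imp_tendsto[OF assms(1)])
  have "dist (f x) a \<le> dist (h x) 0" for x
    using assms(2)[of x] by (simp add: dist_real_def)
  then show "\<forall>\<^sub>F x in F. dist (f x) a \<le> dist (h x) 0"
    by (rule always_eventually[OF allI])
qed

lemma tendsto_add_c:
  fixes f g :: "'x \<Rightarrow> 'c"
  assumes "(f \<longlongrightarrow> a) F" "(g \<longlongrightarrow> b) F"
  shows "((\<lambda>x. f x + g x) \<longlongrightarrow> a + b) F"
proof -
  have "((\<lambda>x. dist (f x) a + dist (g x) b) \<longlongrightarrow> 0 + 0) F"
    by (intro tendsto_add iffD1[OF tendsto_dist_iff assms(1)] iffD1[OF tendsto_dist_iff assms(2)])
  moreover have "dist (f x + g x) (a + b) \<le> dist (f x) a + dist (g x) b" for x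
  proof -
    have "dist (f x + g x) (a + b) = vabs ((f x - a) + (g x - b))"
      by (subst dist_eq_vabs) (simp add: algebra_simps)
    also have "\<dots> \<le> max (vabs (f x - a)) (vabs (g x - b))"
      by (rule vabs_add_le)
    also have "\<dots> \<le> vabs (f x - a) + vabs (g x - b)"
      by simp
    finally show ?thesis
      by (simp flip: dist_eq_vabs)
  qed
  ultimately show ?thesis
    by (simp only: add_0_left mult_zero_left mult_zero_right tendsto_of_dist_le)
qed

lemma tendsto_mult_c:
  fixes f g :: "'x \<Rightarrow> 'c"
  assumes "(f \<longlongrightarrow> a) F" "(g \<longlongrightarrow> b) F"
  shows "((\<lambda>x. f x * g x) \<longlongrightarrow> a * b) F"
proof -
  have "((\<lambda>x. dist (f x) a * vabs (g x) + vabs a * dist (g x) b) \<longlongrightarrow> 0 * vabs b + vabs a * 0) F"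
    by (intro tendsto_add tendsto_mult tendsto_const tendsto_dist[OF assms(2) tendsto_const]
        iffD1[OF tendsto_dist_iff assms(1)] iffD1[OF tendsto_dist_iff assms(2)])
  moreover have "dist (f x * g x) (a * b) \<le> dist (f x) a * vabs (g x) + vabs a * dist (g x) b" for x
  proof -
    have "dist (f x * g x) (a * b) = vabs ((f x - a) * g x + a * (g x - b))"
      by (subst dist_eq_vabs) (simp add: algebra_simps)
    also have "\<dots> \<le> max (vabs ((f x - a) * g x)) (vabs (a * (g x - b)))"
      by (rule vabs_add_le)
    also have "\<dots> \<le> vabs ((f x - a) * g x) + vabs (a * (g x - b))"
      by simp
    finally show ?thesis
      by (simp add: vabs_mult flip: dist_eq_vabs)
  qed
  ultimately show ?thesis
    by (simp only: add_0_left mult_zero_left mult_zero_right tendsto_of_dist_le)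
qed

lemma tendsto_inverse_c:
  fixes f :: "'x \<Rightarrow> 'c"
  assumes f: "(f \<longlongrightarrow> a) F" and "a \<noteq> 0"
  shows "((\<lambda>x. inverse (f x)) \<longlongrightarrow> inverse a) F"
proof -
  have "((\<lambda>x. dist (f x) a / (vabs (f x) * vabs a)) \<longlongrightarrow> 0 / (vabs a * vabs a)) F"
    using \<open>a \<noteq> 0\<close>
    by (intro tendsto_divide tendsto_mult tendsto_const tendsto_dist[OF f tendsto_const]
        iffD1[OF tendsto_dist_iff f]) simp
  moreover have "\<forall>\<^sub>F x in F. dist (f x) a / (vabs (f x) * vabs a) = dist (inverse (f x)) (inverse a)"
    using tendsto_imp_eventually_ne[OF f \<open>a \<noteq> 0\<close>]
  proof eventually_elim
    case (elim x)
    have "dist (inverse (f x)) (inverse a) = vabs ((a - f x) * inverse (f x) * inverse a)"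
      using elim \<open>a \<noteq> 0\<close> by (subst dist_eq_vabs) (simp add: field_simps)
    also have "\<dots> = dist (f x) a / (vabs (f x) * vabs a)"
      by (simp add: vabs_mult vabs_inverse divide_inverse dist_commute[of "f x" a] flip: dist_eq_vabs)
    finally show ?case ..
  qed
  ultimately have "((\<lambda>x. dist (inverse (f x)) (inverse a)) \<longlongrightarrow> 0 / (vabs a * vabs a)) F"
    by (rule Lim_transform_eventually)
  then show ?thesis
    by (subst tendsto_dist_iff) simp
qed

lemma tendsto_sum_c:
  fixes f :: "'i \<Rightarrow> 'x \<Rightarrow> 'c"
  assumes "\<And>i. i \<in> I \<Longrightarrow> (f i \<longlongrightarrow> a i) F"
  shows "((\<lambda>x. \<Sum>i\<in>I. f i x) \<longlongrightarrow> (\<Sum>i\<in>I. a i)) F"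
  using assms by (induction I rule: infinite_finite_induct) (simp_all add: tendsto_add_c)

lemma tendsto_prod_c:
  fixes f :: "'i \<Rightarrow> 'x \<Rightarrow> 'c"
  assumes "\<And>i. i \<in> I \<Longrightarrow> (f i \<longlongrightarrow> a i) F"
  shows "((\<lambda>x. \<Prod>i\<in>I. f i x) \<longlongrightarrow> (\<Prod>i\<in>I. a i)) F"
  using assms by (induction I rule: infinite_finite_induct) (simp_all add: tendsto_mult_c)

lemma tendsto_gchoose_c:
  fixes f :: "'x \<Rightarrow> 'c"
  assumes "(f \<longlongrightarrow> a) F"
  shows "((\<lambda>x. f x gchoose k) \<longlongrightarrow> a gchoose k) F"
  unfolding gbinomial_prod_rev divide_inverse diff_conv_add_uminus
  by (intro tendsto_mult_c tendsto_prod_c tendsto_add_c tendsto_const assms)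

lemma vabs_tendsto_le:
  fixes f :: "nat \<Rightarrow> 'c"
  assumes "f \<longlonglongrightarrow> a" "\<And>i. vabs (f i) \<le> e"
  shows "vabs a \<le> e"
  by (rule LIMSEQ_le_const2[OF tendsto_dist[OF assms(1) tendsto_const[of 0]]]) (simp add: assms(2))

subsection \<open>p-adic numbers and p-adic integers\<close>

text \<open>\<open>Qp\<close> is defined as a closure. Together with \<open>Qp_limit\<close> this
  carries the field operations over from the rationals by continuity.\<close>

lemma Qp_sequence:
  assumes "x \<in> (Qp :: 'c set)"
  obtains q where "(\<lambda>i::nat. of_rat (q i) :: 'c) \<longlonglongrightarrow> x"
proof -
  have "\<exists>q. dist (of_rat q) x < inverse (real (Suc i))" for i
    using assms unfolding Qp_def by (auto simp: closure_approachable)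
  then obtain q where q: "\<And>i. dist (of_rat (q i)) x < inverse (real (Suc i))"
    using choice[of "\<lambda>i q. dist (of_rat q) x < inverse (real (Suc i))"] by blast
  have "(\<lambda>i. of_rat (q i)) \<longlonglongrightarrow> x"
    by (rule tendsto_of_dist_le[OF LIMSEQ_inverse_real_of_nat less_imp_le[OF q]])
  then show ?thesis
    by (rule that)
qed

lemma Qp_limit:
  assumes "\<And>i::nat. f i \<in> (Qp :: 'c set)" "f \<longlonglongrightarrow> x"
  shows "x \<in> Qp"
  using assms unfolding Qp_def by (rule closed_sequentially[OF closed_closure])

lemma Qp_of_rat: "of_rat q \<in> (Qp :: 'c set)"
  unfolding Qp_def by (rule subsetD[OF closure_subset]) simp

lemma Qp_of_int: "of_int q \<in> (Qp :: 'c set)"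
  using Qp_of_rat[of "of_int q"] by simp

lemma Qp_of_nat: "of_nat q \<in> (Qp :: 'c set)"
  using Qp_of_rat[of "of_nat q"] by simp

lemma Qp_0: "0 \<in> (Qp :: 'c set)" and Qp_1: "1 \<in> (Qp :: 'c set)"
  using Qp_of_nat[of 0] Qp_of_nat[of 1] by simp_all

lemma Qp_add:
  assumes "x \<in> (Qp :: 'c set)" "y \<in> Qp"
  shows "x + y \<in> Qp"
proof -
  obtain f g where "(\<lambda>i::nat. of_rat (f i) :: 'c) \<longlonglongrightarrow> x" "(\<lambda>i::nat. of_rat (g i) :: 'c) \<longlonglongrightarrow> y"
    using assms Qp_sequence by metis
  from tendsto_add_c[OF this] show ?thesis
    by (rule Qp_limit[rotated]) (simp add: Qp_of_rat flip: of_rat_add)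
qed

lemma Qp_mult:
  assumes "x \<in> (Qp :: 'c set)" "y \<in> Qp"
  shows "x * y \<in> Qp"
proof -
  obtain f g where "(\<lambda>i::nat. of_rat (f i) :: 'c) \<longlonglongrightarrow> x" "(\<lambda>i::nat. of_rat (g i) :: 'c) \<longlonglongrightarrow> y"
    using assms Qp_sequence by metis
  from tendsto_mult_c[OF this] show ?thesis
    by (rule Qp_limit[rotated]) (simp add: Qp_of_rat flip: of_rat_mult)
qed

lemma Qp_minus: "x \<in> (Qp :: 'c set) \<Longrightarrow> - x \<in> Qp"
  using Qp_mult[of "of_int (-1)" x] Qp_of_int[of "-1"] by simp

lemma Qp_diff: "x \<in> (Qp :: 'c set) \<Longrightarrow> y \<in> Qp \<Longrightarrow> x - y \<in> Qp"
  using Qp_add[of x "- y"] Qp_minus[of y] by simp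

lemma Qp_inverse:
  assumes "x \<in> (Qp :: 'c set)"
  shows "inverse x \<in> Qp"
proof (cases "x = 0")
  case False
  obtain f where "(\<lambda>i::nat. of_rat (f i) :: 'c) \<longlonglongrightarrow> x"
    using assms Qp_sequence by metis
  from tendsto_inverse_c[OF this False] show ?thesis
    by (rule Qp_limit[rotated]) (simp add: Qp_of_rat flip: of_rat_inverse)
qed (simp add: Qp_0)

lemma Qp_sum: "(\<And>i. i \<in> I \<Longrightarrow> f i \<in> (Qp :: 'c set)) \<Longrightarrow> (\<Sum>i\<in>I. f i) \<in> Qp"
  by (induction I rule: infinite_finite_induct) (simp_all add: Qp_0 Qp_add)

lemma Qp_prod: "(\<And>i. i \<in> I \<Longrightarrow> f i \<in> (Qp :: 'c set)) \<Longrightarrow> (\<Prod>i\<in>I. f i) \<in> Qp"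
  by (induction I rule: infinite_finite_induct) (simp_all add: Qp_1 Qp_mult)

lemma Qp_powi: "x \<in> (Qp :: 'c set) \<Longrightarrow> x powi n \<in> Qp"
proof -
  have *: "y \<in> Qp \<Longrightarrow> y ^ m \<in> Qp" for y :: 'c and m
    by (induction m) (simp_all add: Qp_1 Qp_mult)
  show "x \<in> Qp \<Longrightarrow> x powi n \<in> Qp"
    by (simp add: power_int_def * Qp_inverse)
qed

lemma Qp_gchoose: "x \<in> (Qp :: 'c set) \<Longrightarrow> x gchoose k \<in> Qp"
proof -
  assume x: "x \<in> (Qp :: 'c set)"
  have "(fact k :: 'c) \<in> Qp"
    by (metis Qp_of_nat of_nat_fact)
  with x show ?thesis
    unfolding gbinomial_prod_rev divide_inverse
    by (intro Qp_mult Qp_prod Qp_diff Qp_of_nat Qp_inverse)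
qed

text \<open>A rational a/b close to x is p-integral, so b is invertible modulo p^m, and a natural
  number congruent to a/b modulo p^m approximates x as well.\<close>

lemma Zp_nat_approx:
  assumes "x \<in> (Zp :: 'c set)" "0 < e"
  shows "\<exists>n::nat. dist (of_nat n) x < e"
proof -
  \<comment> \<open>The cap at 1 makes a/b inherit |a/b| \<le> 1 from x.\<close>
  define e' where "e' = min e 1"
  have e': "0 < e'" "e' \<le> 1" "e' \<le> e"
    using assms by (auto simp: e'_def)
  have x: "x \<in> Qp" "vabs x \<le> 1"
    using assms by (auto simp: Zp_def)
  obtain q where "dist (of_rat q) x < e'"
    using x(1) e'(1) unfolding Qp_def by (auto simp: closure_approachable)
  moreover obtain a b where "quotient_of q = (a, b)"
    by fastforce
  then have q: "q = of_int a / of_int b" "b > 0" "coprime a b"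
    using quotient_of_div quotient_of_denom_pos quotient_of_coprime by blast+
  ultimately have ab: "vabs (of_int a / of_int b - x) < e'"
    using dist_eq_vabs[of "of_rat q" x] by (simp add: of_rat_divide)
  have "vabs (of_int a / of_int b :: 'c) \<le> 1"
    using vabs_add_le[of "of_int a / of_int b - x" x] ab x(2) e'(2) by simp
  then have "vabs (of_int a :: 'c) * inverse (vabs (of_int b :: 'c)) \<le> 1"
    by (simp only: divide_inverse vabs_mult vabs_inverse)
  then have le: "vabs (of_int a :: 'c) \<le> vabs (of_int b :: 'c)"
    using q(2) by (simp add: field_simps)
  \<comment> \<open>If p divided b, coprimality would give |a| = 1 > |b|, against
    \<open>le\<close>.\<close>
  have nb: "\<not> int p dvd b"
  proof
    assume "int p dvd b"
    then have "\<not> int p dvd a" "vabs (of_int b :: 'c) \<le> 1 / real p"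
      using q(3) vabs_of_int_dvd coprime_common_divisor[of a b "int p"] prime_gt_1_nat[OF prime_p] by auto
    moreover have "1 / real p < 1"
      using p_gt_1 by simp
    ultimately show False
      using le vabs_of_int_not_dvd[of a] by linarith
  qed
  obtain m where m: "(1 / real p) ^ m < e'"
    using real_arch_pow_inv[OF e'(1), of "1 / real p"] p_gt_1 by auto
  have "coprime (int p ^ m) b"
    using prime_p nb by (simp add: prime_imp_coprime)
  then obtain u v where uv: "int p ^ m * u + b * v = 1"
    using bezout_int[of "int p ^ m" b] by (auto simp: algebra_simps)
  \<comment> \<open>By \<open>uv\<close>, v inverts b modulo p^m; reducing v a modulo p^m makes the
    representative nonnegative.\<close>
  define n where "n = nat ((v * a) mod (int p ^ m))"
  have pm: "int p ^ m > 0"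
    using p_gt_1 by simp
  then obtain w where n: "int n = v * a - w * int p ^ m"
    using that[of "v * a div int p ^ m"] by (simp add: n_def minus_div_mult_eq_mod)
  have "b * int n - a = a * (b * v - 1) - b * w * int p ^ m"
    unfolding n by (simp add: algebra_simps)
  also have "b * v - 1 = - (int p ^ m * u)"
    using uv by simp
  also have "a * (- (int p ^ m * u)) - b * w * int p ^ m = int p ^ m * (- a * u - b * w)"
    by (simp add: algebra_simps)
  finally have bn: "b * int n - a = int p ^ m * (- a * u - b * w)" .
  have "of_nat n - of_int a / of_int b = (of_int (b * int n - a) / of_int b :: 'c)"
    using q(2) by (simp add: diff_divide_distrib)
  then have "vabs (of_nat n - of_int a / of_int b :: 'c) = vabs (of_int (b * int n - a) / of_int b :: 'c)"
    by (rule arg_cong)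
  also have "\<dots> = vabs (of_int (b * int n - a) :: 'c)"
    using vabs_of_int_not_dvd[OF nb] by (simp only: divide_inverse vabs_mult vabs_inverse inverse_1 mult_1_right)
  also have "\<dots> = (1 / real p) ^ m * vabs (of_int (- a * u - b * w) :: 'c)"
    unfolding bn of_int_mult of_int_power of_int_of_nat_eq vabs_mult vabs_power vabs_p ..
  also have "\<dots> \<le> (1 / real p) ^ m * 1"
    by (intro mult_left_mono vabs_of_int_le) simp
  finally have "vabs (of_nat n - of_int a / of_int b :: 'c) < e'"
    using m by simp
  with ab have "vabs (of_nat n - x) < e'"
    using vabs_add_less by fastforce
  then have "dist (of_nat n) x < e"
    using e' dist_eq_vabs[of "of_nat n" x] by simp
  then show ?thesis ..
qed

lemma Zp_of_nat: "of_nat n \<in> (Zp :: 'c set)"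
  by (simp add: Zp_def Qp_of_nat vabs_of_nat_le)

lemma Zp_nat_sequence:
  assumes "x \<in> (Zp :: 'c set)"
  obtains m where "(\<lambda>i::nat. of_nat (m i) :: 'c) \<longlonglongrightarrow> x"
proof -
  have "\<exists>n. dist (of_nat n) x < inverse (real (Suc i))" for i
    using Zp_nat_approx[OF assms, of "inverse (real (Suc i))"] by simp
  then obtain m where m: "\<And>i. dist (of_nat (m i)) x < inverse (real (Suc i))"
    using choice[of "\<lambda>i n. dist (of_nat n) x < inverse (real (Suc i))"] by blast
  have "(\<lambda>i. of_nat (m i)) \<longlonglongrightarrow> x"
    by (rule tendsto_of_dist_le[OF LIMSEQ_inverse_real_of_nat less_imp_le[OF m]])
  then show ?thesis
    by (rule that)
qed

text \<open>\<open>padic_power\<close> is a \<open>Lim\<close> along this filter, and such a limit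
  is determined only if the filter is proper.\<close>

lemma Zp_filtercomap_nontrivial: "x \<in> (Zp :: 'c set) \<Longrightarrow> filtercomap (of_nat :: nat \<Rightarrow> 'c) (nhds x) \<noteq> bot"
proof (rule filtercomap_neq_bot)
  fix P assume x: "x \<in> (Zp :: 'c set)" and "eventually P (nhds x)"
  then obtain d where d: "d > 0" "\<And>y. dist y x < d \<Longrightarrow> P y"
    by (metis eventually_nhds_metric)
  then obtain n :: nat where "dist (of_nat n) x < d"
    using Zp_nat_approx[OF x] by blast
  then show "\<exists>n::nat. P (of_nat n)"
    using d(2) by blast
qed

text \<open>On natural numbers the values are integers. These numbers are dense in \<open>Zp\<close>
  and x choose k is polynomial in x, so the bound survives the limit.\<close>

lemma vabs_gchoose_le:
  assumes "x \<in> (Zp :: 'c set)"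
  shows "vabs (x gchoose k) \<le> 1"
proof -
  obtain m where "(\<lambda>i::nat. of_nat (m i) :: 'c) \<longlonglongrightarrow> x"
    using assms by (rule Zp_nat_sequence)
  from tendsto_gchoose_c[OF this, of k] show ?thesis
    by (rule vabs_tendsto_le) (metis binomial_gbinomial vabs_of_nat_le)
qed

end

section \<open>Null families and unconditional convergence\<close>

text \<open>For nonnegative g this is convergence to 0 along the complements of finite sets, which
  refers to no order on the multi-indices.\<close>

definition null_family :: "('i \<Rightarrow> real) \<Rightarrow> 'i set \<Rightarrow> bool" where
  "null_family g I \<longleftrightarrow> (\<forall>e>0. finite {k \<in> I. e \<le> g k})"

text \<open>The maximum of two families is allowed because different terms of a Laurent series will
  be dominated at different radii.\<close>

lemma null_family_le:
  assumes "null_family g I" "null_family h I" "\<And>k. k \<in> I \<Longrightarrow> f k \<le> max (g k) (h k)"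
  shows "null_family f I"
  unfolding null_family_def
proof (intro allI impI)
  fix e :: real assume "0 < e"
  then have "finite ({k \<in> I. e \<le> g k} \<union> {k \<in> I. e \<le> h k})"
    using assms(1,2) by (simp add: null_family_def)
  moreover have "{k \<in> I. e \<le> f k} \<subseteq> {k \<in> I. e \<le> g k} \<union> {k \<in> I. e \<le> h k}"
    using assms(3) by fastforce
  ultimately show "finite {k \<in> I. e \<le> f k}"
    by (rule rev_finite_subset)
qed

text \<open>Completeness speaks of sequences, whereas the partial sums form a net over finite
  subsets. A Cauchy sequence along increasing finite sets is extracted, and its limit is then shown
  to be the limit of the net.\<close>

lemma (in Metric_space) convergent_finite_subsets:
  assumes "mcomplete"
    and S: "\<And>F. finite F \<Longrightarrow> F \<subseteq> I \<Longrightarrow> S F \<in> M"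
    and cauchy: "\<And>e. 0 < e \<Longrightarrow>
      \<exists>E. finite E \<and> E \<subseteq> I \<and> (\<forall>F. finite F \<and> E \<subseteq> F \<and> F \<subseteq> I \<longrightarrow> d (S F) (S E) < e)"
  shows "\<exists>s. limitin mtopology S s (finite_subsets_at_top I)"
proof -
  define r where "r n = inverse (real (Suc n))" for n
  have r: "0 < r n" for n
    by (simp add: r_def)
  have "\<exists>E. \<forall>n. finite (E n) \<and> E n \<subseteq> I \<and> (\<forall>F. finite F \<and> E n \<subseteq> F \<and> F \<subseteq> I \<longrightarrow> d (S F) (S (E n)) < r n)"
    by (intro choice allI cauchy r)
  then obtain E where E_all:
    "\<forall>n. finite (E n) \<and> E n \<subseteq> I \<and> (\<forall>F. finite F \<and> E n \<subseteq> F \<and> F \<subseteq> I \<longrightarrow> d (S F) (S (E n)) < r n)" ..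
  have E: "finite (E n)" "E n \<subseteq> I" "finite F \<Longrightarrow> E n \<subseteq> F \<Longrightarrow> F \<subseteq> I \<Longrightarrow> d (S F) (S (E n)) < r n" for n F
    using E_all[rule_format, of n] by simp_all
  \<comment> \<open>\<open>V n\<close> contains every \<open>E m\<close> with m \<le> n, so S (V n)
    is within r m of S (E m) for all these m at once.\<close>
  define V where "V n = (\<Union>i\<le>n. E i)" for n
  have V: "finite (V n)" "V n \<subseteq> I" for n
    using E by (auto simp: V_def)
  have EV: "E m \<subseteq> V n" if "m \<le> n" for m n
    using that by (auto simp: V_def)
  have small: "\<exists>n. r n < e" if "0 < e" for e
    using reals_Archimedean[OF that] by (simp add: r_def)
  have "MCauchy (\<lambda>n. S (V n))"
    unfolding MCauchy_def
  proof (intro conjI allI impI)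
    show "range (\<lambda>n. S (V n)) \<subseteq> M"
      using S V by blast
    fix e :: real assume "0 < e"
    then obtain N where N: "r N < e / 2"
      using small[of "e / 2"] by auto
    have "d (S (V n)) (S (V m)) < e" if "N \<le> n" "N \<le> m" for n m
    proof -
      have "d (S (V n)) (S (V m)) \<le> d (S (V n)) (S (E N)) + d (S (E N)) (S (V m))"
        by (intro triangle S V E)
      also have "\<dots> = d (S (V n)) (S (E N)) + d (S (V m)) (S (E N))"
        by (simp add: commute)
      also have "\<dots> < r N + r N"
        using that by (intro add_strict_mono E(3) V EV)
      finally show ?thesis
        using N by simp
    qed
    then show "\<exists>N. \<forall>n n'. N \<le> n \<longrightarrow> N \<le> n' \<longrightarrow> d (S (V n)) (S (V n')) < e"
      by blast
  qed
  then obtain s where s: "limitin mtopology (\<lambda>n. S (V n)) s sequentially"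
    using \<open>mcomplete\<close> unfolding mcomplete_def by blast
  then have sM: "s \<in> M"
    by (simp add: limitin_mspace)
  have "limitin mtopology S s (finite_subsets_at_top I)"
    unfolding limitin_metric
  proof (intro conjI allI impI sM)
    fix e :: real assume "0 < e"
    \<comment> \<open>Three distances add up: from S F to S (E N), from there to S (V m), and from
      there to s.\<close>
    then obtain N where N: "r N < e / 3"
      using small[of "e / 3"] by auto
    have "0 < e / 3"
      using \<open>0 < e\<close> by simp
    then obtain N' where N': "\<And>n. N' \<le> n \<Longrightarrow> d (S (V n)) s < e / 3"
      using s unfolding limit_metric_sequentially by blast
    define m where "m = max N N'"
    have "S F \<in> M \<and> d (S F) s < e" if F: "finite F" "E N \<subseteq> F" "F \<subseteq> I" for F
    proof -
      have "d (S F) s \<le> d (S F) (S (E N)) + d (S (E N)) s"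
        using F by (intro triangle S E sM)
      also have "d (S (E N)) s \<le> d (S (E N)) (S (V m)) + d (S (V m)) s"
        by (intro triangle S V E sM)
      also have "d (S (E N)) (S (V m)) = d (S (V m)) (S (E N))"
        by (rule commute)
      finally have "d (S F) s \<le> d (S F) (S (E N)) + (d (S (V m)) (S (E N)) + d (S (V m)) s)"
        by simp
      also have "\<dots> < r N + (r N + e / 3)"
        using F by (intro add_strict_mono E(3) V EV N') (simp_all add: m_def)
      finally show ?thesis
        using N F S by simp
    qed
    then show "\<forall>\<^sub>F F in finite_subsets_at_top I. S F \<in> M \<and> d (S F) s < e"
      unfolding eventually_finite_subsets_at_top using E(1,2) by (intro exI[of _ "E N"]) simp
  qed
  then show ?thesis ..
qed

context Cp_field
begin

text \<open>A term outside E is the difference of two partial sums that are both close to the limit.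
  Conversely, the ultrametric inequality bounds a finite sum of small terms by the largest of them,
  so the partial sums are Cauchy.\<close>

lemma summable_on_iff_null_family:
  "(f :: 'i \<Rightarrow> 'c) summable_on I \<longleftrightarrow> null_family (\<lambda>k. vabs (f k)) I"
proof
  assume "f summable_on I"
  then obtain s where s: "(sum f \<longlongrightarrow> s) (finite_subsets_at_top I)"
    unfolding summable_on_def has_sum_def by blast
  show "null_family (\<lambda>k. vabs (f k)) I"
    unfolding null_family_def
  proof (intro allI impI)
    fix e :: real assume "0 < e"
    then have "\<forall>\<^sub>F F in finite_subsets_at_top I. dist (sum f F) s < e"
      using s by (simp add: tendsto_iff)
    then obtain E where E: "finite E" "E \<subseteq> I"
      "\<And>F. finite F \<Longrightarrow> E \<subseteq> F \<Longrightarrow> F \<subseteq> I \<Longrightarrow> dist (sum f F) s < e"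
      by (auto simp: eventually_finite_subsets_at_top)
    have "{k \<in> I. e \<le> vabs (f k)} \<subseteq> E"
    proof (rule subsetI, rule ccontr)
      fix k assume k: "k \<in> {k \<in> I. e \<le> vabs (f k)}" "k \<notin> E"
      have "dist (sum f (insert k E)) s < e" "dist (sum f E) s < e"
        using k E(1,2) by (intro E(3); blast)+
      then have "vabs (sum f (insert k E) - s) < e" "vabs (sum f E - s) < e"
        by (simp_all flip: dist_eq_vabs)
      then have "vabs ((sum f (insert k E) - s) - (sum f E - s)) < e"
        using vabs_diff_le[of "sum f (insert k E) - s" "sum f E - s"] by linarith
      then show False
        using k E by simp
    qed
    then show "finite {k \<in> I. e \<le> vabs (f k)}"
      using E(1) by (rule finite_subset)
  qed
next
  assume null: "null_family (\<lambda>k. vabs (f k)) I"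
  have "\<exists>s. limitin Met_TC.mtopology (sum f) s (finite_subsets_at_top I)"
  proof (rule Met_TC.convergent_finite_subsets)
    show "Met_TC.mcomplete TYPE('c)"
      using complete_UNIV by (simp add: mcomplete_iff_complete)
    fix e :: real assume "0 < e"
    \<comment> \<open>The ultrametric bound on a sum is not strict; the threshold e/2 leaves room
      for the strict inequality with e.\<close>
    define E where "E = {k \<in> I. e / 2 \<le> vabs (f k)}"
    have fin: "finite E"
      using null half_gt_zero[OF \<open>0 < e\<close>] unfolding null_family_def E_def by blast
    have "dist (sum f F) (sum f E) < e" if F: "finite F" "E \<subseteq> F" "F \<subseteq> I" for F
    proof -
      have "dist (sum f F) (sum f E) = vabs (sum f (F - E))"
        using F fin by (simp add: dist_eq_vabs[of "sum f F"] sum_diff)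
      also have "\<dots> \<le> e / 2"
        using F \<open>0 < e\<close> by (intro vabs_sum_le) (auto simp: E_def)
      finally show ?thesis
        using \<open>0 < e\<close> by simp
    qed
    moreover have "E \<subseteq> I"
      by (auto simp: E_def)
    ultimately show "\<exists>E. finite E \<and> E \<subseteq> I \<and> (\<forall>F. finite F \<and> E \<subseteq> F \<and> F \<subseteq> I \<longrightarrow> dist (sum f F) (sum f E) < e)"
      using fin by blast
  qed simp
  then show "f summable_on I"
    by (simp add: summable_on_def has_sum_def mtopology_is_euclidean)
qed

subsection \<open>Absolute values of binomial coefficients\<close>

text \<open>A positive integer below p^m has p-adic valuation at most m - 1.\<close>

lemma vabs_of_nat_below_power:
  assumes "0 < i" "i < p ^ m"
  shows "(1 / real p) ^ m \<le> vabs (of_nat i :: 'c) / real p"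
proof -
  obtain a u where i: "i = p ^ a * u" "\<not> p dvd u"
    using nat_eq_power_mult[of i] assms(1) by blast
  have "p ^ a \<le> i"
    using assms(1) i(1) by simp
  with assms(2) have "p ^ a < p ^ m"
    by linarith
  then have "a < m"
    using prime_gt_1_nat[OF prime_p] by simp
  then have "(1 / real p) ^ m \<le> (1 / real p) ^ Suc a"
    using p_gt_1 by (intro power_decreasing) auto
  then show ?thesis
    using vabs_of_nat_mult_power[OF i(2), of a] by (simp only: i(1)) simp
qed

text \<open>By absorption, k (q choose k) = q (q - 1 choose k - 1) with q = p^m, and q has a
  strictly larger valuation than k.\<close>

lemma vabs_prime_power_gchoose_le:
  assumes "0 < k" "k < p ^ m"
  shows "vabs (of_nat (p ^ m) gchoose k :: 'c) \<le> 1 / real p"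
proof -
  have Suc: "of_nat (p ^ m) - 1 = (of_nat (p ^ m - 1) :: 'c)"
    using assms by (subst of_nat_diff) auto
  have "of_nat k * (of_nat (p ^ m) gchoose k :: 'c) = of_nat (p ^ m) * (of_nat (p ^ m - 1) gchoose (k - 1))"
    using gbinomial_absorption'[OF assms(1), of "of_nat (p ^ m) :: 'c"] assms(1) unfolding Suc by simp
  then have "vabs (of_nat k :: 'c) * vabs (of_nat (p ^ m) gchoose k :: 'c) =
      (1 / real p) ^ m * vabs (of_nat (p ^ m - 1) gchoose (k - 1) :: 'c)"
    by (metis of_nat_power vabs_mult vabs_p vabs_power)
  also have "\<dots> \<le> (1 / real p) ^ m * 1"
    by (intro mult_left_mono vabs_gchoose_le Zp_of_nat) simp
  also have "\<dots> \<le> vabs (of_nat k :: 'c) * (1 / real p)"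
    using vabs_of_nat_below_power[OF assms] by simp
  finally show ?thesis
    using assms(1) by (simp only: mult_le_cancel_left_pos zero_less_dist_iff of_nat_eq_0_iff)
qed

lemma vabs_gchoose_prime_power:
  fixes x :: 'c
  assumes "vabs x = (1 / real p) ^ m"
  shows "vabs (x gchoose (p ^ m)) = 1"
proof -
  txt \<open>
    With \<open>q = p ^ m\<close>, the factors \<open>x - i\<close> and \<open>i\<close> have the same absolute value for \<open>0 < i < q\<close>, because
    \<open>\<bar>x\<bar> = \<bar>q\<bar> < \<bar>i\<bar>\<close>.  So the numerator of the binomial coefficient is as large as \<open>q!\<close>.
  \<close>
  define q where "q = p ^ m"
  have q: "0 < q"
    using p_gt_1 by (simp add: q_def)
  have xq: "vabs x = vabs (of_nat q :: 'c)"
    by (simp add: q_def assms vabs_power vabs_p)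
  have *: "vabs (x - of_nat i) = vabs (of_nat i :: 'c)" if "0 < i" "i < q" for i
  proof -
    have "vabs (of_nat i :: 'c) / real p < vabs (of_nat i :: 'c) / 1"
      using that p_gt_1 by (intro divide_strict_left_mono) auto
    then have "vabs x < vabs (of_nat i :: 'c)"
      using vabs_of_nat_below_power[of i m] that by (simp add: assms q_def)
    then show ?thesis
      using vabs_eq_of_close[of "- of_nat i" "x - of_nat i"]  by (simp add: vabs_minus)
  qed
  have "vabs (x gchoose q) = (\<Prod>i = 0..<q. vabs (x - of_nat i)) / vabs (of_nat (\<Prod>{1..q}) :: 'c)"
    by (simp add: gbinomial_prod_rev divide_inverse vabs_mult vabs_inverse vabs_prod fact_prod)
  also have "(\<Prod>i = 0..<q. vabs (x - of_nat i)) = vabs x * (\<Prod>i = 1..<q. vabs (x - of_nat i))"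
    using q by (simp add: prod.atLeast_Suc_lessThan)
  also have "(\<Prod>i = 1..<q. vabs (x - of_nat i)) = (\<Prod>i = 1..<q. vabs (of_nat i :: 'c))"
    using * by (intro prod.cong) auto
  also have "vabs x * \<dots> = (\<Prod>i = 1..q. vabs (of_nat i :: 'c))"
    using q by (simp add: xq atLeastLessThanSuc_atLeastAtMost[symmetric] prod.atLeastLessThan_Suc)
  also have "\<dots> = vabs (of_nat (\<Prod>{1..q}) :: 'c)"
    by (simp add: vabs_prod)
  also have "\<dots> / \<dots> = 1"
    by simp
  finally show ?thesis
    by (simp add: q_def)
qed

text \<open>A natural number that is nearer to x than 0 is has the absolute value of x.\<close>

lemma Zp_vabs_eq_power:
  assumes "x \<in> (Zp :: 'c set)" "x \<noteq> 0"
  obtains m where "vabs x = (1 / real p) ^ m"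
proof -
  obtain n :: nat where n: "vabs (of_nat n - x) < vabs x"
    using Zp_nat_approx[OF assms(1), of "vabs x"] assms(2) dist_eq_vabs[of "of_nat _" x] by auto
  then have "vabs (x - of_nat n) < vabs x"
    using vabs_minus[of "x - of_nat n"] by simp
  then have nx: "vabs (of_nat n :: 'c) = vabs x"
    by (rule vabs_eq_of_close)
  then have "n \<noteq> 0"
    using assms(2) by (cases "n = 0") auto
  then obtain m u where "n = p ^ m * u" "\<not> p dvd u"
    by (rule nat_eq_power_mult)
  then show ?thesis
    using that vabs_of_nat_mult_power[of u m] nx by metis
qed

text \<open>Roots exist in an algebraically closed field. This realizes every admissible radius as
  the absolute value of a point at which the Laurent series can be tested.\<close>

lemma value_group:
  assumes "q \<in> \<rat>"
  obtains z :: 'c where "vabs z = real p powr q"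
proof -
  obtain a b where q: "q = real_of_int a / real_of_int b" "0 < b"
    using assms by (metis Rats_cases')
  \<comment> \<open>The exponent is negated because |p| = 1/p.\<close>
  obtain z :: 'c where z: "z ^ nat b = of_nat p powi (- a)"
    using nth_root_exists[of "nat b" "of_nat p powi (- a) :: 'c"] q(2) by auto
  have "vabs z ^ nat b = (1 / real p) powi (- a)"
    using arg_cong[OF z, of vabs] by (simp only: vabs_power vabs_powi vabs_p)
  also have "\<dots> = real p powi a"
    by (simp add: power_int_minus power_int_divide_distrib)
  also have "\<dots> = (real p powr q) ^ nat b"
    using p_gt_1 q by (simp add: powr_real_of_int' [symmetric] powr_realpow[symmetric] powr_powr)
  finally have "vabs z = real p powr q"
    by (rule power_eq_imp_eq_base) (use q(2) in auto)
  then show ?thesis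
    by (rule that)
qed

end

section \<open>Matrix groups\<close>

lemma matrix_inv:
  fixes A :: "'a::semiring_1 ^ 'n ^ 'n"
  assumes "invertible A"
  shows "A ** matrix_inv A = mat 1" "matrix_inv A ** A = mat 1"
  using someI_ex[OF assms[unfolded invertible_def]] by (simp_all add: matrix_inv_def)

lemma invertible_matrix_inv: "invertible A \<Longrightarrow> invertible (matrix_inv A)"
  for A :: "'a::semiring_1 ^ 'n ^ 'n"
  unfolding invertible_def[of "matrix_inv A"] by (intro exI[of _ A]) (simp add: matrix_inv)

lemma matrix_inv_mat_1: "matrix_inv (mat 1 :: 'a::semiring_1 ^ 'n ^ 'n) = mat 1"
proof -
  have "invertible (mat 1 :: 'a ^ 'n ^ 'n)"
    unfolding invertible_def by (intro exI[of _ "mat 1"]) simp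
  from matrix_inv(2)[OF this] show ?thesis
    by simp
qed

lemma GL_simps [simp]:
  "carrier GL = {A. invertible A}" "A \<otimes>\<^bsub>GL\<^esub> B = A ** B" "\<one>\<^bsub>GL\<^esub> = mat 1"
  by (simp_all add: GL_def)

lemma group_GL: "group (GL :: ('a::field ^ 'n ^ 'n) monoid)"
proof (rule groupI)
  fix A :: "'a ^ 'n ^ 'n"
  assume A: "A \<in> carrier GL"
  then have "invertible (matrix_inv A)"
    by (simp add: invertible_matrix_inv)
  then show "\<exists>B\<in>carrier GL. B \<otimes>\<^bsub>GL\<^esub> A = \<one>\<^bsub>GL\<^esub>"
    using matrix_inv(2)[of A] A by auto
next
  show "\<one>\<^bsub>GL\<^esub> \<in> carrier (GL :: ('a ^ 'n ^ 'n) monoid)"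
    by (simp add: invertible_det_nz)
qed (simp_all add: invertible_mult matrix_mul_assoc)

lemma inv_GL: "invertible A \<Longrightarrow> inv\<^bsub>GL\<^esub> A = matrix_inv A"
  for A :: "'a::field ^ 'n ^ 'n"
proof (rule group.inv_equality[OF group_GL])
  assume A: "invertible A"
  then show "matrix_inv A \<in> carrier GL"
    using matrix_inv[of A] by (auto simp: invertible_def)
qed (simp_all add: matrix_inv)

lemma conj_mult:
  fixes t A B :: "'a::field ^ 'n ^ 'n"
  assumes "invertible t"
  shows "t ** (A ** B) ** matrix_inv t = (t ** A ** matrix_inv t) ** (t ** B ** matrix_inv t)"
proof -
  have "(t ** A ** matrix_inv t) ** (t ** B ** matrix_inv t) = t ** A ** (matrix_inv t ** t) ** B ** matrix_inv t"
    by (simp only: matrix_mul_assoc)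
  then show ?thesis
    by (simp add: matrix_inv[OF assms] matrix_mul_assoc)
qed

lemma poly_funs_mono: "f \<in> poly_funs F X \<Longrightarrow> F \<subseteq> F' \<Longrightarrow> f \<in> poly_funs F' X"
  by (induction rule: poly_funs.induct) (auto intro: poly_funs.intros)

text \<open>Only the generators have to pull back to regular functions; sums and products follow by
  induction. Applied to the parametrization of a torus, it turns characters into Laurent
  polynomials.\<close>

lemma poly_funs_comp:
  assumes "f \<in> poly_funs F Y" "\<And>h. h \<in> Y \<Longrightarrow> \<exists>g\<in>poly_funs F X. \<forall>x\<in>D. h (\<theta> x) = g x"
  shows "\<exists>g\<in>poly_funs F X. \<forall>x\<in>D. f (\<theta> x) = g x"
  using assms(1)
proof (induction rule: poly_funs.induct)
  case (const a)
  show ?case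
    by (rule bexI[OF _ poly_funs.const[OF const]]) simp
next
  case (gen f)
  then show ?case
    by (rule assms(2))
next
  case (add f g)
  then obtain f' g' where "f' \<in> poly_funs F X" "\<forall>x\<in>D. f (\<theta> x) = f' x"
    "g' \<in> poly_funs F X" "\<forall>x\<in>D. g (\<theta> x) = g' x"
    by blast
  then show ?case
    by (intro bexI[OF _ poly_funs.add[of f' F X g']]) simp_all
next
  case (mult f g)
  then obtain f' g' where "f' \<in> poly_funs F X" "\<forall>x\<in>D. f (\<theta> x) = f' x"
    "g' \<in> poly_funs F X" "\<forall>x\<in>D. g (\<theta> x) = g' x"
    by blast
  then show ?case
    by (intro bexI[OF _ poly_funs.mult[of f' F X g']]) simp_all
qed

context Cp_field
begin

text \<open>The bridge from algebraic to p-adic data: regular functions are continuous and, if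
  defined over \<open>Qp\<close>, preserve \<open>Qp\<close>-rationality. So an algebraic
  isomorphism is also a homeomorphism on the points at issue.\<close>

lemma poly_funs_tendsto:
  assumes "f \<in> poly_funs F X" "\<And>h. h \<in> X \<Longrightarrow> ((\<lambda>i. h (x i)) \<longlongrightarrow> (h a :: 'c)) Fl"
  shows "((\<lambda>i. f (x i)) \<longlongrightarrow> f a) Fl"
  using assms(1)
  by (induction rule: poly_funs.induct) (simp_all add: tendsto_add_c tendsto_mult_c assms(2))

lemma poly_funs_Qp:
  assumes "f \<in> poly_funs Qp X" "\<And>h. h \<in> X \<Longrightarrow> h a \<in> (Qp :: 'c set)"
  shows "f a \<in> Qp"
  using assms(1)
  by (induction rule: poly_funs.induct) (simp_all add: Qp_add Qp_mult assms(2))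

lemma det_tendsto_c:
  fixes x :: "'i \<Rightarrow> 'c ^ 'n ^ 'n"
  assumes "(x \<longlongrightarrow> a) Fl"
  shows "((\<lambda>i. det (x i)) \<longlongrightarrow> det a) Fl"
  unfolding det_def
  by (intro tendsto_sum_c tendsto_mult_c tendsto_prod_c tendsto_const tendsto_vec_nth assms)

lemma GL_coords_tendsto:
  fixes x :: "'i \<Rightarrow> 'c ^ 'n ^ 'n"
  assumes "(x \<longlongrightarrow> a) Fl" "invertible a" "h \<in> GL_coords"
  shows "((\<lambda>i. h (x i)) \<longlongrightarrow> h a) Fl"
  using assms(3) unfolding GL_coords_def entry_funs_def
proof (elim insertE CollectE exE)
  assume h: "h = (\<lambda>A. inverse (det A))"
  show ?thesis
    unfolding h using assms(2) by (intro tendsto_inverse_c det_tendsto_c assms) (simp add: invertible_det_nz)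
next
  fix i j assume h: "h = (\<lambda>A. A $ i $ j)"
  show ?thesis
    unfolding h by (intro tendsto_vec_nth assms)
qed

lemma det_Qp: "(\<And>i j. A $ i $ j \<in> (Qp :: 'c set)) \<Longrightarrow> det A \<in> Qp" for A :: "'c ^ 'n ^ 'n"
  unfolding det_def by (intro Qp_sum Qp_mult Qp_prod Qp_of_int)

lemma GL_coords_Qp:
  fixes A :: "'c ^ 'n ^ 'n"
  assumes "\<And>i j. A $ i $ j \<in> Qp" "h \<in> GL_coords"
  shows "h A \<in> Qp"
  using assms by (auto simp: GL_coords_def entry_funs_def intro: Qp_inverse det_Qp)

end

section \<open>Root subgroups\<close>

text \<open>The parameter u reduces questions about a root subgroup to the additive group: powers
  become multiples, and conjugation by t becomes scaling by \<beta>(t).\<close>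

locale root_parameter = Cp_field p TC
  for p and TC :: "'c::{alg_closed_field, field_char_0, complete_space} itself" +
  fixes T U :: "('c ^ 'n::finite ^ 'n) set" and \<beta> :: "'c ^ 'n ^ 'n \<Rightarrow> 'c" and u :: "'c \<Rightarrow> 'c ^ 'n ^ 'n"
  assumes U: "subgroup U GL"
    and u_iso: "alg_iso Qp Ga {\<lambda>x. x} (GL\<lparr>carrier := U\<rparr>) GL_coords u"
    and u_conj: "t \<in> T \<Longrightarrow> t ** u x ** matrix_inv t = u (\<beta> t * x)"
begin

lemma u_add: "u (x + y) = u x ** u y" and u_in_U: "u x \<in> U" and bij_u: "bij_betw u UNIV U"
  using u_iso by (auto simp: alg_iso_def iso_def hom_def Ga_def)

lemma u_eq_iff: "u x = u y \<longleftrightarrow> x = y"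
  using bij_u by (simp add: bij_betw_def inj_eq)

lemma u_invertible: "invertible (u x)"
  using subgroup.subset[OF U] u_in_U[of x] by auto

lemma u_0: "u 0 = mat 1"
proof -
  have "u 0 ** u 0 ** matrix_inv (u 0) = u 0 ** matrix_inv (u 0)"
    using u_add[of 0 0] by simp
  then show ?thesis
    using matrix_inv(1)[OF u_invertible[of 0]] by (simp flip: matrix_mul_assoc)
qed

lemma u_minus: "inv\<^bsub>GL\<^esub> (u x) = u (- x)"
  using u_add[of "- x" x] by (intro group.inv_equality[OF group_GL]) (simp_all add: u_0 u_invertible)

lemma u_power: "u x [^]\<^bsub>GL\<^esub> (n::nat) = u (of_nat n * x)"
  by (induction n) (simp_all add: u_0 ring_distribs u_add[symmetric] nat_pow_def add.commute)

lemma u_tendsto: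
  assumes "(f \<longlongrightarrow> x) F"
  shows "((\<lambda>i. u (f i)) \<longlongrightarrow> u x) F"
proof (intro vec_tendstoI)
  fix i j
  have "(\<lambda>A. A $ i $ j) \<in> (GL_coords :: ('c ^ 'n ^ 'n \<Rightarrow> 'c) set)"
    by (auto simp: GL_coords_def entry_funs_def)
  then obtain g where "g \<in> poly_funs Qp {\<lambda>x. x}" "\<And>x. u x $ i $ j = g x"
    using u_iso unfolding alg_iso_def Ga_def by auto
  then show "((\<lambda>k. u (f k) $ i $ j) \<longlongrightarrow> u x $ i $ j) F"
    using poly_funs_tendsto[of g Qp "{\<lambda>x. x}" f x F] assms by simp
qed

lemma u_Qp: "x \<in> Qp \<Longrightarrow> u x $ i $ j \<in> Qp"
proof -
  assume x: "x \<in> Qp"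
  have "(\<lambda>A. A $ i $ j) \<in> (GL_coords :: ('c ^ 'n ^ 'n \<Rightarrow> 'c) set)"
    by (auto simp: GL_coords_def entry_funs_def)
  then obtain g where "g \<in> poly_funs Qp {\<lambda>x. x}" "\<And>x. u x $ i $ j = g x"
    using u_iso unfolding alg_iso_def Ga_def by auto
  then show ?thesis
    using poly_funs_Qp[of g "{\<lambda>x. x}" x] x by simp
qed

lemma inverse_u:
  obtains h where "h \<in> poly_funs Qp GL_coords" "\<And>x. h (u x) = x"
proof -
  have "\<exists>h\<in>poly_funs Qp GL_coords. \<forall>x. x = h (u x)"
    using u_iso by (simp add: alg_iso_def Ga_def)
  then obtain h where h: "h \<in> poly_funs Qp GL_coords" "\<forall>x. x = h (u x)" ..
  show ?thesis
    by (rule that[OF h(1)]) (simp add: h(2)[rule_format, symmetric])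
qed

lemma Qp_of_u:
  assumes "\<And>i j. u x $ i $ j \<in> Qp"
  shows "x \<in> Qp"
proof -
  obtain h where h: "h \<in> poly_funs Qp GL_coords" "\<And>x. h (u x) = x"
    by (rule inverse_u) (rule that)
  have "h (u x) \<in> Qp"
    by (rule poly_funs_Qp[OF h(1) GL_coords_Qp[OF assms]])
  then show ?thesis
    by (simp add: h(2))
qed

end

text \<open>In the coordinate of u, the group \<open>N0 \<inter> U\<close> is the lattice spanned
  over \<open>Zp\<close> by y, the coordinate of the topological generator n_\<beta>.\<close>

locale root_lattice = root_parameter p TC T U \<beta> u
  for p and TC :: "'c::{alg_closed_field, field_char_0, complete_space} itself"
    and T U :: "('c ^ 'n::finite ^ 'n) set" and \<beta> u +
  fixes N0 :: "('c ^ 'n ^ 'n) set" and y :: 'c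
  assumes N0: "subgroup N0 GL" and N0_Qp: "A \<in> N0 \<Longrightarrow> A $ i $ j \<in> Qp"
    and closure_gen: "closure (generate GL {u y}) = N0 \<inter> U"
    and y_nonzero: "y \<noteq> 0"
begin

lemma y_in_N0: "u y \<in> N0"
  using generate.incl[of "u y" "{u y}" GL] closure_subset[of "generate GL {u y}"] closure_gen by blast

lemma u_multiple_in_N0: "u x \<in> N0 \<Longrightarrow> u (of_nat n * x) \<in> N0"
proof (induction n)
  case 0
  then show ?case
    using subgroup.one_closed[OF N0] by (simp add: u_0)
next
  case (Suc n)
  then show ?case
    using subgroup.m_closed[OF N0, of "u x" "u (of_nat n * x)"]
    by (simp add: ring_distribs u_add)
qed

text \<open>Natural multiples remain in the group, and \<open>N0 \<inter> U\<close>, being a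
  closure, contains the limits of such multiples.\<close>

lemma u_Zp_multiple_in_N0:
  assumes "u x \<in> N0" "a \<in> Zp"
  shows "u (a * x) \<in> N0"
proof -
  obtain m where "(\<lambda>i::nat. of_nat (m i) :: 'c) \<longlonglongrightarrow> a"
    using assms(2) by (rule Zp_nat_sequence)
  then have "(\<lambda>i. u (of_nat (m i) * x)) \<longlonglongrightarrow> u (a * x)"
    by (intro u_tendsto tendsto_mult_c tendsto_const)
  then have "u (a * x) \<in> N0 \<inter> U"
    using assms(1) closed_closure[of "generate GL {u y}"] unfolding closure_gen
    by (intro closed_sequentially[of "N0 \<inter> U" "\<lambda>i. u (of_nat (m i) * x)" "u (a * x)"])
      (simp_all add: u_multiple_in_N0 u_in_U)
  then show ?thesis
    by simp
qed

text \<open>Integer multiples of y are no larger than y. The coordinate function h inverse to u is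
  regular, hence continuous, and extends the bound to the closure.\<close>

lemma vabs_le_of_in_N0:
  assumes "u x \<in> N0"
  shows "vabs x \<le> vabs y"
proof -
  obtain h where h: "h \<in> poly_funs Qp GL_coords" "\<And>x. h (u x) = x"
    by (rule inverse_u) (rule that)
  have gen: "\<exists>n. A = u (of_int n * y)" if "A \<in> generate GL {u y}" for A
    using that
  proof (induction rule: generate.induct)
    case one
    then show ?case
      by (intro exI[of _ 0]) (simp add: u_0)
  next
    case (incl A)
    then show ?case
      by (intro exI[of _ 1]) simp
  next
    case (inv A)
    then show ?case
      by (intro exI[of _ "- 1"]) (simp add: u_minus)
  next
    case (eng A B)
    then obtain m n where "A = u (of_int m * y)" "B = u (of_int n * y)"
      by blast
    then show ?case
      by (intro exI[of _ "m + n"]) (simp add: ring_distribs u_add)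
  qed
  have bound: "vabs (h A) \<le> vabs y" if "A \<in> generate GL {u y}" for A
  proof -
    obtain n where "A = u (of_int n * y)"
      using gen[OF \<open>A \<in> _\<close>] by blast
    then have "vabs (h A) = vabs (of_int n :: 'c) * vabs y"
      by (simp add: h(2) vabs_mult)
    also have "\<dots> \<le> 1 * vabs y"
      by (intro mult_right_mono vabs_of_int_le) simp
    finally show ?thesis
      by simp
  qed
  have "u x \<in> closure (generate GL {u y})"
    using assms by (simp add: closure_gen u_in_U)
  then obtain X where X: "\<forall>i. X i \<in> generate GL {u y}" "X \<longlonglongrightarrow> u x"
    unfolding closure_sequential by (elim exE conjE)
  have "(\<lambda>i. h (X i)) \<longlonglongrightarrow> h (u x)"
    by (rule poly_funs_tendsto[OF h(1) GL_coords_tendsto[OF X(2) u_invertible]])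
  then have "vabs (h (u x)) \<le> vabs y"
    by (rule vabs_tendsto_le) (simp add: bound X(1))
  then show ?thesis
    by (simp add: h(2))
qed

lemma padic_power_u:
  assumes "a \<in> Zp"
  shows "padic_power (u y) a = u (a * y)"
proof -
  have "((\<lambda>m. u (of_nat m * y)) \<longlongrightarrow> u (a * y)) (filtercomap of_nat (nhds a))"
    by (intro u_tendsto tendsto_mult_c tendsto_const filterlim_filtercomap)
  then show ?thesis
    unfolding padic_power_def u_power
    by (intro tendsto_Lim Zp_filtercomap_nontrivial assms)
qed

text \<open>Conjugating the generator by t gives the coordinate \<beta>(t) y, again in the lattice;
  dividing by y leaves a p-adic integer.\<close>

lemma T_plus_root_Zp:
  assumes "t \<in> T_plus T N0"
  shows "\<beta> t \<in> Zp"
proof -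
  have "t \<in> T" "t ** u y ** matrix_inv t \<in> N0"
    using assms y_in_N0 by (auto simp: T_plus_def Qp_points_def)
  then have in_N0: "u (\<beta> t * y) \<in> N0"
    using u_conj by simp
  have "\<beta> t * y \<in> Qp" "y \<in> Qp"
    using N0_Qp[OF in_N0] N0_Qp[OF y_in_N0] by (auto intro: Qp_of_u)
  then have "\<beta> t * y * inverse y \<in> Qp"
    by (rule Qp_mult[OF _ Qp_inverse])
  moreover have "vabs (\<beta> t) * vabs y \<le> 1 * vabs y"
    using vabs_le_of_in_N0[OF in_N0] by (simp add: vabs_mult)
  moreover have "\<beta> t * y * inverse y = \<beta> t"
    using y_nonzero by simp
  ultimately show ?thesis
    using y_nonzero by (simp add: Zp_def)
qed

end

section \<open>Coordinates of the second kind\<close>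

lemma ordprod_Nil [simp]: "ordprod M f [] = \<one>\<^bsub>M\<^esub>"
  and ordprod_Cons [simp]: "ordprod M f (b # bs) = f b \<otimes>\<^bsub>M\<^esub> ordprod M f bs"
  by (simp_all add: ordprod_def)

lemma ordprod_cong: "(\<And>b. b \<in> set bs \<Longrightarrow> f b = g b) \<Longrightarrow> ordprod M f bs = ordprod M g bs"
  by (induction bs) simp_all

lemma ordprod_GL_trivial: "(\<And>b. b \<in> set bs \<Longrightarrow> f b = mat 1) \<Longrightarrow> ordprod GL f bs = mat 1"
  by (induction bs) simp_all

lemma ordprod_GL_single:
  "distinct bs \<Longrightarrow> c \<in> set bs \<Longrightarrow> (\<And>b. b \<in> set bs \<Longrightarrow> b \<noteq> c \<Longrightarrow> f b = mat 1) \<Longrightarrow> ordprod GL f bs = f c"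
proof (induction bs)
  case (Cons b bs)
  show ?case
  proof (cases "b = c")
    case True
    then have "ordprod GL f bs = mat 1"
      using Cons.prems by (intro ordprod_GL_trivial) auto
    then show ?thesis
      using True by simp
  next
    case False
    then show ?thesis
      using Cons by simp
  qed
qed simp

lemma ordprod_GL_conj:
  fixes t :: "'a::field ^ 'n ^ 'n"
  assumes "invertible t"
  shows "t ** ordprod GL f bs ** matrix_inv t = ordprod GL (\<lambda>b. t ** f b ** matrix_inv t) bs"
  by (induction bs) (simp_all add: matrix_inv[OF assms] conj_mult[OF assms])

locale root_coordinates = Cp_field p TC
  for p and TC :: "'c::{alg_closed_field, field_char_0, complete_space} itself" +
  fixes T N0 :: "('c ^ 'n::finite ^ 'n) set"
    and bs :: "('c ^ 'n ^ 'n \<Rightarrow> 'c) list"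
    and U :: "('c ^ 'n ^ 'n \<Rightarrow> 'c) \<Rightarrow> ('c ^ 'n ^ 'n) set"
    and u :: "('c ^ 'n ^ 'n \<Rightarrow> 'c) \<Rightarrow> 'c \<Rightarrow> 'c ^ 'n ^ 'n"
    and y :: "('c ^ 'n ^ 'n \<Rightarrow> 'c) \<Rightarrow> 'c"
    and gen :: "('c ^ 'n ^ 'n \<Rightarrow> 'c) \<Rightarrow> 'c ^ 'n ^ 'n"
  assumes lattice: "\<beta> \<in> set bs \<Longrightarrow> root_lattice p TC T (U \<beta>) \<beta> (u \<beta>) N0 (y \<beta>)"
    and gen: "\<beta> \<in> set bs \<Longrightarrow> gen \<beta> = u \<beta> (y \<beta>)"
    and distinct: "distinct bs"
    and inj_ordprod: "inj_on (\<lambda>f. ordprod GL f bs) (\<Pi>\<^sub>E \<beta>\<in>set bs. N0 \<inter> U \<beta>)"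
    and root_nonzero: "\<beta> \<in> set bs \<Longrightarrow> t \<in> T \<Longrightarrow> \<beta> t \<noteq> 0"
begin

lemma padic_power_gen: "\<beta> \<in> set bs \<Longrightarrow> x \<in> Zp \<Longrightarrow> padic_power (gen \<beta>) x = u \<beta> (x * y \<beta>)"
  using root_lattice.padic_power_u[OF lattice] gen by simp

text \<open>\<open>coords\<close> is a definite description. Its uniqueness combines unique
  factorization in the given order with the injectivity of each u \<beta> and y \<beta> \<noteq>
  0.\<close>

lemma coords_ordprod:
  assumes x: "\<And>\<beta>. \<beta> \<in> set bs \<Longrightarrow> x \<beta> \<in> Zp" "\<And>\<beta>. \<beta> \<notin> set bs \<Longrightarrow> x \<beta> = 0"
  shows "coords bs gen (ordprod GL (\<lambda>\<beta>. padic_power (gen \<beta>) (x \<beta>)) bs) = x"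
  unfolding coords_def
proof (rule the_equality)
  show "(\<forall>\<beta>\<in>set bs. x \<beta> \<in> Zp) \<and> (\<forall>\<beta>. \<beta> \<notin> set bs \<longrightarrow> x \<beta> = 0) \<and>
      ordprod GL (\<lambda>\<beta>. padic_power (gen \<beta>) (x \<beta>)) bs = ordprod GL (\<lambda>\<beta>. padic_power (gen \<beta>) (x \<beta>)) bs"
    using x by simp
next
  fix x' assume x': "(\<forall>\<beta>\<in>set bs. x' \<beta> \<in> Zp) \<and> (\<forall>\<beta>. \<beta> \<notin> set bs \<longrightarrow> x' \<beta> = 0) \<and>
      ordprod GL (\<lambda>\<beta>. padic_power (gen \<beta>) (x \<beta>)) bs = ordprod GL (\<lambda>\<beta>. padic_power (gen \<beta>) (x' \<beta>)) bs"
  \<comment> \<open>The restriction to \<open>set bs\<close> places the tuple of factors in the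
    extensional product on which \<open>inj_ordprod\<close> is stated.\<close>
  let ?f = "\<lambda>x. \<lambda>\<beta>\<in>set bs. u \<beta> (x \<beta> * y \<beta>)"
  have in_PiE: "?f z \<in> (\<Pi>\<^sub>E \<beta>\<in>set bs. N0 \<inter> U \<beta>)" if "\<forall>\<beta>\<in>set bs. z \<beta> \<in> Zp" for z
    using that root_lattice.u_Zp_multiple_in_N0[OF lattice] root_lattice.y_in_N0[OF lattice]
      root_parameter.u_in_U[OF root_lattice.axioms(1)[OF lattice]] by auto
  have ordprod_f: "ordprod GL (?f z) bs = ordprod GL (\<lambda>\<beta>. padic_power (gen \<beta>) (z \<beta>)) bs"
    if "\<forall>\<beta>\<in>set bs. z \<beta> \<in> Zp" for z
    using that by (intro ordprod_cong) (simp add: padic_power_gen)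
  have eq: "?f x = ?f x'"
    using x x' by (intro inj_onD[OF inj_ordprod] in_PiE) (simp_all add: ordprod_f)
  have "u \<beta> (x \<beta> * y \<beta>) = u \<beta> (x' \<beta> * y \<beta>)" if "\<beta> \<in> set bs" for \<beta>
    using fun_cong[OF eq, of \<beta>] that by simp
  then have "x \<beta> = x' \<beta>" if "\<beta> \<in> set bs" for \<beta>
    using that root_parameter.u_eq_iff[OF root_lattice.axioms(1)[OF lattice]]
      root_lattice.y_nonzero[OF lattice] by simp
  then have "x' \<beta> = x \<beta>" for \<beta>
    using x(2)[of \<beta>] x' by (cases "\<beta> \<in> set bs") auto
  then show "x' = x"
    by (rule ext)
qed

lemma coords_root_element:
  assumes "\<gamma> \<in> set bs" "x \<in> Zp"
  shows "coords bs gen (u \<gamma> (x * y \<gamma>)) = (\<lambda>\<delta>. if \<delta> = \<gamma> then x else 0)"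
proof -
  have "0 \<in> (Zp :: 'c set)"
    using Zp_of_nat[of 0] by simp
  then have "coords bs gen (ordprod GL (\<lambda>\<delta>. padic_power (gen \<delta>) (if \<delta> = \<gamma> then x else 0)) bs) =
      (\<lambda>\<delta>. if \<delta> = \<gamma> then x else 0)"
    using assms by (intro coords_ordprod) auto
  moreover have "ordprod GL (\<lambda>\<delta>. padic_power (gen \<delta>) (if \<delta> = \<gamma> then x else 0)) bs = u \<gamma> (x * y \<gamma>)"
    using assms \<open>0 \<in> Zp\<close> root_parameter.u_0[OF root_lattice.axioms(1)[OF lattice]] distinct
    by (subst ordprod_GL_single[of _ \<gamma>]) (simp_all add: padic_power_gen)
  ultimately show ?thesis
    by simp
qed

text \<open>The coefficients of a power series in the single variable b_\<gamma>. The constant term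
  is left out because phi_t(b_\<gamma>) is a Dirac distribution minus 1.\<close>

definition axis_family :: "'r \<Rightarrow> (nat \<Rightarrow> 'c) \<Rightarrow> ('r \<Rightarrow> nat) \<Rightarrow> 'c" where
  "axis_family \<gamma> a k = (if k \<gamma> \<noteq> 0 \<and> (\<forall>\<delta>. \<delta> \<noteq> \<gamma> \<longrightarrow> k \<delta> = 0) then a (k \<gamma>) else 0)"

text \<open>Conjugation by t stays in the root subgroup, so all coordinates other than that of
  \<gamma> vanish; and 0 choose n = 0 for n > 0 removes every monomial that involves another
  variable.\<close>

lemma phi_b_eq_axis_family:
  assumes "t \<in> T_plus T N0" "\<gamma> \<in> set bs"
  shows "phi_b bs gen t \<gamma> = axis_family \<gamma> (\<lambda>n. \<gamma> t gchoose n)"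
proof
  fix k :: "('c ^ 'n ^ 'n \<Rightarrow> 'c) \<Rightarrow> nat"
  have "t \<in> T"
    using assms by (simp add: T_plus_def Qp_points_def)
  then have "t ** gen \<gamma> ** matrix_inv t = u \<gamma> (\<gamma> t * y \<gamma>)"
    using root_parameter.u_conj[OF root_lattice.axioms(1)[OF lattice]] assms(2) by (simp add: gen)
  then have coords: "coords bs gen (t ** gen \<gamma> ** matrix_inv t) = (\<lambda>\<delta>. if \<delta> = \<gamma> then \<gamma> t else 0)"
    using coords_root_element root_lattice.T_plus_root_Zp[OF lattice] assms by simp
  show "phi_b bs gen t \<gamma> k = axis_family \<gamma> (\<lambda>n. \<gamma> t gchoose n) k"
  proof (cases "\<forall>\<delta>. \<delta> \<noteq> \<gamma> \<longrightarrow> k \<delta> = 0")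
    case True
    have "(\<Prod>\<delta>\<in>set bs. (if \<delta> = \<gamma> then \<gamma> t else 0) gchoose k \<delta>) =
        (\<Prod>\<delta>\<in>set bs. if \<delta> = \<gamma> then \<gamma> t gchoose k \<gamma> else 1)"
      using True by (intro prod.cong) auto
    also have "\<dots> = \<gamma> t gchoose k \<gamma>"
      using assms(2) by simp
    finally have "dirac bs gen (t ** gen \<gamma> ** matrix_inv t) k = \<gamma> t gchoose k \<gamma>"
      using True assms(2) unfolding dirac_def coords by (auto simp: indices_def)
    moreover have "k = (\<lambda>_. 0) \<longleftrightarrow> k \<gamma> = 0"
      using True by (metis (full_types))
    ultimately show ?thesis
      using True by (simp add: phi_b_def axis_family_def scalar_def)
  next
    case False
    then obtain \<delta> where \<delta>: "\<delta> \<noteq> \<gamma>" "k \<delta> \<noteq> 0"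
      by blast
    have "dirac bs gen (t ** gen \<gamma> ** matrix_inv t) k = 0"
    proof (cases "k \<in> indices bs")
      case True
      then have "\<delta> \<in> set bs"
        using \<delta>(2) by (auto simp: indices_def)
      moreover have "(if \<delta> = \<gamma> then \<gamma> t else 0) gchoose k \<delta> = 0"
        using \<delta> by (cases "k \<delta>") (simp_all add: gbinomial_Suc)
      ultimately show ?thesis
        using True unfolding dirac_def coords by (auto intro!: prod_zero bexI[of _ \<delta>])
    qed (simp add: dirac_def)
    then show ?thesis
      using False \<delta>(2) by (auto simp: phi_b_def axis_family_def scalar_def)
  qed
qed

end

section \<open>Norms of distributions\<close>

lemma indices_nonempty: "indices bs \<noteq> {}"
  by (auto simp: indices_def intro: exI[of _ "\<lambda>_. 0"])

lemma bounded_atI: "(\<And>k. k \<in> indices bs \<Longrightarrow> vabs (d k) * \<rho> ^ total_degree bs k \<le> B) \<Longrightarrow> bounded_at bs \<rho> d"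
  unfolding bounded_at_def by (rule bdd_aboveI2)

lemma dist_rnorm_le:
  "(\<And>k. k \<in> indices bs \<Longrightarrow> vabs (d k) * \<rho> ^ total_degree bs k \<le> B) \<Longrightarrow> dist_rnorm bs \<rho> d \<le> B"
  unfolding dist_rnorm_def by (rule cSUP_least[OF indices_nonempty])

lemma dist_rnorm_ge:
  "bounded_at bs \<rho> d \<Longrightarrow> k \<in> indices bs \<Longrightarrow> vabs (d k) * \<rho> ^ total_degree bs k \<le> dist_rnorm bs \<rho> d"
  unfolding dist_rnorm_def bounded_at_def by (rule cSUP_upper)

lemma distributions_subset:
  assumes "d \<in> distributions K bs" "0 < \<rho>" "\<rho> < 1"
  shows "d \<in> carrier (distribution_ring K bs gen \<rho>)"
proof -
  have "dist_rnorm bs \<rho> (\<lambda>k. d k - d k) < e" if "0 < e" for e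
    using dist_rnorm_le[of bs "\<lambda>k. d k - d k" \<rho> 0] that by simp
  then show ?thesis
    using assms unfolding distribution_ring_def distributions_def by fastforce
qed

context root_coordinates
begin

lemma dist_rnorm_scalar: "dist_rnorm bs \<rho> (scalar a) = vabs (a :: 'c)"
proof (rule antisym)
  have le: "vabs (scalar a k) * \<rho> ^ total_degree bs k \<le> vabs a" for k
    by (auto simp: scalar_def total_degree_def)
  then show "dist_rnorm bs \<rho> (scalar a) \<le> vabs a"
    by (rule dist_rnorm_le)
  define z :: "('c ^ 'n ^ 'n \<Rightarrow> 'c) \<Rightarrow> nat" where "z = (\<lambda>_. 0)"
  have "vabs (scalar a z) * \<rho> ^ total_degree bs z \<le> dist_rnorm bs \<rho> (scalar a)"
    by (rule dist_rnorm_ge[OF bounded_atI[where B = "vabs a"]]) (simp_all add: le indices_def z_def)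
  then show "vabs a \<le> dist_rnorm bs \<rho> (scalar a)"
    by (simp add: scalar_def total_degree_def z_def)
qed

lemma scalar_in_distributions:
  assumes "0 \<in> K" "a \<in> K"
  shows "scalar a \<in> distributions K bs"
proof -
  have "vabs (scalar a k) * \<rho> ^ total_degree bs k \<le> vabs a" for k \<rho>
    by (auto simp: scalar_def total_degree_def)
  then have "bounded_at bs \<rho> (scalar a)" for \<rho>
    by (rule bounded_atI)
  then show ?thesis
    using assms by (auto simp: distributions_def coeff_families_def scalar_def indices_def)
qed

lemma axis_family_outside:
  assumes "\<gamma> \<in> set bs" "k \<notin> indices bs"
  shows "axis_family \<gamma> a k = 0"
proof -
  obtain \<delta> where "\<delta> \<notin> set bs" "k \<delta> \<noteq> 0"
    using assms(2) by (auto simp: indices_def)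
  then have "\<delta> \<noteq> \<gamma>" "k \<delta> \<noteq> 0"
    using assms(1) by auto
  then show ?thesis
    by (auto simp: axis_family_def)
qed

lemma axis_family_bound:
  assumes "\<gamma> \<in> set bs" "\<And>n. 0 < n \<Longrightarrow> vabs (a n) * \<rho> ^ n \<le> B" "0 \<le> B"
  shows "vabs (axis_family \<gamma> a k) * \<rho> ^ total_degree bs k \<le> B"
proof (cases "k \<gamma> \<noteq> 0 \<and> (\<forall>\<delta>. \<delta> \<noteq> \<gamma> \<longrightarrow> k \<delta> = 0)")
  case True
  then have "total_degree bs k = (\<Sum>\<delta>\<in>set bs. if \<delta> = \<gamma> then k \<gamma> else 0)"
    unfolding total_degree_def by (intro sum.cong) auto
  then have "total_degree bs k = k \<gamma>"
    using assms(1) by simp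
  then show ?thesis
    using True assms(2) by (simp add: axis_family_def)
next
  case False
  then have "axis_family \<gamma> a k = 0"
    unfolding axis_family_def by (rule if_not_P)
  then show ?thesis
    using assms(3) by simp
qed

text \<open>A real supremum is known to bound its terms only when the family is bounded; that is the
  purpose of B.\<close>

lemma axis_family_norm_ge:
  assumes "\<gamma> \<in> set bs" "\<And>n. 0 < n \<Longrightarrow> vabs (a n) * \<rho> ^ n \<le> B" "0 \<le> B" "0 < q"
  shows "vabs (a q) * \<rho> ^ q \<le> dist_rnorm bs \<rho> (axis_family \<gamma> a)"
proof -
  let ?k = "\<lambda>\<delta>. if \<delta> = \<gamma> then q else 0"
  have "total_degree bs ?k = q"
    using assms(1) by (simp add: total_degree_def)
  moreover have "vabs (axis_family \<gamma> a ?k) * \<rho> ^ total_degree bs ?k \<le> dist_rnorm bs \<rho> (axis_family \<gamma> a)"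
    using assms(1) axis_family_bound[OF assms(1-3)]
    by (intro dist_rnorm_ge bounded_atI) (auto simp: indices_def)
  ultimately show ?thesis
    using assms(4) by (simp add: axis_family_def)
qed

context
  fixes t \<gamma>
  assumes t: "t \<in> T_plus T N0" and \<gamma>: "\<gamma> \<in> set bs"
begin

lemma root_Zp: "\<gamma> t \<in> Zp"
  by (rule root_lattice.T_plus_root_Zp[OF lattice[OF \<gamma>] t])

lemma vabs_gchoose_power_le:
  assumes "0 \<le> \<rho>" "\<rho> \<le> 1" "0 < n"
  shows "vabs (\<gamma> t gchoose n) * \<rho> ^ n \<le> \<rho>"
proof -
  have "vabs (\<gamma> t gchoose n) * \<rho> ^ n \<le> 1 * \<rho> ^ 1"
    using assms root_Zp by (intro mult_mono vabs_gchoose_le power_decreasing) auto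
  then show ?thesis
    by simp
qed

lemma phi_b_in_distributions:
  assumes "Qp \<subseteq> K"
  shows "phi_b bs gen t \<gamma> \<in> distributions K bs"
proof -
  have "bounded_at bs \<rho> (axis_family \<gamma> (\<lambda>n. \<gamma> t gchoose n))" if "0 < \<rho>" "\<rho> < 1" for \<rho>
    using that by (intro bounded_atI[where B = \<rho>] axis_family_bound \<gamma> vabs_gchoose_power_le) auto
  moreover have "\<gamma> t gchoose n \<in> K" for n
    using Qp_gchoose root_Zp assms by (auto simp: Zp_def)
  ultimately show ?thesis
    using assms Qp_0 axis_family_outside[OF \<gamma>]
    unfolding phi_b_eq_axis_family[OF t \<gamma>] distributions_def coeff_families_def
    by (auto simp: axis_family_def)
qed

lemma phi_b_norm_le:
  "0 < \<rho> \<Longrightarrow> \<rho> < 1 \<Longrightarrow> dist_rnorm bs \<rho> (phi_b bs gen t \<gamma>) \<le> \<rho>"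
  unfolding phi_b_eq_axis_family[OF t \<gamma>]
  by (intro dist_rnorm_le axis_family_bound \<gamma> vabs_gchoose_power_le) auto

lemma phi_b_norm_ge_term:
  "0 < \<rho> \<Longrightarrow> \<rho> < 1 \<Longrightarrow> 0 < q \<Longrightarrow> vabs (\<gamma> t gchoose q) * \<rho> ^ q \<le> dist_rnorm bs \<rho> (phi_b bs gen t \<gamma>)"
  unfolding phi_b_eq_axis_family[OF t \<gamma>]
  by (intro axis_family_norm_ge[where B = \<rho>] \<gamma> vabs_gchoose_power_le) auto

text \<open>The exponent q is a power of p that depends on t and \<gamma> but not on the radius, so
  one choice serves all radii.\<close>

lemma phi_b_norm_ge:
  obtains q where "0 < q" "\<And>\<rho>. 0 < \<rho> \<Longrightarrow> \<rho> < 1 \<Longrightarrow> \<rho> ^ q \<le> dist_rnorm bs \<rho> (phi_b bs gen t \<gamma>)"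
proof -
  have "\<gamma> t \<noteq> 0"
    using root_nonzero \<gamma> t by (simp add: T_plus_def Qp_points_def)
  with root_Zp obtain m where "vabs (\<gamma> t) = (1 / real p) ^ m"
    by (rule Zp_vabs_eq_power)
  then have unit: "vabs (\<gamma> t gchoose p ^ m) = 1"
    by (rule vabs_gchoose_prime_power)
  have "0 < p ^ m"
    using p_gt_1 by simp
  with phi_b_norm_ge_term[of _ "p ^ m"] unit show ?thesis
    by (intro that[of "p ^ m"]) simp_all
qed

lemma phi_b_norm_eq:
  assumes "\<gamma> t = 1" "0 < \<rho>" "\<rho> < 1"
  shows "dist_rnorm bs \<rho> (phi_b bs gen t \<gamma>) = \<rho>"
  using phi_b_norm_le[of \<rho>] phi_b_norm_ge_term[of \<rho> 1] assms by (simp add: vabs_1)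

text \<open>For n < r the binomial coefficient is divisible by p, and 1/p \<le> rho^r; for n \<ge> r
  the power of rho is small enough by itself.\<close>

lemma phi_b_norm_le_power:
  assumes "\<gamma> t = of_nat (p ^ m)" "r \<le> p ^ m" "0 < \<rho>" "\<rho> < 1" "1 / real p \<le> \<rho> ^ r"
  shows "dist_rnorm bs \<rho> (phi_b bs gen t \<gamma>) \<le> \<rho> ^ r"
  unfolding phi_b_eq_axis_family[OF t \<gamma>]
proof (intro dist_rnorm_le axis_family_bound \<gamma>)
  fix n :: nat assume "0 < n"
  show "vabs (\<gamma> t gchoose n) * \<rho> ^ n \<le> \<rho> ^ r"
  proof (cases "n < r")
    case True
    have "vabs (\<gamma> t gchoose n) * \<rho> ^ n \<le> 1 / real p * 1"
      unfolding assms(1) using True assms \<open>0 < n\<close>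
      by (intro mult_mono vabs_prime_power_gchoose_le power_le_one) auto
    then show ?thesis
      using assms(5) by simp
  next
    case False
    have "vabs (\<gamma> t gchoose n) * \<rho> ^ n \<le> 1 * \<rho> ^ r"
      using False assms root_Zp by (intro mult_mono vabs_gchoose_le power_decreasing) auto
    then show ?thesis
      by simp
  qed
qed (use assms in auto)

end

end

section \<open>Rings with two multiplicative norms\<close>

lemma int_pow_nonneg: "0 \<le> n \<Longrightarrow> x [^]\<^bsub>G\<^esub> (n::int) = x [^]\<^bsub>G\<^esub> nat n"
  by (subst int_pow_def2) (rule if_not_P, simp)

lemma int_pow_negative: "n < 0 \<Longrightarrow> x [^]\<^bsub>G\<^esub> (n::int) = inv\<^bsub>G\<^esub> (x [^]\<^bsub>G\<^esub> nat (- n))"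
  by (subst int_pow_def2) (rule if_P)

locale normed_ring_pair = ring A for A :: "'a normed_ring" (structure) +
  fixes \<rho>1 \<rho>2 :: real
  assumes multiplicative: "\<rho> \<in> {\<rho>1, \<rho>2} \<Longrightarrow> multiplicative_rnorm A \<rho>"
    and one_not_zero: "\<one> \<noteq> \<zero>"
    and complete: "Metric_space.mcomplete (carrier A) (max_dist A \<rho>1 \<rho>2)"
begin

context
  fixes \<rho> assumes \<rho>: "\<rho> \<in> {\<rho>1, \<rho>2}"
begin

lemma rnorm_nonneg: "x \<in> carrier A \<Longrightarrow> 0 \<le> rnorm A \<rho> x"
  and rnorm_eq_0_iff: "x \<in> carrier A \<Longrightarrow> rnorm A \<rho> x = 0 \<longleftrightarrow> x = \<zero>"
  and rnorm_add_le: "x \<in> carrier A \<Longrightarrow> y \<in> carrier A \<Longrightarrow> rnorm A \<rho> (x \<oplus> y) \<le> max (rnorm A \<rho> x) (rnorm A \<rho> y)"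
  and rnorm_mult: "x \<in> carrier A \<Longrightarrow> y \<in> carrier A \<Longrightarrow> rnorm A \<rho> (x \<otimes> y) = rnorm A \<rho> x * rnorm A \<rho> y"
  using multiplicative[OF \<rho>] by (simp_all add: multiplicative_rnorm_def)

lemma rnorm_one: "rnorm A \<rho> \<one> = 1"
  using rnorm_mult[of \<one> \<one>] rnorm_eq_0_iff[of \<one>] one_not_zero by simp

lemma rnorm_zero: "rnorm A \<rho> \<zero> = 0"
  using rnorm_eq_0_iff[of \<zero>] by simp

lemma rnorm_minus:
  assumes "x \<in> carrier A"
  shows "rnorm A \<rho> (\<ominus> x) = rnorm A \<rho> x"
proof -
  have "rnorm A \<rho> (\<ominus> \<one>) * rnorm A \<rho> (\<ominus> \<one>) = 1"
    using rnorm_mult[of "\<ominus> \<one>" "\<ominus> \<one>"] by (simp add: l_minus r_minus rnorm_one)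
  then have "rnorm A \<rho> (\<ominus> \<one>) = 1"
    using rnorm_nonneg[of "\<ominus> \<one>"] by (simp add: power2_eq_1_iff flip: power2_eq_square)
  then show ?thesis
    using rnorm_mult[of "\<ominus> \<one>" x] assms by (simp add: l_minus)
qed

lemma rnorm_diff_commute:
  assumes "x \<in> carrier A" "y \<in> carrier A"
  shows "rnorm A \<rho> (x \<ominus> y) = rnorm A \<rho> (y \<ominus> x)"
proof -
  have "\<ominus> (x \<ominus> y) = y \<ominus> x"
    using assms by (simp add: a_minus_def minus_add a_comm)
  then show ?thesis
    using rnorm_minus[of "x \<ominus> y"] assms by simp
qed

lemma rnorm_diff_triangle:
  assumes "x \<in> carrier A" "y \<in> carrier A" "z \<in> carrier A"
  shows "rnorm A \<rho> (x \<ominus> z) \<le> max (rnorm A \<rho> (x \<ominus> y)) (rnorm A \<rho> (y \<ominus> z))"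
proof -
  have "(x \<ominus> y) \<oplus> (y \<ominus> z) = x \<ominus> z"
    using assms by (simp add: a_minus_def a_assoc r_neg1)
  then show ?thesis
    using rnorm_add_le[of "x \<ominus> y" "y \<ominus> z"] assms by simp
qed

lemma rnorm_nat_pow: "x \<in> carrier A \<Longrightarrow> rnorm A \<rho> (x [^] (n::nat)) = rnorm A \<rho> x ^ n"
  by (induction n) (simp_all add: rnorm_one rnorm_mult)

lemma rnorm_int_pow:
  assumes "x \<in> Units A"
  shows "rnorm A \<rho> (x [^] (n::int)) = rnorm A \<rho> x powi n"
proof -
  have inverse: "rnorm A \<rho> (inv z) = inverse (rnorm A \<rho> z)" if "z \<in> Units A" for z
  proof -
    have "rnorm A \<rho> z * rnorm A \<rho> (inv z) = 1"
      using rnorm_mult[of z "inv z"] that by (simp add: rnorm_one Units_closed)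
    then show ?thesis
      by (rule inverse_unique[symmetric])
  qed
  have pow: "x [^] m \<in> Units A" for m :: nat
    using assms by (induction m) simp_all
  have x: "x \<in> carrier A"
    using assms by (rule Units_closed)
  show ?thesis
  proof (cases "n < 0")
    case True
    then have "rnorm A \<rho> (x [^] n) = inverse (rnorm A \<rho> (x [^] nat (- n)))"
      using inverse[OF pow, of "nat (- n)"] by (simp only: int_pow_negative)
    also have "\<dots> = rnorm A \<rho> x powi n"
      using True by (simp only: rnorm_nat_pow[OF x] power_int_def power_inverse) simp
    finally show ?thesis .
  next
    case False
    then have "0 \<le> n"
      by simp
    then show ?thesis
      by (simp only: int_pow_nonneg rnorm_nat_pow[OF x] power_int_def if_True)
  qed
qed

lemma rnorm_ordprod:
  assumes "distinct bs" "\<And>b. b \<in> set bs \<Longrightarrow> f b \<in> carrier A"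
  shows "ordprod A f bs \<in> carrier A \<and> rnorm A \<rho> (ordprod A f bs) = (\<Prod>b\<in>set bs. rnorm A \<rho> (f b))"
  using assms by (induction bs) (simp_all add: rnorm_one rnorm_mult)

lemma rnorm_finsum_le:
  assumes "finite F" "f \<in> F \<rightarrow> carrier A" "0 \<le> e" "\<And>k. k \<in> F \<Longrightarrow> rnorm A \<rho> (f k) \<le> e"
  shows "rnorm A \<rho> (finsum A f F) \<le> e"
  using assms
proof (induction F rule: finite_induct)
  case empty
  then show ?case
    by (simp add: rnorm_zero)
next
  case (insert k F)
  then show ?case
    using rnorm_add_le[of "f k" "finsum A f F"] by (fastforce simp: Pi_def)
qed

end

definition max_norm :: "'a \<Rightarrow> real" where
  "max_norm x = max (rnorm A \<rho>1 x) (rnorm A \<rho>2 x)"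

lemma max_dist_eq: "x \<in> carrier A \<Longrightarrow> y \<in> carrier A \<Longrightarrow> max_dist A \<rho>1 \<rho>2 x y = max_norm (x \<ominus> y)"
  by (simp add: max_dist_def max_norm_def)

lemma max_norm_le_iff: "max_norm x \<le> e \<longleftrightarrow> (\<forall>\<rho>\<in>{\<rho>1, \<rho>2}. rnorm A \<rho> x \<le> e)"
  by (simp add: max_norm_def)

lemma max_norm_diff_triangle:
  assumes "x \<in> carrier A" "y \<in> carrier A" "z \<in> carrier A"
  shows "max_norm (x \<ominus> z) \<le> max (max_norm (x \<ominus> y)) (max_norm (y \<ominus> z))"
  using rnorm_diff_triangle[OF _ assms, of \<rho>1] rnorm_diff_triangle[OF _ assms, of \<rho>2]
  by (auto simp: max_norm_def max_def split: if_splits)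

lemma Metric_space: "Metric_space (carrier A) (max_dist A \<rho>1 \<rho>2)"
proof
  fix x y z
  show "0 \<le> max_dist A \<rho>1 \<rho>2 x y"
    using rnorm_nonneg[of \<rho>1 "x \<ominus> y"] by (auto simp: max_dist_def max_def)
  show "max_dist A \<rho>1 \<rho>2 x y = max_dist A \<rho>1 \<rho>2 y x"
    by (simp add: max_dist_def rnorm_diff_commute)
  show "max_dist A \<rho>1 \<rho>2 x y = 0 \<longleftrightarrow> x = y" if "x \<in> carrier A" "y \<in> carrier A"
  proof
    assume "max_dist A \<rho>1 \<rho>2 x y = 0"
    then have "rnorm A \<rho>1 (x \<ominus> y) = 0"
      using that rnorm_nonneg[of \<rho>1 "x \<ominus> y"] by (auto simp: max_dist_def max_def split: if_splits)
    then have "x \<ominus> y = \<zero>"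
      using that by (simp add: rnorm_eq_0_iff)
    moreover have "(x \<ominus> y) \<oplus> y = x"
      using that by (simp add: a_minus_def a_assoc l_neg)
    ultimately show "x = y"
      using that by simp
  next
    assume "x = y"
    then show "max_dist A \<rho>1 \<rho>2 x y = 0"
      using that by (simp add: max_dist_def a_minus_def r_neg rnorm_zero)
  qed
  show "max_dist A \<rho>1 \<rho>2 x z \<le> max_dist A \<rho>1 \<rho>2 x y + max_dist A \<rho>1 \<rho>2 y z"
    if "x \<in> carrier A" "y \<in> carrier A" "z \<in> carrier A"
  proof -
    have "0 \<le> max_norm (x \<ominus> y)" "0 \<le> max_norm (y \<ominus> z)"
      using that by (auto simp: max_norm_def max_def rnorm_nonneg)
    then show ?thesis
      using max_norm_diff_triangle[OF that] that by (simp add: max_dist_eq)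
  qed
qed

sublocale M: Metric_space "carrier A" "max_dist A \<rho>1 \<rho>2"
  by (rule Metric_space)

lemma max_topology_eq: "max_topology A \<rho>1 \<rho>2 = M.mtopology"
  by (simp add: max_topology_def)

lemma topspace_max_topology: "topspace (max_topology A \<rho>1 \<rho>2) = carrier A"
  by (simp add: max_topology_eq)

text \<open>As in the field: a term outside E is the difference of two partial sums close to s, and
  the maximum of the two norms is again ultrametric.\<close>

lemma null_family_of_convergent_finsum:
  assumes f: "f \<in> I \<rightarrow> carrier A"
    and s: "limitin (max_topology A \<rho>1 \<rho>2) (\<lambda>F. finsum A f F) s (finite_subsets_at_top I)"
    and \<rho>: "\<rho> \<in> {\<rho>1, \<rho>2}"
  shows "null_family (\<lambda>k. rnorm A \<rho> (f k)) I"
  unfolding null_family_def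
proof (intro allI impI)
  fix e :: real assume "0 < e"
  have sA: "s \<in> carrier A"
    using s by (simp add: max_topology_eq M.limitin_mspace)
  have "\<forall>\<^sub>F F in finite_subsets_at_top I. finsum A f F \<in> carrier A \<and> max_dist A \<rho>1 \<rho>2 (finsum A f F) s < e"
    using s \<open>0 < e\<close> by (simp add: max_topology_eq M.limitin_metric)
  then obtain E where E: "finite E" "E \<subseteq> I"
    "\<And>F. finite F \<Longrightarrow> E \<subseteq> F \<Longrightarrow> F \<subseteq> I \<Longrightarrow> max_dist A \<rho>1 \<rho>2 (finsum A f F) s < e"
    by (auto simp: eventually_finite_subsets_at_top)
  have "{k \<in> I. e \<le> rnorm A \<rho> (f k)} \<subseteq> E"
  proof (rule subsetI, rule ccontr)
    fix k assume k: "k \<in> {k \<in> I. e \<le> rnorm A \<rho> (f k)}" "k \<notin> E"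
    let ?S = "finsum A f E"
    have S: "?S \<in> carrier A" "f k \<in> carrier A"
      using f E(2) k by (auto intro!: finsum_closed)
    have "finsum A f (insert k E) = f k \<oplus> ?S"
      using f E k by (intro finsum_insert) auto
    then have "max_dist A \<rho>1 \<rho>2 (f k \<oplus> ?S) s < e"
      using E(3)[of "insert k E"] E(1,2) k by auto
    moreover have "max_dist A \<rho>1 \<rho>2 ?S s < e"
      using E by blast
    ultimately have "max_norm ((f k \<oplus> ?S) \<ominus> s) < e" "max_norm (s \<ominus> ?S) < e"
      using S sA by (simp_all add: max_dist_eq max_norm_def rnorm_diff_commute[of _ s])
    then have "max_norm ((f k \<oplus> ?S) \<ominus> ?S) < e"
      using max_norm_diff_triangle[of "f k \<oplus> ?S" s ?S] S sA by simp
    moreover have "(f k \<oplus> ?S) \<ominus> ?S = f k"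
      using S by (simp add: a_minus_def a_assoc r_neg)
    ultimately have "max_norm (f k) < e"
      by simp
    then show False
      using k \<rho> by (auto simp: max_norm_def)
  qed
  then show "finite {k \<in> I. e \<le> rnorm A \<rho> (f k)}"
    using E(1) by (rule finite_subset)
qed

text \<open>Completeness holds for the maximum of the two norms, so the partial sums are made Cauchy
  by discarding the terms that are large in either norm.\<close>

lemma convergent_finsum_of_null_family:
  assumes f: "f \<in> I \<rightarrow> carrier A"
    and null: "\<And>\<rho>. \<rho> \<in> {\<rho>1, \<rho>2} \<Longrightarrow> null_family (\<lambda>k. rnorm A \<rho> (f k)) I"
  shows "\<exists>s. limitin (max_topology A \<rho>1 \<rho>2) (\<lambda>F. finsum A f F) s (finite_subsets_at_top I)"
  unfolding max_topology_eq
proof (rule M.convergent_finite_subsets[OF complete])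
  show "finsum A f F \<in> carrier A" if "F \<subseteq> I" for F
    using f that by (intro finsum_closed) auto
  fix e :: real assume "0 < e"
  define E where "E = {k \<in> I. e / 2 \<le> rnorm A \<rho>1 (f k)} \<union> {k \<in> I. e / 2 \<le> rnorm A \<rho>2 (f k)}"
  have fin: "finite E"
    using null[of \<rho>1] null[of \<rho>2] half_gt_zero[OF \<open>0 < e\<close>] unfolding null_family_def E_def by blast
  have E: "E \<subseteq> I"
    by (auto simp: E_def)
  have "max_dist A \<rho>1 \<rho>2 (finsum A f F) (finsum A f E) < e" if F: "finite F" "E \<subseteq> F" "F \<subseteq> I" for F
  proof -
    have closed: "finsum A f E \<in> carrier A" "finsum A f (F - E) \<in> carrier A"
      using f F E by (auto intro!: finsum_closed)
    have "finsum A f (E \<union> (F - E)) = finsum A f E \<oplus> finsum A f (F - E)"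
      using f F E fin by (intro finsum_Un_disjoint) auto
    then have "finsum A f F = finsum A f (F - E) \<oplus> finsum A f E"
      using F(2) closed by (simp add: Un_absorb1 a_comm)
    then have "finsum A f F \<ominus> finsum A f E = finsum A f (F - E)"
      using closed by (simp add: a_minus_def a_assoc r_neg)
    moreover have "finsum A f F \<in> carrier A"
      using f F by (intro finsum_closed) auto
    ultimately have "max_dist A \<rho>1 \<rho>2 (finsum A f F) (finsum A f E) = max_norm (finsum A f (F - E))"
      using closed by (simp add: max_dist_eq)
    also have "\<dots> \<le> e / 2"
      unfolding max_norm_le_iff using f F \<open>0 < e\<close>
      by (intro ballI rnorm_finsum_le) (auto simp: E_def)
    finally show ?thesis
      using \<open>0 < e\<close> by simp
  qed
  then show "\<exists>E. finite E \<and> E \<subseteq> I \<and> (\<forall>F. finite F \<and> E \<subseteq> F \<and> F \<subseteq> I \<longrightarrow>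
      max_dist A \<rho>1 \<rho>2 (finsum A f F) (finsum A f E) < e)"
    using fin E by (intro exI[of _ E]) simp
qed

end

section \<open>Projective limits\<close>

locale limit_system =
  fixes p :: nat and A :: "real \<Rightarrow> real \<Rightarrow> 'a normed_ring" and res :: "real \<Rightarrow> real \<Rightarrow> real \<Rightarrow> 'a \<Rightarrow> 'a"
    and \<rho>1 :: real
  assumes pair: "\<rho>2 \<in> radii_above p \<rho>1 \<Longrightarrow> normed_ring_pair (A \<rho>1 \<rho>2) \<rho>1 \<rho>2"
    and res_hom: "\<rho>2 \<in> radii_above p \<rho>1 \<Longrightarrow> \<rho>3 \<in> radii_above p \<rho>1 \<Longrightarrow> \<rho>2 < \<rho>3 \<Longrightarrow>
      res \<rho>1 \<rho>2 \<rho>3 \<in> ring_hom (A \<rho>1 \<rho>3) (A \<rho>1 \<rho>2)"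
    and res_continuous: "\<rho>2 \<in> radii_above p \<rho>1 \<Longrightarrow> \<rho>3 \<in> radii_above p \<rho>1 \<Longrightarrow> \<rho>2 < \<rho>3 \<Longrightarrow>
      continuous_map (max_topology (A \<rho>1 \<rho>3) \<rho>1 \<rho>3) (max_topology (A \<rho>1 \<rho>2) \<rho>1 \<rho>2) (res \<rho>1 \<rho>2 \<rho>3)"
begin

abbreviation "J \<equiv> radii_above p \<rho>1"
abbreviation "B \<equiv> A \<rho>1"
abbreviation "R \<equiv> limit_ring p A res \<rho>1"

lemma ring_B: "\<rho>2 \<in> J \<Longrightarrow> ring (B \<rho>2)"
  using pair normed_ring_pair.axioms(1) by blast

lemma abelian_monoid_B: "\<rho>2 \<in> J \<Longrightarrow> abelian_monoid (B \<rho>2)"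
  using ring_B abelian_group.axioms(1) ring.is_abelian_group by blast

lemma monoid_B: "\<rho>2 \<in> J \<Longrightarrow> monoid (B \<rho>2)"
  using ring_B ring.is_monoid by blast

lemma R_carrierI:
  "x \<in> extensional J \<Longrightarrow> (\<And>\<rho>2. \<rho>2 \<in> J \<Longrightarrow> x \<rho>2 \<in> carrier (B \<rho>2)) \<Longrightarrow>
    (\<And>\<rho>2 \<rho>3. \<rho>2 \<in> J \<Longrightarrow> \<rho>3 \<in> J \<Longrightarrow> \<rho>2 < \<rho>3 \<Longrightarrow> res \<rho>1 \<rho>2 \<rho>3 (x \<rho>3) = x \<rho>2) \<Longrightarrow> x \<in> carrier R"
  by (auto simp: limit_ring_def PiE_def)

lemma R_component: "x \<in> carrier R \<Longrightarrow> \<rho>2 \<in> J \<Longrightarrow> x \<rho>2 \<in> carrier (B \<rho>2)"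
  by (auto simp: limit_ring_def)

lemma R_res: "x \<in> carrier R \<Longrightarrow> \<rho>2 \<in> J \<Longrightarrow> \<rho>3 \<in> J \<Longrightarrow> \<rho>2 < \<rho>3 \<Longrightarrow> res \<rho>1 \<rho>2 \<rho>3 (x \<rho>3) = x \<rho>2"
  by (simp add: limit_ring_def)

lemma R_extensional: "x \<in> carrier R \<Longrightarrow> x \<in> extensional J"
  by (auto simp: limit_ring_def PiE_def)

lemma R_ext: "x \<in> carrier R \<Longrightarrow> y \<in> carrier R \<Longrightarrow> (\<And>\<rho>2. \<rho>2 \<in> J \<Longrightarrow> x \<rho>2 = y \<rho>2) \<Longrightarrow> x = y"
  by (rule extensionalityI[OF R_extensional R_extensional])

lemma R_mult: "\<rho>2 \<in> J \<Longrightarrow> (x \<otimes>\<^bsub>R\<^esub> y) \<rho>2 = x \<rho>2 \<otimes>\<^bsub>B \<rho>2\<^esub> y \<rho>2"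
  and R_add: "\<rho>2 \<in> J \<Longrightarrow> (x \<oplus>\<^bsub>R\<^esub> y) \<rho>2 = x \<rho>2 \<oplus>\<^bsub>B \<rho>2\<^esub> y \<rho>2"
  and R_one: "\<rho>2 \<in> J \<Longrightarrow> \<one>\<^bsub>R\<^esub> \<rho>2 = \<one>\<^bsub>B \<rho>2\<^esub>"
  and R_zero: "\<rho>2 \<in> J \<Longrightarrow> \<zero>\<^bsub>R\<^esub> \<rho>2 = \<zero>\<^bsub>B \<rho>2\<^esub>"
  by (simp_all add: limit_ring_def)

lemma R_mult_closed: "x \<in> carrier R \<Longrightarrow> y \<in> carrier R \<Longrightarrow> x \<otimes>\<^bsub>R\<^esub> y \<in> carrier R"
proof (rule R_carrierI)
  assume x: "x \<in> carrier R" "y \<in> carrier R"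
  show "x \<otimes>\<^bsub>R\<^esub> y \<in> extensional J"
    by (simp add: limit_ring_def)
  show "(x \<otimes>\<^bsub>R\<^esub> y) \<rho>2 \<in> carrier (B \<rho>2)" if "\<rho>2 \<in> J" for \<rho>2
    using x that by (simp add: R_mult R_component monoid.m_closed[OF monoid_B])
  show "res \<rho>1 \<rho>2 \<rho>3 ((x \<otimes>\<^bsub>R\<^esub> y) \<rho>3) = (x \<otimes>\<^bsub>R\<^esub> y) \<rho>2" if "\<rho>2 \<in> J" "\<rho>3 \<in> J" "\<rho>2 < \<rho>3" for \<rho>2 \<rho>3
    using x that by (simp add: R_mult R_component R_res ring_hom_mult[OF res_hom])
qed

lemma R_add_closed: "x \<in> carrier R \<Longrightarrow> y \<in> carrier R \<Longrightarrow> x \<oplus>\<^bsub>R\<^esub> y \<in> carrier R"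
proof (rule R_carrierI)
  assume x: "x \<in> carrier R" "y \<in> carrier R"
  show "x \<oplus>\<^bsub>R\<^esub> y \<in> extensional J"
    by (simp add: limit_ring_def)
  show "(x \<oplus>\<^bsub>R\<^esub> y) \<rho>2 \<in> carrier (B \<rho>2)" if "\<rho>2 \<in> J" for \<rho>2
    using x that by (simp add: R_add R_component abelian_monoid.a_closed[OF abelian_monoid_B])
  show "res \<rho>1 \<rho>2 \<rho>3 ((x \<oplus>\<^bsub>R\<^esub> y) \<rho>3) = (x \<oplus>\<^bsub>R\<^esub> y) \<rho>2" if "\<rho>2 \<in> J" "\<rho>3 \<in> J" "\<rho>2 < \<rho>3" for \<rho>2 \<rho>3
    using x that by (simp add: R_add R_component R_res ring_hom_add[OF res_hom])
qed

lemma R_one_closed: "\<one>\<^bsub>R\<^esub> \<in> carrier R"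
proof (rule R_carrierI)
  show "\<one>\<^bsub>R\<^esub> \<in> extensional J"
    by (simp add: limit_ring_def)
qed (simp_all add: R_one monoid.one_closed[OF monoid_B] ring_hom_one[OF res_hom])

lemma R_zero_closed: "\<zero>\<^bsub>R\<^esub> \<in> carrier R"
proof (rule R_carrierI)
  show "\<zero>\<^bsub>R\<^esub> \<in> extensional J"
    by (simp add: limit_ring_def)
qed (simp_all add: R_zero abelian_monoid.zero_closed[OF abelian_monoid_B]
      ring_hom_zero[OF res_hom ring_B ring_B])

lemma monoid_R: "monoid R"
proof (rule monoidI)
  fix x y z assume "x \<in> carrier R" "y \<in> carrier R" "z \<in> carrier R"
  then show "x \<otimes>\<^bsub>R\<^esub> y \<otimes>\<^bsub>R\<^esub> z = x \<otimes>\<^bsub>R\<^esub> (y \<otimes>\<^bsub>R\<^esub> z)"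
    by (intro R_ext R_mult_closed) (simp_all add: R_mult R_component monoid.m_assoc[OF monoid_B])
next
  fix x assume x: "x \<in> carrier R"
  then show "\<one>\<^bsub>R\<^esub> \<otimes>\<^bsub>R\<^esub> x = x"
    by (intro R_ext R_mult_closed R_one_closed)
      (simp_all add: R_mult R_one R_component monoid.l_one[OF monoid_B])
  show "x \<otimes>\<^bsub>R\<^esub> \<one>\<^bsub>R\<^esub> = x"
    using x by (intro R_ext R_mult_closed R_one_closed)
      (simp_all add: R_mult R_one R_component monoid.r_one[OF monoid_B])
qed (simp_all add: R_mult_closed R_one_closed)

lemma abelian_monoid_R: "abelian_monoid R"
proof (rule abelian_monoidI)
  fix x y z assume "x \<in> carrier R" "y \<in> carrier R" "z \<in> carrier R"
  then show "x \<oplus>\<^bsub>R\<^esub> y \<oplus>\<^bsub>R\<^esub> z = x \<oplus>\<^bsub>R\<^esub> (y \<oplus>\<^bsub>R\<^esub> z)"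
    by (intro R_ext R_add_closed) (simp_all add: R_add R_component abelian_monoid.a_assoc[OF abelian_monoid_B])
next
  fix x y assume "x \<in> carrier R" "y \<in> carrier R"
  then show "x \<oplus>\<^bsub>R\<^esub> y = y \<oplus>\<^bsub>R\<^esub> x"
    by (intro R_ext R_add_closed) (simp_all add: R_add R_component abelian_monoid.a_comm[OF abelian_monoid_B])
next
  fix x assume "x \<in> carrier R"
  then show "\<zero>\<^bsub>R\<^esub> \<oplus>\<^bsub>R\<^esub> x = x"
    by (intro R_ext R_add_closed R_zero_closed)
      (simp_all add: R_add R_zero R_component abelian_monoid.l_zero[OF abelian_monoid_B])
qed (simp_all add: R_add_closed R_zero_closed)

lemma R_finsum:
  assumes "f \<in> F \<rightarrow> carrier R" "\<rho>2 \<in> J"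
  shows "finsum R f F \<rho>2 = finsum (B \<rho>2) (\<lambda>k. f k \<rho>2) F"
  using assms(1)
proof (induction F rule: infinite_finite_induct)
  \<comment> \<open>By convention a sum over an infinite set is zero, in the limit ring as well as
    in each component.\<close>
  case (infinite F)
  then show ?case
    using assms(2) by (simp add: finsum_def finprod_def R_zero)
next
  case empty
  then show ?case
    using assms(2) by (simp add: abelian_monoid.finsum_empty abelian_monoid_R abelian_monoid_B R_zero)
next
  case (insert k F)
  then have "finsum R f (insert k F) = f k \<oplus>\<^bsub>R\<^esub> finsum R f F"
    by (intro abelian_monoid.finsum_insert[OF abelian_monoid_R]) auto
  moreover have "finsum (B \<rho>2) (\<lambda>k. f k \<rho>2) (insert k F) = f k \<rho>2 \<oplus>\<^bsub>B \<rho>2\<^esub> finsum (B \<rho>2) (\<lambda>k. f k \<rho>2) F"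
    using insert R_component[OF _ assms(2)] by (intro abelian_monoid.finsum_insert[OF abelian_monoid_B[OF assms(2)]]) auto
  ultimately show ?case
    using insert assms(2) by (simp add: R_add)
qed

lemma R_nat_pow: "\<rho>2 \<in> J \<Longrightarrow> (x [^]\<^bsub>R\<^esub> (n::nat)) \<rho>2 = x \<rho>2 [^]\<^bsub>B \<rho>2\<^esub> n"
  by (induction n) (simp_all add: monoid.nat_pow_0[OF monoid_R] monoid.nat_pow_Suc[OF monoid_R]
      monoid.nat_pow_0[OF monoid_B] monoid.nat_pow_Suc[OF monoid_B] R_one R_mult)

lemma R_Units_component:
  assumes "x \<in> Units R" "\<rho>2 \<in> J"
  shows "x \<rho>2 \<in> Units (B \<rho>2)" "(inv\<^bsub>R\<^esub> x) \<rho>2 = inv\<^bsub>B \<rho>2\<^esub> (x \<rho>2)"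
proof -
  have x: "x \<in> carrier R" and i: "inv\<^bsub>R\<^esub> x \<in> carrier R"
    using assms(1) monoid.Units_closed[OF monoid_R] monoid.Units_inv_closed[OF monoid_R] by auto
  have "x \<rho>2 \<otimes>\<^bsub>B \<rho>2\<^esub> (inv\<^bsub>R\<^esub> x) \<rho>2 = \<one>\<^bsub>B \<rho>2\<^esub>" "(inv\<^bsub>R\<^esub> x) \<rho>2 \<otimes>\<^bsub>B \<rho>2\<^esub> x \<rho>2 = \<one>\<^bsub>B \<rho>2\<^esub>"
    using monoid.Units_r_inv[OF monoid_R assms(1)] monoid.Units_l_inv[OF monoid_R assms(1)]
      R_mult[OF assms(2)] R_one[OF assms(2)] by metis+
  moreover note R_component[OF x assms(2)] R_component[OF i assms(2)]
  ultimately show "x \<rho>2 \<in> Units (B \<rho>2)" "(inv\<^bsub>R\<^esub> x) \<rho>2 = inv\<^bsub>B \<rho>2\<^esub> (x \<rho>2)"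
    using monoid.inv_char[OF monoid_B[OF assms(2)]] by (auto simp: Units_def)
qed

text \<open>The inverses of the components form a compatible family: a ring homomorphism preserves
  inverses, and inverses are unique.\<close>

lemma R_UnitsI:
  assumes x: "x \<in> carrier R" and units: "\<And>\<rho>2. \<rho>2 \<in> J \<Longrightarrow> x \<rho>2 \<in> Units (B \<rho>2)"
  shows "x \<in> Units R"
proof -
  define w where "w = (\<lambda>\<rho>2\<in>J. inv\<^bsub>B \<rho>2\<^esub> (x \<rho>2))"
  have w: "w \<rho>2 \<in> carrier (B \<rho>2)" "x \<rho>2 \<otimes>\<^bsub>B \<rho>2\<^esub> w \<rho>2 = \<one>\<^bsub>B \<rho>2\<^esub>" "w \<rho>2 \<otimes>\<^bsub>B \<rho>2\<^esub> x \<rho>2 = \<one>\<^bsub>B \<rho>2\<^esub>"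
    if "\<rho>2 \<in> J" for \<rho>2
    using that units[OF that] by (simp_all add: w_def monoid.Units_inv_closed[OF monoid_B]
        monoid.Units_r_inv[OF monoid_B] monoid.Units_l_inv[OF monoid_B])
  have "w \<in> carrier R"
  proof (rule R_carrierI)
    show "w \<in> extensional J"
      by (simp add: w_def)
    show "w \<rho>2 \<in> carrier (B \<rho>2)" if "\<rho>2 \<in> J" for \<rho>2
      using w(1)[OF that] .
    show "res \<rho>1 \<rho>2 \<rho>3 (w \<rho>3) = w \<rho>2" if \<rho>: "\<rho>2 \<in> J" "\<rho>3 \<in> J" "\<rho>2 < \<rho>3" for \<rho>2 \<rho>3
    proof (rule monoid.inv_unique[OF monoid_B[OF \<rho>(1)], of _ "x \<rho>2"])
      note hom = res_hom[OF \<rho>]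
      have "res \<rho>1 \<rho>2 \<rho>3 (w \<rho>3 \<otimes>\<^bsub>B \<rho>3\<^esub> x \<rho>3) = res \<rho>1 \<rho>2 \<rho>3 (w \<rho>3) \<otimes>\<^bsub>B \<rho>2\<^esub> res \<rho>1 \<rho>2 \<rho>3 (x \<rho>3)"
        by (rule ring_hom_mult[OF hom w(1)[OF \<rho>(2)] R_component[OF x \<rho>(2)]])
      then show "res \<rho>1 \<rho>2 \<rho>3 (w \<rho>3) \<otimes>\<^bsub>B \<rho>2\<^esub> x \<rho>2 = \<one>\<^bsub>B \<rho>2\<^esub>"
        using w(3)[OF \<rho>(2)] R_res[OF x \<rho>] ring_hom_one[OF hom] by simp
      show "x \<rho>2 \<otimes>\<^bsub>B \<rho>2\<^esub> w \<rho>2 = \<one>\<^bsub>B \<rho>2\<^esub>" "w \<rho>2 \<in> carrier (B \<rho>2)"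
        using w \<rho>(1) by auto
      show "x \<rho>2 \<in> carrier (B \<rho>2)"
        by (rule R_component[OF x \<rho>(1)])
      show "res \<rho>1 \<rho>2 \<rho>3 (w \<rho>3) \<in> carrier (B \<rho>2)"
        by (rule ring_hom_closed[OF hom w(1)[OF \<rho>(2)]])
    qed
  qed
  moreover have "x \<otimes>\<^bsub>R\<^esub> w = \<one>\<^bsub>R\<^esub>" "w \<otimes>\<^bsub>R\<^esub> x = \<one>\<^bsub>R\<^esub>"
    using x \<open>w \<in> carrier R\<close> w
    by (auto intro!: R_ext R_mult_closed R_one_closed simp: R_mult R_one)
  ultimately show ?thesis
    using x unfolding Units_def by blast
qed

lemma R_int_pow:
  assumes "x \<in> Units R \<or> x \<in> carrier R \<and> 0 \<le> n" "\<rho>2 \<in> J"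
  shows "x [^]\<^bsub>R\<^esub> (n::int) \<in> carrier R" "(x [^]\<^bsub>R\<^esub> n) \<rho>2 = x \<rho>2 [^]\<^bsub>B \<rho>2\<^esub> n"
proof -
  have pow: "z [^]\<^bsub>R\<^esub> m \<in> Units R" if "z \<in> Units R" for z and m :: nat
    using that by (induction m) (simp_all add: monoid.nat_pow_0[OF monoid_R] monoid.nat_pow_Suc[OF monoid_R]
        monoid.Units_m_closed[OF monoid_R] monoid.Units_one_closed[OF monoid_R])
  have "x [^]\<^bsub>R\<^esub> n \<in> carrier R \<and> (x [^]\<^bsub>R\<^esub> n) \<rho>2 = x \<rho>2 [^]\<^bsub>B \<rho>2\<^esub> n"
  proof (cases "n < 0")
    case True
    then have "x [^]\<^bsub>R\<^esub> nat (- n) \<in> Units R"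
      using assms(1) by (intro pow) auto
    then show ?thesis
      using R_Units_component(2)[OF _ assms(2)] monoid.Units_inv_closed[OF monoid_R]
      by (simp only: int_pow_negative[OF True] R_nat_pow[OF assms(2)])
  next
    case False
    then have n: "0 \<le> n"
      by simp
    have "x \<in> carrier R"
      using assms(1) monoid.Units_closed[OF monoid_R] by blast
    then show ?thesis
      using monoid.nat_pow_closed[OF monoid_R]
      by (simp only: int_pow_nonneg[OF n] R_nat_pow[OF assms(2)])
  qed
  then show "x [^]\<^bsub>R\<^esub> n \<in> carrier R" "(x [^]\<^bsub>R\<^esub> n) \<rho>2 = x \<rho>2 [^]\<^bsub>B \<rho>2\<^esub> n"
    by (rule conjunct1, rule conjunct2)
qed

lemma R_ordprod:
  assumes "\<And>b. b \<in> set bs \<Longrightarrow> f b \<in> carrier R" "\<rho>2 \<in> J"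
  shows "ordprod R f bs \<in> carrier R" "ordprod R f bs \<rho>2 = ordprod (B \<rho>2) (\<lambda>b. f b \<rho>2) bs"
  using assms by (induction bs) (simp_all add: R_one_closed R_one R_mult_closed R_mult)

text \<open>Convergence in a product is componentwise, and each component obeys the null-family
  criterion. Compatibility of the component limits comes from continuity of the transition maps and
  uniqueness of limits in Hausdorff spaces.\<close>

lemma unconditionally_convergent_iff:
  assumes f: "f \<in> I \<rightarrow> carrier R"
  shows "unconditionally_convergent R (limit_topology p A res \<rho>1) f I \<longleftrightarrow>
    (\<forall>\<rho>2\<in>J. \<forall>\<rho>\<in>{\<rho>1, \<rho>2}. null_family (\<lambda>k. rnorm (B \<rho>2) \<rho> (f k \<rho>2)) I)"
proof -
  let ?X = "\<lambda>\<rho>2. max_topology (B \<rho>2) \<rho>1 \<rho>2"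
  let ?F = "finite_subsets_at_top I"
  have component: "(\<lambda>k. f k \<rho>2) \<in> I \<rightarrow> carrier (B \<rho>2)" if "\<rho>2 \<in> J" for \<rho>2
    using f R_component that by (auto simp: Pi_def)
  have closed: "\<forall>\<^sub>F F in ?F. finsum R f F \<in> carrier R"
    unfolding eventually_finite_subsets_at_top
    \<comment> \<open>Every finite subset of I will do, so the filter condition already holds from
      the empty set on.\<close>
    using f by (intro exI[of _ "{}"]) (auto intro!: abelian_monoid.finsum_closed[OF abelian_monoid_R])
  have finsum: "\<forall>\<^sub>F F in ?F. finsum R f F \<rho>2 = finsum (B \<rho>2) (\<lambda>k. f k \<rho>2) F" if "\<rho>2 \<in> J" for \<rho>2
    unfolding eventually_finite_subsets_at_top
    using f that by (intro exI[of _ "{}"]) (auto intro!: R_finsum)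
  have limit_iff: "limitin (?X \<rho>2) (\<lambda>F. finsum R f F \<rho>2) s ?F \<longleftrightarrow>
      limitin (?X \<rho>2) (\<lambda>F. finsum (B \<rho>2) (\<lambda>k. f k \<rho>2) F) s ?F" if "\<rho>2 \<in> J" for \<rho>2 s
  proof
    show "limitin (?X \<rho>2) (\<lambda>F. finsum R f F \<rho>2) s ?F \<Longrightarrow>
        limitin (?X \<rho>2) (\<lambda>F. finsum (B \<rho>2) (\<lambda>k. f k \<rho>2) F) s ?F"
      by (rule limitin_transform_eventually[OF finsum[OF that]])
    have "\<forall>\<^sub>F F in ?F. finsum (B \<rho>2) (\<lambda>k. f k \<rho>2) F = finsum R f F \<rho>2"
      using finsum[OF that] by eventually_elim simp
    then show "limitin (?X \<rho>2) (\<lambda>F. finsum (B \<rho>2) (\<lambda>k. f k \<rho>2) F) s ?F \<Longrightarrow>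
        limitin (?X \<rho>2) (\<lambda>F. finsum R f F \<rho>2) s ?F"
      by (rule limitin_transform_eventually)
  qed
  show ?thesis
  proof
    assume "unconditionally_convergent R (limit_topology p A res \<rho>1) f I"
    then obtain s where "limitin (limit_topology p A res \<rho>1) (finsum R f) s ?F"
      unfolding unconditionally_convergent_def by blast
    then have "limitin (?X \<rho>2) (\<lambda>F. finsum (B \<rho>2) (\<lambda>k. f k \<rho>2) F) (s \<rho>2) ?F" if "\<rho>2 \<in> J" for \<rho>2
      using that unfolding limit_topology_def limitin_subtopology limitin_componentwise by (simp flip: limit_iff)
    then show "\<forall>\<rho>2\<in>J. \<forall>\<rho>\<in>{\<rho>1, \<rho>2}. null_family (\<lambda>k. rnorm (B \<rho>2) \<rho> (f k \<rho>2)) I"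
      using normed_ring_pair.null_family_of_convergent_finsum[OF pair component] by blast
  next
    assume null: "\<forall>\<rho>2\<in>J. \<forall>\<rho>\<in>{\<rho>1, \<rho>2}. null_family (\<lambda>k. rnorm (B \<rho>2) \<rho> (f k \<rho>2)) I"
    have "\<exists>s. limitin (?X \<rho>2) (\<lambda>F. finsum (B \<rho>2) (\<lambda>k. f k \<rho>2) F) s ?F" if "\<rho>2 \<in> J" for \<rho>2
      using null that by (intro normed_ring_pair.convergent_finsum_of_null_family[OF pair component]) auto
    then have "\<exists>s. \<forall>\<rho>2\<in>J. limitin (?X \<rho>2) (\<lambda>F. finsum R f F \<rho>2) (s \<rho>2) ?F"
      by (intro bchoice) (simp add: limit_iff)
    then obtain s' where s': "\<forall>\<rho>2\<in>J. limitin (?X \<rho>2) (\<lambda>F. finsum R f F \<rho>2) (s' \<rho>2) ?F" ..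
    \<comment> \<open>Points of the product topology are extensional; the values outside J have to
      be normalized.\<close>
    define s where "s = restrict s' J"
    have s: "limitin (?X \<rho>2) (\<lambda>F. finsum R f F \<rho>2) (s \<rho>2) ?F" if "\<rho>2 \<in> J" for \<rho>2
      using s' that by (simp add: s_def)
    have sR: "s \<in> carrier R"
    proof (rule R_carrierI)
      show "s \<in> extensional J"
        by (simp add: s_def)
      show "s \<rho>2 \<in> carrier (B \<rho>2)" if "\<rho>2 \<in> J" for \<rho>2
        using limitin_topspace[OF s[OF that]] normed_ring_pair.topspace_max_topology[OF pair[OF that]] by simp
      show "res \<rho>1 \<rho>2 \<rho>3 (s \<rho>3) = s \<rho>2" if \<rho>: "\<rho>2 \<in> J" "\<rho>3 \<in> J" "\<rho>2 < \<rho>3" for \<rho>2 \<rho>3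
      proof -
        have "limitin (?X \<rho>2) (res \<rho>1 \<rho>2 \<rho>3 \<circ> (\<lambda>F. finsum R f F \<rho>3)) (res \<rho>1 \<rho>2 \<rho>3 (s \<rho>3)) ?F"
          by (rule continuous_map_limit[OF res_continuous[OF \<rho>] s[OF \<rho>(2)]])
        moreover have "\<forall>\<^sub>F F in ?F. (res \<rho>1 \<rho>2 \<rho>3 \<circ> (\<lambda>F. finsum R f F \<rho>3)) F = finsum R f F \<rho>2"
          using closed by eventually_elim (simp add: R_res[OF _ \<rho>])
        ultimately have "limitin (?X \<rho>2) (\<lambda>F. finsum R f F \<rho>2) (res \<rho>1 \<rho>2 \<rho>3 (s \<rho>3)) ?F"
          by (rule limitin_transform_eventually[rotated])
        moreover have "Hausdorff_space (?X \<rho>2)"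
          using Metric_space.Hausdorff_space_mtopology[OF normed_ring_pair.Metric_space[OF pair[OF \<rho>(1)]]]
          by (simp add: max_topology_def)
        ultimately show ?thesis
          using s[OF \<rho>(1)] by (intro limitin_Hausdorff_unique[of "?X \<rho>2"]) auto
      qed
    qed
    have "topspace (product_topology ?X J) = (\<Pi>\<^sub>E \<rho>2\<in>J. carrier (B \<rho>2))"
      unfolding topspace_product_topology
      by (intro PiE_cong normed_ring_pair.topspace_max_topology pair)
    then have "\<forall>\<^sub>F F in ?F. finsum R f F \<in> topspace (product_topology ?X J)"
      using closed by (auto elim!: eventually_mono simp: limit_ring_def)
    moreover have "s \<in> extensional J"
      by (simp add: s_def)
    ultimately have "limitin (limit_topology p A res \<rho>1) (finsum R f) s ?F"
      unfolding limit_topology_def limitin_subtopology limitin_componentwise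
      using sR closed s by simp
    then show "unconditionally_convergent R (limit_topology p A res \<rho>1) f I"
      unfolding unconditionally_convergent_def by blast
  qed
qed

end

section \<open>Cocharacters of split tori\<close>

text \<open>Here v i will be the exponent vectors of the simple roots, and the w k become
  cocharacters. Allowing a common factor D in place of 1 keeps the exponents integral.\<close>

lemma integer_dual_basis:
  fixes v :: "'i \<Rightarrow> 'j \<Rightarrow> int"
  assumes "finite I" "finite J"
    and "\<And>e. (\<And>j. j \<in> J \<Longrightarrow> (\<Sum>i\<in>I. e i * v i j) = 0) \<Longrightarrow> \<forall>i\<in>I. e i = 0"
  shows "\<exists>D w. D \<noteq> 0 \<and> (\<forall>i\<in>I. \<forall>k\<in>I. (\<Sum>j\<in>J. v i j * w k j) = (if i = k then D else 0))"
  using assms(1,3)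
proof (induction I rule: finite_induct)
  case empty
  show ?case
    by (intro exI[of _ 1]) simp
next
  case (insert a I)
  have "\<forall>i\<in>I. e i = 0" if "\<And>j. j \<in> J \<Longrightarrow> (\<Sum>i\<in>I. e i * v i j) = 0" for e
  proof -
    have "(\<Sum>i\<in>insert a I. (e(a := 0)) i * v i j) = 0" if "j \<in> J" for j
    proof -
      have "(\<Sum>i\<in>I. (e(a := 0)) i * v i j) = (\<Sum>i\<in>I. e i * v i j)"
        using insert.hyps by (intro sum.cong) auto
      then show ?thesis
        using \<open>\<And>j. j \<in> J \<Longrightarrow> _\<close>[OF that] insert.hyps by simp
    qed
    then have "\<forall>i\<in>insert a I. (e(a := 0)) i = 0"
      by (rule insert.prems)
    then show ?thesis
      using insert.hyps by (auto split: if_splits)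
  qed
  then have "\<exists>D w. D \<noteq> 0 \<and> (\<forall>i\<in>I. \<forall>k\<in>I. (\<Sum>j\<in>J. v i j * w k j) = (if i = k then D else 0))"
    by (rule insert.IH)
  then obtain D w where D: "D \<noteq> 0"
    and w: "\<forall>i\<in>I. \<forall>k\<in>I. (\<Sum>j\<in>J. v i j * w k j) = (if i = k then D else 0)"
    by (elim exE conjE)
  txt \<open>
    A Gram-Schmidt step with the denominators cleared: \<open>W\<close> below is a nonzero coordinate of \<open>D\<close> times
    the component of \<open>v a\<close> that all \<open>w i\<close> annihilate, and \<open>m\<close> pairs to \<open>W\<close> with \<open>v a\<close> and to \<open>0\<close> with
    the other \<open>v i\<close>.
  \<close>
  define P where "P i = (\<Sum>j\<in>J. v a j * w i j)" for i
  have "\<exists>j0\<in>J. D * v a j0 - (\<Sum>i\<in>I. P i * v i j0) \<noteq> 0"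
  proof (rule ccontr)
    \<comment> \<open>Otherwise D v_a = sum of the P_i v_i would be a relation in which v_a has the
      nonzero coefficient D.\<close>
    assume *: "\<not> (\<exists>j0\<in>J. D * v a j0 - (\<Sum>i\<in>I. P i * v i j0) \<noteq> 0)"
    have "(\<Sum>i\<in>insert a I. (if i = a then D else - P i) * v i j) = 0" if "j \<in> J" for j
    proof -
      have "(\<Sum>i\<in>I. (if i = a then D else - P i) * v i j) = (\<Sum>i\<in>I. - (P i * v i j))"
        using insert.hyps by (intro sum.cong) auto
      then show ?thesis
        using * that insert.hyps by (simp add: sum_negf)
    qed
    then have "\<forall>i\<in>insert a I. (if i = a then D else - P i) = 0"
      by (rule insert.prems)
    then show False
      using D by simp
  qed
  then obtain j0 where j0: "j0 \<in> J" and nonzero: "D * v a j0 - (\<Sum>i\<in>I. P i * v i j0) \<noteq> 0" ..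
  define W where "W = D * v a j0 - (\<Sum>i\<in>I. P i * v i j0)"
  define m where "m j = (if j = j0 then D else 0) - (\<Sum>i\<in>I. v i j0 * w i j)" for j
  have m: "(\<Sum>j\<in>J. x j * m j) = D * x j0 - (\<Sum>i\<in>I. v i j0 * (\<Sum>j\<in>J. x j * w i j))" for x
  proof -
    have "(\<Sum>j\<in>J. x j * m j) = (\<Sum>j\<in>J. (if j = j0 then D * x j0 else 0) - (\<Sum>i\<in>I. v i j0 * (x j * w i j)))"
      by (intro sum.cong) (auto simp: m_def right_diff_distrib sum_distrib_left mult_ac)
    also have "\<dots> = D * x j0 - (\<Sum>j\<in>J. \<Sum>i\<in>I. v i j0 * (x j * w i j))"
      using j0 assms(2) by (simp add: sum_subtractf)
    also have "(\<Sum>j\<in>J. \<Sum>i\<in>I. v i j0 * (x j * w i j)) = (\<Sum>i\<in>I. v i j0 * (\<Sum>j\<in>J. x j * w i j))"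
      by (subst sum.swap) (simp add: sum_distrib_left)
    finally show ?thesis .
  qed
  have m_a: "(\<Sum>j\<in>J. v a j * m j) = W"
    unfolding m W_def P_def by (simp add: mult.commute)
  have m_I: "(\<Sum>j\<in>J. v k j * m j) = 0" if "k \<in> I" for k
  proof -
    have "(\<Sum>i\<in>I. v i j0 * (\<Sum>j\<in>J. v k j * w i j)) = (\<Sum>i\<in>I. if k = i then v k j0 * D else 0)"
      using that by (intro sum.cong) (auto simp: w)
    then show ?thesis
      unfolding m using that insert.hyps by simp
  qed
  \<comment> \<open>The multiple D m serves a. For k in I, subtracting P k m from W w_k cancels the
    pairing with v_a, which is W P_k - P_k W, and leaves the pairings with the other vectors
    multiplied by W.\<close>
  define w' where "w' k j = (if k = a then D * m j else W * w k j - P k * m j)" for k j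
  have w'_a: "(\<Sum>j\<in>J. x j * w' a j) = D * (\<Sum>j\<in>J. x j * m j)" for x
    by (simp add: w'_def sum_distrib_left mult_ac)
  have w'_I: "(\<Sum>j\<in>J. x j * w' k j) = W * (\<Sum>j\<in>J. x j * w k j) - P k * (\<Sum>j\<in>J. x j * m j)" if "k \<noteq> a" for x k
    using that by (simp add: w'_def sum_distrib_left right_diff_distrib sum_subtractf mult_ac)
  have "(\<Sum>j\<in>J. v i j * w' k j) = (if i = k then D * W else 0)" if "i \<in> insert a I" "k \<in> insert a I" for i k
  proof (cases "k = a")
    case True
    then show ?thesis
      using that m_a m_I by (auto simp: w'_a)
  next
    case False
    then have k: "k \<in> I"
      using that by simp
    show ?thesis
    proof (cases "i = a")
      case True
      then show ?thesis
        using False m_a by (simp add: w'_I P_def mult.commute)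
    next
      case False
      then show ?thesis
        using that k \<open>k \<noteq> a\<close> m_I w by (simp add: w'_I)
    qed
  qed
  moreover have "D * W \<noteq> 0"
    using D nonzero by (simp add: W_def)
  ultimately show ?case
    by blast
qed

section \<open>Characters of a split torus are Laurent monomials\<close>

lemma poly_without_nonzero_roots:
  fixes P :: "'a::alg_closed_field poly"
  assumes "\<And>s. s \<noteq> 0 \<Longrightarrow> poly P s \<noteq> 0"
  obtains a k where "\<And>s. poly P s = a * s ^ k"
proof -
  have "P \<noteq> 0"
    using assms[of 1] by auto
  \<comment> \<open>All factors vanishing at 0 are split off. The cofactor then has no root at all,
    so it is constant over an algebraically closed field.\<close>
  then obtain q where q: "P = [:- 0, 1:] ^ Polynomial.order 0 P * q" "\<not> [:- 0, 1:] dvd q"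
    using order_decomp by blast
  have "degree q = 0"
  proof (rule ccontr)
    assume "degree q \<noteq> 0"
    then obtain x where x: "poly q x = 0"
      using alg_closed_imp_poly_has_root[of q] by auto
    then have "poly P x = 0"
      by (subst q(1)) simp
    then have "x = 0"
      using assms by blast
    then show False
      using x q(2) by (simp add: poly_eq_0_iff_dvd)
  qed
  then obtain a where "q = [:a:]"
    by (rule degree_eq_zeroE)
  then have "poly P s = a * s ^ Polynomial.order 0 P" for s
    by (subst q(1)) simp
  then show ?thesis
    by (rule that)
qed

text \<open>For j < d, the j-th coordinate cocharacter of the torus.\<close>

definition Gm_line :: "nat \<Rightarrow> 'a::field \<Rightarrow> nat \<Rightarrow> 'a" where
  "Gm_line j s = (\<lambda>i. if i = j then s else 1)"

text \<open>The factor s^N clears the denominators, so that a Laurent polynomial on the line can be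
  handled by ordinary polynomials.\<close>

lemma laurent_polynomial_on_Gm_line:
  fixes g :: "(nat \<Rightarrow> 'a::field) \<Rightarrow> 'a"
  assumes "g \<in> poly_funs F (Gm_coords d)"
  shows "\<exists>N P. \<forall>s. s \<noteq> 0 \<longrightarrow> s ^ N * g (Gm_line j s) = poly P s"
  using assms
proof (induction rule: poly_funs.induct)
  case (const a)
  show ?case
    by (intro exI[of _ 0] exI[of _ "[:a:]"]) simp
next
  case (gen f)
  then consider i where "f = (\<lambda>z. z i)" | i where "f = (\<lambda>z. inverse (z i))"
    by (auto simp: Gm_coords_def)
  then show ?case
  proof cases
    case (1 i)
    then show ?thesis
      by (intro exI[of _ 0] exI[of _ "if i = j then [:0, 1:] else 1"]) (simp add: Gm_line_def)
  next
    \<comment> \<open>One factor s is enough: it cancels the inverse of the j-th coordinate, and on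
      the other coordinates, which equal 1, the product is s itself.\<close>
    case (2 i)
    then show ?thesis
      by (intro exI[of _ 1] exI[of _ "if i = j then 1 else [:0, 1:]"]) (simp add: Gm_line_def)
  qed
next
  case (add f g)
  obtain N P where f: "\<forall>s. s \<noteq> 0 \<longrightarrow> s ^ N * f (Gm_line j s) = poly P s"
    using add.IH(1) by (elim exE)
  obtain N' P' where g: "\<forall>s. s \<noteq> 0 \<longrightarrow> s ^ N' * g (Gm_line j s) = poly P' s"
    using add.IH(2) by (elim exE)
  have "s ^ (N + N') * (f (Gm_line j s) + g (Gm_line j s)) = poly (monom 1 N' * P + monom 1 N * P') s"
    if "s \<noteq> 0" for s
    using that by (simp add: f[rule_format, symmetric] g[rule_format, symmetric] poly_monom power_add algebra_simps)
  then show ?case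
    by blast
next
  case (mult f g)
  obtain N P where f: "\<forall>s. s \<noteq> 0 \<longrightarrow> s ^ N * f (Gm_line j s) = poly P s"
    using mult.IH(1) by (elim exE)
  obtain N' P' where g: "\<forall>s. s \<noteq> 0 \<longrightarrow> s ^ N' * g (Gm_line j s) = poly P' s"
    using mult.IH(2) by (elim exE)
  have "s ^ (N + N') * (f (Gm_line j s) * g (Gm_line j s)) = poly (P * P') s" if "s \<noteq> 0" for s
    using that by (simp add: f[rule_format, symmetric] g[rule_format, symmetric] power_add algebra_simps)
  then show ?case
    by blast
qed

lemma Gm_simps: "carrier (Gm d) = {z. \<forall>i. z i \<noteq> 0 \<and> (d \<le> i \<longrightarrow> z i = 1)}"
  "z \<otimes>\<^bsub>Gm d\<^esub> w = (\<lambda>i. z i * w i)"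
  by (simp_all add: Gm_def)

locale torus_parameter =
  fixes d :: nat and T :: "('c::{alg_closed_field, field_char_0, metric_space} ^ 'n::finite ^ 'n) set" and \<theta>
  assumes \<theta>: "alg_iso Qp (Gm d) (Gm_coords d) (GL\<lparr>carrier := T\<rparr>) GL_coords \<theta>"
begin

lemma \<theta>_in_T: "z \<in> carrier (Gm d) \<Longrightarrow> \<theta> z \<in> T"
  and \<theta>_mult: "z \<in> carrier (Gm d) \<Longrightarrow> w \<in> carrier (Gm d) \<Longrightarrow> \<theta> (\<lambda>i. z i * w i) = \<theta> z ** \<theta> w"
  and \<theta>_surj: "T = \<theta> ` carrier (Gm d)"
  using \<theta> by (auto simp: alg_iso_def iso_def hom_def bij_betw_def Gm_simps(2))

context
  fixes c assumes c: "c \<in> characters T"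
begin

lemma character_nonzero: "t \<in> T \<Longrightarrow> c t \<noteq> 0"
  and character_mult: "s \<in> T \<Longrightarrow> t \<in> T \<Longrightarrow> c (s ** t) = c s * c t"
  using c by (auto simp: characters_def)

lemma character_\<theta>_mult:
  "z \<in> carrier (Gm d) \<Longrightarrow> w \<in> carrier (Gm d) \<Longrightarrow> c (\<theta> (\<lambda>i. z i * w i)) = c (\<theta> z) * c (\<theta> w)"
  by (simp add: \<theta>_mult character_mult \<theta>_in_T)

lemma character_\<theta>_one: "c (\<theta> (\<lambda>_. 1)) = 1"
proof -
  have one: "(\<lambda>_. 1) \<in> carrier (Gm d)"
    by (simp add: Gm_simps)
  then have "c (\<theta> (\<lambda>_. 1)) = c (\<theta> (\<lambda>_. 1)) * c (\<theta> (\<lambda>_. 1))"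
    using character_\<theta>_mult[of "\<lambda>_. 1" "\<lambda>_. 1"] by simp
  then show ?thesis
    using character_nonzero[OF \<theta>_in_T[OF one]] by simp
qed

text \<open>A character has no zeros, so the polynomial obtained by clearing denominators vanishes
  at most at 0 and is a monomial; the value 1 at s = 1 fixes its coefficient.\<close>

lemma character_on_Gm_line:
  assumes "j < d"
  obtains n :: int where "\<And>s. s \<noteq> 0 \<Longrightarrow> c (\<theta> (Gm_line j s)) = s powi n"
proof -
  have line: "Gm_line j s \<in> carrier (Gm d)" if "s \<noteq> 0" for s
    using that assms by (simp add: Gm_simps Gm_line_def)
  obtain f where f: "f \<in> poly_funs UNIV GL_coords" "\<And>t. t \<in> T \<Longrightarrow> c t = f t"
    using c by (auto simp: characters_def)
  have pull: "\<exists>g\<in>poly_funs UNIV (Gm_coords d). \<forall>x\<in>carrier (Gm d). h (\<theta> x) = g x" if "h \<in> GL_coords" for h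
    using \<theta> that poly_funs_mono[of _ Qp "Gm_coords d" UNIV] unfolding alg_iso_def by (meson subset_UNIV)
  have "\<exists>g\<in>poly_funs UNIV (Gm_coords d). \<forall>x\<in>carrier (Gm d). f (\<theta> x) = g x"
    by (rule poly_funs_comp[OF f(1)]) (rule pull)
  then obtain g where g: "g \<in> poly_funs UNIV (Gm_coords d)"
    "\<And>x. x \<in> carrier (Gm d) \<Longrightarrow> f (\<theta> x) = g x"
    by blast
  obtain N P where NP: "\<And>s. s \<noteq> 0 \<Longrightarrow> s ^ N * g (Gm_line j s) = poly P s"
    using laurent_polynomial_on_Gm_line[OF g(1), of j] by blast
  have eq: "s ^ N * c (\<theta> (Gm_line j s)) = poly P s" if "s \<noteq> 0" for s
    using NP[OF that] f(2)[OF \<theta>_in_T[OF line[OF that]]] g(2)[OF line[OF that]] by simp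
  have roots: "poly P s \<noteq> 0" if "s \<noteq> 0" for s
    using eq[OF that] character_nonzero[OF \<theta>_in_T[OF line[OF that]]] that by auto
  obtain a k where P: "\<And>s. poly P s = a * s ^ k"
    by (rule poly_without_nonzero_roots[of P]) (rule roots, assumption, rule that)
  have "Gm_line j 1 = (\<lambda>_. 1 :: 'c)"
    by (simp add: Gm_line_def)
  then have "a = 1"
    using eq[of 1] by (simp add: P character_\<theta>_one)
  have "c (\<theta> (Gm_line j s)) = s powi (int k - int N)" if "s \<noteq> 0" for s
    using eq[OF that] that by (simp add: P \<open>a = 1\<close> power_int_diff field_simps)
  then show ?thesis
    by (rule that)
qed

lemma character_eq_monomial:
  obtains n :: "nat \<Rightarrow> int" where "\<And>z. z \<in> carrier (Gm d) \<Longrightarrow> c (\<theta> z) = (\<Prod>j<d. z j powi n j)"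
proof -
  have "\<exists>n. \<forall>j\<in>{..<d}. \<forall>s. s \<noteq> 0 \<longrightarrow> c (\<theta> (Gm_line j s)) = s powi n j"
  proof (rule bchoice, rule ballI)
    fix j assume "j \<in> {..<d}"
    then have "j < d"
      by simp
    then obtain n :: int where "\<And>s. s \<noteq> 0 \<Longrightarrow> c (\<theta> (Gm_line j s)) = s powi n"
      by (rule character_on_Gm_line) (rule that)
    then show "\<exists>n. \<forall>s. s \<noteq> 0 \<longrightarrow> c (\<theta> (Gm_line j s)) = s powi n"
      by blast
  qed
  then obtain n where n: "\<And>j s. j < d \<Longrightarrow> s \<noteq> 0 \<Longrightarrow> c (\<theta> (Gm_line j s)) = s powi n j"
    by auto
  have "c (\<theta> z) = (\<Prod>j<d. z j powi n j)" if z: "z \<in> carrier (Gm d)" for z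
  proof -
    \<comment> \<open>Truncations of z: passing from \<open>zz m\<close> to
      \<open>zz (Suc m)\<close> multiplies by a point of the m-th coordinate line.\<close>
    define zz where "zz m = (\<lambda>i. if i < m then z i else 1)" for m :: nat
    have "c (\<theta> (zz m)) = (\<Prod>j<m. z j powi n j)" if "m \<le> d" for m
      using that
    proof (induction m)
      case 0
      then show ?case
        using character_\<theta>_one by (simp add: zz_def)
    next
      case (Suc m)
      have "zz (Suc m) = (\<lambda>i. zz m i * Gm_line m (z m) i)"
        by (auto simp: zz_def Gm_line_def less_Suc_eq)
      moreover have "zz m \<in> carrier (Gm d)" "Gm_line m (z m) \<in> carrier (Gm d)"
        using z Suc.prems by (auto simp: Gm_simps zz_def Gm_line_def)
      ultimately have "c (\<theta> (zz (Suc m))) = c (\<theta> (zz m)) * c (\<theta> (Gm_line m (z m)))"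
        using character_\<theta>_mult by simp
      then show ?case
        using Suc z n[of m "z m"] by (simp add: Gm_simps)
    qed
    moreover have "zz d = z"
      using z by (auto simp: zz_def Gm_simps)
    ultimately show ?thesis
      by (metis order_refl)
  qed
  then show ?thesis
    by (rule that)
qed

end

end

lemma power_int_sum: "x \<noteq> 0 \<Longrightarrow> x powi (\<Sum>i\<in>I. f i) = (\<Prod>i\<in>I. x powi f i)" for x :: "'a::field"
  by (induction I rule: infinite_finite_induct) (simp_all add: power_int_add)

lemma prod_power_int: "(\<Prod>i\<in>I. f i) powi n = (\<Prod>i\<in>I. f i powi n)" for f :: "'i \<Rightarrow> 'a::field"
  by (induction I rule: infinite_finite_induct) (simp_all add: power_int_mult_distrib)

text \<open>The element is the value at p of a cocharacter that pairs to 0 with \<alpha> and to M =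
  |D| r with every other simple root. A root \<beta> \<noteq> \<alpha> in \<Phi> involves some other
  simple root, so its value is a power of p with exponent at least M.\<close>

lemma (in Cp_field) exists_contracting_torus_element:
  fixes T :: "('c ^ 'n::finite ^ 'n) set"
  assumes T: "split_torus Qp T" and simple: "simple_roots T \<Phi> \<Delta>"
    and \<Phi>: "\<Phi> \<subseteq> characters T" "finite \<Phi>" and \<alpha>: "\<alpha> \<in> \<Delta>"
  obtains t where "t \<in> Qp_points T" "\<alpha> t = 1"
    "\<And>\<beta>. \<beta> \<in> \<Phi> \<Longrightarrow> \<beta> \<noteq> \<alpha> \<Longrightarrow> \<exists>m\<ge>r. \<beta> t = of_nat (p ^ m)"
proof -
  obtain d \<theta> where "alg_iso Qp (Gm d) (Gm_coords d) (GL\<lparr>carrier := T\<rparr>) GL_coords \<theta>"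
    using T unfolding split_torus_def by (elim conjE exE)
  then interpret torus_parameter d T \<theta>
    by unfold_locales
  have \<Delta>: "\<Delta> \<subseteq> \<Phi>" "finite \<Delta>"
    and independent: "\<And>e :: _ \<Rightarrow> int. \<forall>t\<in>T. (\<Prod>\<delta>\<in>\<Delta>. \<delta> t powi e \<delta>) = 1 \<Longrightarrow> \<forall>\<delta>\<in>\<Delta>. e \<delta> = 0"
    and combination: "\<And>\<beta>. \<beta> \<in> \<Phi> \<Longrightarrow> \<exists>m :: _ \<Rightarrow> nat. \<forall>t\<in>T. \<beta> t = (\<Prod>\<delta>\<in>\<Delta>. \<delta> t ^ m \<delta>)"
    and reduced: "\<And>\<beta> \<gamma> m. \<beta> \<in> \<Phi> \<Longrightarrow> \<gamma> \<in> \<Phi> \<Longrightarrow> \<forall>t\<in>T. \<gamma> t = \<beta> t ^ m \<Longrightarrow> m = 1"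
    using simple \<Phi>(2) finite_subset unfolding simple_roots_def by auto
  have "\<exists>n. \<forall>\<delta>\<in>\<Delta>. \<forall>z\<in>carrier (Gm d). \<delta> (\<theta> z) = (\<Prod>j<d. z j powi n \<delta> j)"
  proof (intro bchoice ballI)
    fix \<delta> assume "\<delta> \<in> \<Delta>"
    then have "\<delta> \<in> characters T"
      using \<Delta> \<Phi> by blast
    then obtain n where "\<And>z. z \<in> carrier (Gm d) \<Longrightarrow> \<delta> (\<theta> z) = (\<Prod>j<d. z j powi n j)"
      by (rule character_eq_monomial) (rule that)
    then show "\<exists>n. \<forall>z\<in>carrier (Gm d). \<delta> (\<theta> z) = (\<Prod>j<d. z j powi n j)"
      by blast
  qed
  then obtain n where n: "\<forall>\<delta>\<in>\<Delta>. \<forall>z\<in>carrier (Gm d). \<delta> (\<theta> z) = (\<Prod>j<d. z j powi n \<delta> j)" ..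
  have exponents: "\<forall>\<delta>\<in>\<Delta>. e \<delta> = 0" if e: "\<And>j. j \<in> {..<d} \<Longrightarrow> (\<Sum>\<delta>\<in>\<Delta>. e \<delta> * n \<delta> j) = 0" for e
  proof (rule independent, rule ballI)
    fix t assume "t \<in> T"
    then obtain z where z: "z \<in> carrier (Gm d)" "t = \<theta> z"
      using \<theta>_surj by auto
    have "(\<Prod>\<delta>\<in>\<Delta>. \<delta> t powi e \<delta>) = (\<Prod>\<delta>\<in>\<Delta>. \<Prod>j<d. z j powi (e \<delta> * n \<delta> j))"
    proof (rule prod.cong[OF refl])
      fix \<delta> assume "\<delta> \<in> \<Delta>"
      then have "\<delta> t = (\<Prod>j<d. z j powi n \<delta> j)"
        using n z by simp
      then show "\<delta> t powi e \<delta> = (\<Prod>j<d. z j powi (e \<delta> * n \<delta> j))"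
        by (simp add: prod_power_int mult.commute[of "e \<delta>"] power_int_mult)
    qed
    also have "\<dots> = (\<Prod>j<d. \<Prod>\<delta>\<in>\<Delta>. z j powi (e \<delta> * n \<delta> j))"
      by (rule prod.swap)
    also have "\<dots> = (\<Prod>j<d. z j powi (\<Sum>\<delta>\<in>\<Delta>. e \<delta> * n \<delta> j))"
      using z by (intro prod.cong) (simp_all add: power_int_sum Gm_simps)
    also have "\<dots> = 1"
      using e by (intro prod.neutral) simp
    finally show "(\<Prod>\<delta>\<in>\<Delta>. \<delta> t powi e \<delta>) = 1" .
  qed
  have "\<exists>D w. D \<noteq> 0 \<and>
      (\<forall>i\<in>\<Delta>. \<forall>k\<in>\<Delta>. (\<Sum>j\<in>{..<d}. n i j * w k j) = (if i = k then D else 0))"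
    by (rule integer_dual_basis[OF \<Delta>(2) finite_lessThan]) (rule exponents)
  then obtain D w where D: "D \<noteq> 0"
    and w: "\<forall>i\<in>\<Delta>. \<forall>k\<in>\<Delta>. (\<Sum>j\<in>{..<d}. n i j * w k j) = (if i = k then D else 0)"
    by (elim exE conjE)
  \<comment> \<open>The sum of the dual vectors of the simple roots other than \<alpha>; the sign of
    D makes the pairing |D| r nonnegative.\<close>
  define x where "x j = sgn D * int r * (\<Sum>\<delta>\<in>\<Delta> - {\<alpha>}. w \<delta> j)" for j
  define z where "z j = (if j < d then of_nat p powi x j else 1 :: 'c)" for j
  define M where "M = nat \<bar>D\<bar> * r"
  have p0: "(of_nat p :: 'c) \<noteq> 0"
    using p_gt_1 by simp
  have z: "z \<in> carrier (Gm d)"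
    using p0 by (simp add: Gm_simps z_def)
  have dot: "(\<Sum>j<d. x j * n \<delta> j) = (if \<delta> = \<alpha> then 0 else int M)" if "\<delta> \<in> \<Delta>" for \<delta>
  proof -
    have "(\<Sum>j<d. x j * n \<delta> j) = sgn D * int r * (\<Sum>j<d. \<Sum>\<gamma>\<in>\<Delta> - {\<alpha>}. n \<delta> j * w \<gamma> j)"
      by (simp add: x_def sum_distrib_left sum_distrib_right mult_ac)
    also have "(\<Sum>j<d. \<Sum>\<gamma>\<in>\<Delta> - {\<alpha>}. n \<delta> j * w \<gamma> j) = (\<Sum>\<gamma>\<in>\<Delta> - {\<alpha>}. \<Sum>j<d. n \<delta> j * w \<gamma> j)"
      by (rule sum.swap)
    also have "\<dots> = (\<Sum>\<gamma>\<in>\<Delta> - {\<alpha>}. if \<delta> = \<gamma> then D else 0)"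
      using that w by (intro sum.cong) auto
    also have "\<dots> = (if \<delta> = \<alpha> then 0 else D)"
      using that \<Delta>(2) by simp
    finally show ?thesis
      using D by (simp add: M_def sgn_if)
  qed
  have value_at: "\<delta> (\<theta> z) = (if \<delta> = \<alpha> then 1 else of_nat (p ^ M))" if "\<delta> \<in> \<Delta>" for \<delta>
  proof -
    have "\<delta> (\<theta> z) = (\<Prod>j<d. z j powi n \<delta> j)"
      using n z that by blast
    also have "\<dots> = (\<Prod>j<d. of_nat p powi (x j * n \<delta> j))"
      by (intro prod.cong) (simp_all add: z_def power_int_mult)
    also have "\<dots> = of_nat p powi (\<Sum>j<d. x j * n \<delta> j)"
      by (rule power_int_sum[OF p0, symmetric])
    also have "\<dots> = (if \<delta> = \<alpha> then 1 else of_nat (p ^ M))"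
      unfolding dot[OF that] by simp
    finally show ?thesis .
  qed
  \<comment> \<open>The parametrization is defined over \<open>Qp\<close>, and the coordinates of z
    are integral powers of p or 1.\<close>
  have "\<theta> z $ i $ j \<in> Qp" for i j
  proof -
    have "\<forall>f\<in>GL_coords. \<exists>g\<in>poly_funs Qp (Gm_coords d). \<forall>x\<in>carrier (Gm d). f (\<theta> x) = g x"
      using \<theta> by (simp add: alg_iso_def)
    moreover have "(\<lambda>A. A $ i $ j) \<in> (GL_coords :: ('c ^ 'n ^ 'n \<Rightarrow> 'c) set)"
      by (auto simp: GL_coords_def entry_funs_def)
    ultimately have "\<exists>g\<in>poly_funs Qp (Gm_coords d). \<forall>x\<in>carrier (Gm d). (\<lambda>A. A $ i $ j) (\<theta> x) = g x"
      by (rule bspec)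
    then obtain g where g: "g \<in> poly_funs Qp (Gm_coords d)" "\<forall>x\<in>carrier (Gm d). \<theta> x $ i $ j = g x"
      by auto
    have "z i \<in> Qp" for i
      by (simp add: z_def Qp_powi Qp_of_nat Qp_1)
    then have "h z \<in> Qp" if "h \<in> Gm_coords d" for h
      using that Qp_inverse by (auto simp: Gm_coords_def)
    then have "g z \<in> Qp"
      by (rule poly_funs_Qp[OF g(1)])
    then show ?thesis
      using g(2) z by simp
  qed
  then have "\<theta> z \<in> Qp_points T"
    using \<theta>_in_T[OF z] by (simp add: Qp_points_def)
  moreover have "\<alpha> (\<theta> z) = 1"
    using value_at[OF \<alpha>] by simp
  moreover have "\<exists>m\<ge>r. \<beta> (\<theta> z) = of_nat (p ^ m)" if \<beta>: "\<beta> \<in> \<Phi>" "\<beta> \<noteq> \<alpha>" for \<beta>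
  proof -
    obtain m :: "_ \<Rightarrow> nat" where m: "\<forall>t\<in>T. \<beta> t = (\<Prod>\<delta>\<in>\<Delta>. \<delta> t ^ m \<delta>)"
      using combination[OF \<beta>(1)] ..
    have split: "\<beta> t = \<alpha> t ^ m \<alpha> * (\<Prod>\<delta>\<in>\<Delta> - {\<alpha>}. \<delta> t ^ m \<delta>)" if "t \<in> T" for t
      using m that \<alpha> \<Delta>(2) by (simp add: prod.remove)
    have "(\<Sum>\<delta>\<in>\<Delta> - {\<alpha>}. m \<delta>) \<noteq> 0"
    proof
      assume "(\<Sum>\<delta>\<in>\<Delta> - {\<alpha>}. m \<delta>) = 0"
      then have "m \<delta> = 0" if "\<delta> \<in> \<Delta> - {\<alpha>}" for \<delta>
        using that \<Delta>(2) by simp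
      then have *: "\<forall>t\<in>T. \<beta> t = \<alpha> t ^ m \<alpha>"
        using split by simp
      \<comment> \<open>If only \<alpha> occurred, \<beta> would be a power of \<alpha>. Reducedness
        makes the exponent 1, and extensionality of characters then forces \<beta> =
        \<alpha>.\<close>
      then have "m \<alpha> = 1"
        using reduced[of \<alpha> \<beta> "m \<alpha>"] \<alpha> \<Delta>(1) \<beta>(1) by blast
      then have "\<beta> t = \<alpha> t" if "t \<in> T" for t
        using * that by simp
      moreover have "\<beta> \<in> extensional T" "\<alpha> \<in> extensional T"
        using \<Phi> \<alpha> \<Delta>(1) \<beta>(1) by (auto simp: characters_def)
      ultimately have "\<beta> = \<alpha>"
        by (intro extensionalityI[of _ T])
      then show False
        using \<beta>(2) by simp
    qed
    then have "1 * r * 1 \<le> nat \<bar>D\<bar> * r * (\<Sum>\<delta>\<in>\<Delta> - {\<alpha>}. m \<delta>)"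
      using D by (intro mult_le_mono) auto
    then have "r \<le> M * (\<Sum>\<delta>\<in>\<Delta> - {\<alpha>}. m \<delta>)"
      by (simp add: M_def)
    moreover have "(\<Prod>\<delta>\<in>\<Delta> - {\<alpha>}. \<delta> (\<theta> z) ^ m \<delta>) = (\<Prod>\<delta>\<in>\<Delta> - {\<alpha>}. of_nat ((p ^ M) ^ m \<delta>))"
      by (intro prod.cong) (auto simp: value_at)
    then have "\<beta> (\<theta> z) = (\<Prod>\<delta>\<in>\<Delta> - {\<alpha>}. of_nat ((p ^ M) ^ m \<delta>))"
      by (simp add: split[OF \<theta>_in_T[OF z]] value_at[OF \<alpha>])
    then have "\<beta> (\<theta> z) = of_nat (p ^ (M * (\<Sum>\<delta>\<in>\<Delta> - {\<alpha>}. m \<delta>)))"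
      by (simp add: power_mult power_sum)
    ultimately show ?thesis
      by blast
  qed
  ultimately show ?thesis
    by (rule that)
qed

section \<open>Elements of N_0 and of T_+\<close>

lemma (in root_parameter) open_subgroup_nontrivial:
  assumes "openin (top_of_set (Qp_points N)) N0" "U \<subseteq> N" "mat 1 \<in> N0"
  obtains x where "x \<noteq> 0" "u x \<in> N0"
proof -
  obtain S where S: "open S" "N0 = Qp_points N \<inter> S"
    using assms(1) by (auto simp: openin_open)
  \<comment> \<open>As p^k tends to 0, u(p^k) tends to 1 and enters every neighbourhood of it. These
    rational points are different from 1.\<close>
  have "(\<lambda>k. of_nat p ^ k) \<longlonglongrightarrow> (0 :: 'c)"
  proof (rule tendsto_of_dist_le)
    show "(\<lambda>k. (1 / real p) ^ k) \<longlonglongrightarrow> 0"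
      using p_gt_1 by (intro LIMSEQ_power_zero) simp
  qed (simp add: vabs_power vabs_p)
  from u_tendsto[OF this] have "\<forall>\<^sub>F k in sequentially. u (of_nat p ^ k) \<in> S"
    using S assms(3) by (intro topological_tendstoD[of _ "mat 1"]) (simp_all add: u_0)
  then obtain k where "u (of_nat p ^ k) \<in> S"
    by (auto simp: eventually_sequentially)
  moreover have "u (of_nat p ^ k) $ i $ j \<in> Qp" for i j
    using Qp_of_nat[of "p ^ k"] by (intro u_Qp) simp
  then have "u (of_nat p ^ k) \<in> Qp_points N"
    using assms(2) u_in_U by (auto simp: Qp_points_def)
  ultimately have "u (of_nat p ^ k) \<in> N0"
    by (simp add: S(2))
  moreover have "(of_nat p ^ k :: 'c) \<noteq> 0"
    using p_gt_1 by simp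
  ultimately show ?thesis
    by (rule that[rotated])
qed

lemma generate_GL_trivial: "generate GL {mat 1 :: 'a::field ^ 'n ^ 'n} \<subseteq> {mat 1}"
proof
  fix A :: "'a ^ 'n ^ 'n" assume "A \<in> generate GL {mat 1}"
  then show "A \<in> {mat 1}"
  proof (induction rule: generate.induct)
    case (inv h)
    then show ?case
      by (simp add: inv_GL matrix_inv_mat_1 invertible_det_nz)
  qed simp_all
qed

text \<open>Conjugation distributes over the ordered product. If \<beta>(t) is a natural number m,
  each factor u(x) becomes its m-th power u(m x), so it stays in the group N0.\<close>

lemma (in root_coordinates) T_plusI:
  assumes T: "subgroup T GL" and N0: "subgroup N0 GL"
    and surj: "(\<lambda>f. ordprod GL f bs) ` (\<Pi>\<^sub>E \<beta>\<in>set bs. N0 \<inter> U \<beta>) = N0"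
    and t: "t \<in> Qp_points T" and integral: "\<And>\<beta>. \<beta> \<in> set bs \<Longrightarrow> \<exists>m. \<beta> t = of_nat m"
  shows "t \<in> T_plus T N0"
proof -
  have tT: "t \<in> T" and inv: "invertible t"
    using t subgroup.subset[OF T] by (auto simp: Qp_points_def)
  have conj: "t ** A ** matrix_inv t \<in> N0" if \<beta>: "\<beta> \<in> set bs" and A: "A \<in> N0 \<inter> U \<beta>" for \<beta> A
  proof -
    interpret root_lattice p TC T "U \<beta>" \<beta> "u \<beta>" N0 "y \<beta>"
      by (rule lattice[OF \<beta>])
    obtain x where x: "A = u \<beta> x"
      using A bij_u by (auto simp: bij_betw_def)
    obtain m where m: "\<beta> t = of_nat m"
      using integral[OF \<beta>] ..
    show ?thesis
      using u_conj[OF tT, of x] u_multiple_in_N0[of x m] A by (simp add: x m)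
  qed
  have prod_closed: "set cs \<subseteq> set bs \<Longrightarrow> (\<And>\<beta>. \<beta> \<in> set bs \<Longrightarrow> f \<beta> \<in> N0) \<Longrightarrow> ordprod GL f cs \<in> N0" for f cs
    using subgroup.m_closed[OF N0] subgroup.one_closed[OF N0] by (induction cs) simp_all
  have "t ** A ** matrix_inv t \<in> N0" if "A \<in> N0" for A
  proof -
    have "A \<in> (\<lambda>f. ordprod GL f bs) ` (\<Pi>\<^sub>E \<beta>\<in>set bs. N0 \<inter> U \<beta>)"
      using that surj by simp
    then obtain f where f: "f \<in> (\<Pi>\<^sub>E \<beta>\<in>set bs. N0 \<inter> U \<beta>)" "A = ordprod GL f bs"
      by auto
    show ?thesis
      unfolding f(2) ordprod_GL_conj[OF inv]
    proof (rule prod_closed)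
      show "t ** f \<beta> ** matrix_inv t \<in> N0" if "\<beta> \<in> set bs" for \<beta>
        using conj[OF that PiE_mem[OF f(1) that]] .
    qed simp
  qed
  then show ?thesis
    using t by (auto simp: T_plus_def)
qed

section \<open>Convergence in the generalized Robba ring\<close>

lemma (in normed_ring_pair) int_pow_closed_norm:
  assumes \<rho>: "\<rho> \<in> {\<rho>1, \<rho>2}" and x: "x \<in> Units A \<or> x \<in> carrier A \<and> 0 \<le> n"
  shows "x [^] (n::int) \<in> carrier A \<and> rnorm A \<rho> (x [^] n) = rnorm A \<rho> x powi n"
proof (cases "0 \<le> n")
  case True
  have "x \<in> carrier A"
    using x Units_closed by blast
  then have "x [^] nat n \<in> carrier A" "rnorm A \<rho> (x [^] nat n) = rnorm A \<rho> x ^ nat n"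
    using rnorm_nat_pow[OF \<rho>, of x "nat n"] nat_pow_closed[of x "nat n"] by simp_all
  then show ?thesis
    using True by (simp only: int_pow_nonneg[OF True] power_int_def if_True)
next
  case False
  then have unit: "x \<in> Units A" and n: "n < 0"
    using x by auto
  have "x [^] m \<in> Units A" for m :: nat
    using unit by (induction m) simp_all
  then have "inv (x [^] nat (- n)) \<in> carrier A"
    by (rule Units_inv_closed)
  then have "x [^] n \<in> carrier A"
    by (simp only: int_pow_negative[OF n])
  then show ?thesis
    using rnorm_int_pow[OF \<rho> unit] by blast
qed

lemma null_family_cong: "(\<And>k. k \<in> I \<Longrightarrow> f k = g k) \<Longrightarrow> null_family f I \<longleftrightarrow> null_family g I"
  unfolding null_family_def by (simp cong: conj_cong)

lemma laurent_indices_nonneg: "k \<in> laurent_indices bs \<alpha> \<Longrightarrow> \<beta> \<in> set bs \<Longrightarrow> \<beta> \<noteq> \<alpha> \<Longrightarrow> 0 \<le> k \<beta>"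
  by (auto simp: laurent_indices_def)

lemma (in Cp_field) radii_dense:
  assumes "1 / real p \<le> a" "a < b" "b \<le> 1"
  shows "\<exists>\<rho>\<in>radii p. a < \<rho> \<and> \<rho> < b"
proof -
  have a: "0 < a"
    using assms(1) p_gt_1 by (smt (verit) divide_pos_pos)
  then have "log (real p) a < log (real p) b"
    using assms p_gt_1 by simp
  then obtain q where q: "log (real p) a < of_rat q" "of_rat q < log (real p) b"
    using of_rat_dense by blast
  have "a < real p powr of_rat q" "real p powr of_rat q < b"
    using q p_gt_1 a assms(2) by (simp_all add: log_less_iff less_log_iff)
  moreover from this have "real p powr of_rat q \<in> radii p"
    using assms unfolding radii_def by (auto intro: Rats_of_rat)
  ultimately show ?thesis
    by blast
qed

section \<open>Norms of the terms in the microlocalizations\<close>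

locale microlocal_setting = root_coordinates p TC T N0 bs U u y gen
  for p and TC :: "'c::{alg_closed_field, field_char_0, complete_space} itself"
    and T N0 :: "('c ^ 'n::finite ^ 'n) set" and bs U u y gen +
  fixes K :: "'c set" and \<alpha> :: "'c ^ 'n ^ 'n \<Rightarrow> 'c"
    and A :: "real \<Rightarrow> real \<Rightarrow> 'a normed_ring"
    and emb :: "real \<Rightarrow> real \<Rightarrow> ((('c ^ 'n ^ 'n \<Rightarrow> 'c) \<Rightarrow> nat) \<Rightarrow> 'c) \<Rightarrow> 'a"
    and res :: "real \<Rightarrow> real \<Rightarrow> real \<Rightarrow> 'a \<Rightarrow> 'a"
  assumes K: "Qp \<subseteq> K"
    and system: "microlocalization_system p K bs gen \<alpha> A emb res"
    and \<alpha>: "\<alpha> \<in> set bs"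
    and one_T_plus: "mat 1 \<in> T_plus T N0" and \<alpha>_one: "\<alpha> (mat 1) = 1"
begin

abbreviation phi_norm :: "'c ^ 'n ^ 'n \<Rightarrow> ('c ^ 'n ^ 'n \<Rightarrow> 'c) \<Rightarrow> real \<Rightarrow> real" where
  "phi_norm t \<beta> \<rho> \<equiv> dist_rnorm bs \<rho> (phi_b bs gen t \<beta>)"

abbreviation term_norm :: "'c ^ 'n ^ 'n \<Rightarrow> ((('c ^ 'n ^ 'n \<Rightarrow> 'c) \<Rightarrow> int) \<Rightarrow> 'c) \<Rightarrow> real \<Rightarrow> (('c ^ 'n ^ 'n \<Rightarrow> 'c) \<Rightarrow> int) \<Rightarrow> real" where
  "term_norm t c \<rho> k \<equiv> vabs (c k) * (\<Prod>\<beta>\<in>set bs. phi_norm t \<beta> \<rho> powi k \<beta>)"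

lemma radii_bounds: "\<rho> \<in> radii p \<Longrightarrow> 0 < \<rho> \<and> \<rho> < 1"
  using p_gt_1 unfolding radii_def by (auto intro: less_trans[rotated])

lemma radii_aboveD: "\<rho>2 \<in> radii_above p \<rho>1 \<Longrightarrow> \<rho>2 \<in> radii p \<and> \<rho>1 < \<rho>2"
  by (simp add: radii_above_def)

context
  fixes \<rho>1 assumes \<rho>1: "\<rho>1 \<in> radii p"
begin

lemma microlocal: "\<rho>2 \<in> radii_above p \<rho>1 \<Longrightarrow> microlocalization K bs gen \<alpha> \<rho>1 \<rho>2 (A \<rho>1 \<rho>2) (emb \<rho>1 \<rho>2)"
  using system \<rho>1 radii_aboveD by (simp add: microlocalization_system_def)

lemma emb_closed:
  assumes "\<rho>2 \<in> radii_above p \<rho>1" "d \<in> distributions K bs"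
  shows "emb \<rho>1 \<rho>2 d \<in> carrier (A \<rho>1 \<rho>2)"
proof -
  have "d \<in> carrier (distribution_ring K bs gen \<rho>2)"
    using assms radii_aboveD radii_bounds by (intro distributions_subset) auto
  moreover have "emb \<rho>1 \<rho>2 \<in> ring_hom (distribution_ring K bs gen \<rho>2) (A \<rho>1 \<rho>2)"
    using microlocal[OF assms(1)] by (simp add: microlocalization_def Let_def)
  ultimately show ?thesis
    by (rule ring_hom_closed[rotated])
qed

lemma emb_norm:
  assumes "\<rho>2 \<in> radii_above p \<rho>1" "d \<in> distributions K bs" "\<rho> \<in> {\<rho>1, \<rho>2}"
  shows "rnorm (A \<rho>1 \<rho>2) \<rho> (emb \<rho>1 \<rho>2 d) = dist_rnorm bs \<rho> d"
proof -
  have "d \<in> carrier (distribution_ring K bs gen \<rho>2)"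
    using assms radii_aboveD radii_bounds by (intro distributions_subset) auto
  then show ?thesis
    using microlocal[OF assms(1)] assms(3) unfolding microlocalization_def Let_def by blast
qed

lemma normed_ring_pair_A:
  assumes \<rho>2: "\<rho>2 \<in> radii_above p \<rho>1"
  shows "normed_ring_pair (A \<rho>1 \<rho>2) \<rho>1 \<rho>2"
proof -
  note m = microlocal[OF \<rho>2, unfolded microlocalization_def Let_def]
  interpret ring "A \<rho>1 \<rho>2"
    using m by (elim conjE)
  have mult: "\<And>\<rho>. \<rho> \<in> {\<rho>1, \<rho>2} \<Longrightarrow> multiplicative_rnorm (A \<rho>1 \<rho>2) \<rho>"
    using m by blast
  have phi: "phi_b bs gen (mat 1) \<alpha> \<in> distributions K bs"
    by (rule phi_b_in_distributions[OF one_T_plus \<alpha> K])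
  show ?thesis
  proof
    show "\<one>\<^bsub>A \<rho>1 \<rho>2\<^esub> \<noteq> \<zero>\<^bsub>A \<rho>1 \<rho>2\<^esub>"
    proof
      assume "\<one>\<^bsub>A \<rho>1 \<rho>2\<^esub> = \<zero>\<^bsub>A \<rho>1 \<rho>2\<^esub>"
      \<comment> \<open>In the zero ring b_\<alpha> would have norm 0, whereas its norm is the
        positive number \<open>\<rho>1\<close>; b_\<alpha> is treated as phi_t(b_\<alpha>) at t =
        1.\<close>
      then have "carrier (A \<rho>1 \<rho>2) = {\<zero>\<^bsub>A \<rho>1 \<rho>2\<^esub>}"
        by (rule one_zeroD)
      then have "emb \<rho>1 \<rho>2 (phi_b bs gen (mat 1) \<alpha>) = \<zero>\<^bsub>A \<rho>1 \<rho>2\<^esub>"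
        using emb_closed[OF \<rho>2 phi] by simp
      then have "rnorm (A \<rho>1 \<rho>2) \<rho>1 (emb \<rho>1 \<rho>2 (phi_b bs gen (mat 1) \<alpha>)) = 0"
        using mult[of \<rho>1] by (simp add: multiplicative_rnorm_def)
      moreover have "rnorm (A \<rho>1 \<rho>2) \<rho>1 (emb \<rho>1 \<rho>2 (phi_b bs gen (mat 1) \<alpha>)) = \<rho>1"
        using emb_norm[OF \<rho>2 phi] phi_b_norm_eq[OF one_T_plus \<alpha> \<alpha>_one] radii_bounds[OF \<rho>1] by simp
      ultimately show False
        using radii_bounds[OF \<rho>1] by simp
    qed
    show "Metric_space.mcomplete (carrier (A \<rho>1 \<rho>2)) (max_dist (A \<rho>1 \<rho>2) \<rho>1 \<rho>2)"
      using m by (elim conjE)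
  qed (rule mult)
qed

lemma limit_system_A: "limit_system p A res \<rho>1"
proof (rule limit_system.intro)
  fix \<rho>2 \<rho>3 assume "\<rho>2 \<in> radii_above p \<rho>1" "\<rho>3 \<in> radii_above p \<rho>1" "\<rho>2 < \<rho>3"
  then show "res \<rho>1 \<rho>2 \<rho>3 \<in> ring_hom (A \<rho>1 \<rho>3) (A \<rho>1 \<rho>2)"
    "continuous_map (max_topology (A \<rho>1 \<rho>3) \<rho>1 \<rho>3) (max_topology (A \<rho>1 \<rho>2) \<rho>1 \<rho>2) (res \<rho>1 \<rho>2 \<rho>3)"
    using system \<rho>1 unfolding microlocalization_system_def radii_above_def by blast+
qed (rule normed_ring_pair_A)

interpretation L: limit_system p A res \<rho>1
  by (rule limit_system_A)

lemma limit_emb_component: "\<rho>2 \<in> radii_above p \<rho>1 \<Longrightarrow> limit_emb p emb \<rho>1 d \<rho>2 = emb \<rho>1 \<rho>2 d"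
  by (simp add: limit_emb_def)

lemma limit_emb_closed:
  assumes d: "d \<in> distributions K bs"
  shows "limit_emb p emb \<rho>1 d \<in> carrier (limit_ring p A res \<rho>1)"
proof (rule L.R_carrierI)
  show "limit_emb p emb \<rho>1 d \<in> extensional (radii_above p \<rho>1)"
    by (simp add: limit_emb_def)
  fix \<rho>2 assume \<rho>2: "\<rho>2 \<in> radii_above p \<rho>1"
  show "limit_emb p emb \<rho>1 d \<rho>2 \<in> carrier (A \<rho>1 \<rho>2)"
    using emb_closed[OF \<rho>2 d] by (simp add: limit_emb_component \<rho>2)
  fix \<rho>3 assume \<rho>3: "\<rho>3 \<in> radii_above p \<rho>1" "\<rho>2 < \<rho>3"
  have "d \<in> carrier (distribution_ring K bs gen \<rho>3)"
    using d \<rho>3 radii_aboveD radii_bounds by (intro distributions_subset) auto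
  then have "res \<rho>1 \<rho>2 \<rho>3 (emb \<rho>1 \<rho>3 d) = emb \<rho>1 \<rho>2 d"
    using system \<rho>1 \<rho>2 \<rho>3 unfolding microlocalization_system_def radii_above_def by blast
  then show "res \<rho>1 \<rho>2 \<rho>3 (limit_emb p emb \<rho>1 d \<rho>3) = limit_emb p emb \<rho>1 d \<rho>2"
    by (simp add: limit_emb_component \<rho>2 \<rho>3)
qed

text \<open>Multiplicativity evaluates the ordered product factor by factor. A negative exponent can
  occur only at \<alpha>, where \<open>unit\<close> makes the power meaningful.\<close>

lemma laurent_term_closed_norm:
  assumes t: "t \<in> T_plus T N0" and c: "c \<in> laurent_series K bs \<alpha>" and k: "k \<in> laurent_indices bs \<alpha>"
    and unit: "limit_emb p emb \<rho>1 (phi_b bs gen t \<alpha>) \<in> Units (limit_ring p A res \<rho>1)"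
    and \<rho>2: "\<rho>2 \<in> radii_above p \<rho>1"
  shows "laurent_term p bs gen A emb res \<rho>1 t c k \<in> carrier (limit_ring p A res \<rho>1)"
    and "\<rho> \<in> {\<rho>1, \<rho>2} \<Longrightarrow>
      rnorm (A \<rho>1 \<rho>2) \<rho> (laurent_term p bs gen A emb res \<rho>1 t c k \<rho>2) = term_norm t c \<rho> k"
proof -
  let ?R = "limit_ring p A res \<rho>1"
  interpret N: normed_ring_pair "A \<rho>1 \<rho>2" \<rho>1 \<rho>2
    by (rule normed_ring_pair_A[OF \<rho>2])
  define f where "f \<beta> = limit_emb p emb \<rho>1 (phi_b bs gen t \<beta>)" for \<beta>
  have phi: "phi_b bs gen t \<beta> \<in> distributions K bs" if "\<beta> \<in> set bs" for \<beta>
    using phi_b_in_distributions[OF t that K] .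
  have f: "f \<beta> \<in> Units ?R \<or> f \<beta> \<in> carrier ?R \<and> 0 \<le> k \<beta>" if "\<beta> \<in> set bs" for \<beta>
    using unit laurent_indices_nonneg[OF k that] limit_emb_closed[OF phi[OF that]]
    by (cases "\<beta> = \<alpha>") (auto simp: f_def)
  have f_pow: "f \<beta> [^]\<^bsub>?R\<^esub> k \<beta> \<in> carrier ?R" "(f \<beta> [^]\<^bsub>?R\<^esub> k \<beta>) \<rho>2 = f \<beta> \<rho>2 [^]\<^bsub>A \<rho>1 \<rho>2\<^esub> k \<beta>"
    if "\<beta> \<in> set bs" for \<beta>
    using L.R_int_pow[OF f[OF that] \<rho>2] by auto
  have f\<rho>2: "f \<beta> \<rho>2 \<in> Units (A \<rho>1 \<rho>2) \<or> f \<beta> \<rho>2 \<in> carrier (A \<rho>1 \<rho>2) \<and> 0 \<le> k \<beta>" if "\<beta> \<in> set bs" for \<beta>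
    using f[OF that] L.R_Units_component(1)[OF _ \<rho>2, of "f \<beta>"] L.R_component[OF _ \<rho>2, of "f \<beta>"]
    by (elim disjE) simp_all
  have "0 \<in> K" "c k \<in> K"
    using K Qp_0 c by (auto simp: laurent_series_def)
  then have scalar: "scalar (c k) \<in> distributions K bs"
    by (rule scalar_in_distributions)
  have term_eq: "laurent_term p bs gen A emb res \<rho>1 t c k =
      limit_emb p emb \<rho>1 (scalar (c k)) \<otimes>\<^bsub>?R\<^esub> ordprod ?R (\<lambda>\<beta>. f \<beta> [^]\<^bsub>?R\<^esub> k \<beta>) bs"
    by (simp add: laurent_term_def f_def Let_def)
  let ?O = "ordprod ?R (\<lambda>\<beta>. f \<beta> [^]\<^bsub>?R\<^esub> k \<beta>) bs"
  have prod: "?O \<in> carrier ?R"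
    by (rule L.R_ordprod(1)[OF _ \<rho>2]) (rule f_pow(1))
  have "?O \<rho>2 = ordprod (A \<rho>1 \<rho>2) (\<lambda>\<beta>. (f \<beta> [^]\<^bsub>?R\<^esub> k \<beta>) \<rho>2) bs"
    by (rule L.R_ordprod(2)[OF _ \<rho>2]) (rule f_pow(1))
  also have "\<dots> = ordprod (A \<rho>1 \<rho>2) (\<lambda>\<beta>. f \<beta> \<rho>2 [^]\<^bsub>A \<rho>1 \<rho>2\<^esub> k \<beta>) bs"
    by (rule ordprod_cong) (rule f_pow(2))
  finally have prod_component: "?O \<rho>2 = ordprod (A \<rho>1 \<rho>2) (\<lambda>\<beta>. f \<beta> \<rho>2 [^]\<^bsub>A \<rho>1 \<rho>2\<^esub> k \<beta>) bs" .
  show "laurent_term p bs gen A emb res \<rho>1 t c k \<in> carrier ?R"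
    unfolding term_eq by (rule L.R_mult_closed[OF limit_emb_closed[OF scalar] prod])
  assume \<rho>: "\<rho> \<in> {\<rho>1, \<rho>2}"
  have pow_norm: "f \<beta> \<rho>2 [^]\<^bsub>A \<rho>1 \<rho>2\<^esub> k \<beta> \<in> carrier (A \<rho>1 \<rho>2)"
    "rnorm (A \<rho>1 \<rho>2) \<rho> (f \<beta> \<rho>2 [^]\<^bsub>A \<rho>1 \<rho>2\<^esub> k \<beta>) = phi_norm t \<beta> \<rho> powi k \<beta>" if "\<beta> \<in> set bs" for \<beta>
    using N.int_pow_closed_norm[OF \<rho> f\<rho>2[OF that]] emb_norm[OF \<rho>2 phi[OF that] \<rho>]
    by (simp_all add: f_def limit_emb_component[OF \<rho>2])
  let ?P = "ordprod (A \<rho>1 \<rho>2) (\<lambda>\<beta>. f \<beta> \<rho>2 [^]\<^bsub>A \<rho>1 \<rho>2\<^esub> k \<beta>) bs"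
  have P: "?P \<in> carrier (A \<rho>1 \<rho>2) \<and> rnorm (A \<rho>1 \<rho>2) \<rho> ?P =
      (\<Prod>\<beta>\<in>set bs. rnorm (A \<rho>1 \<rho>2) \<rho> (f \<beta> \<rho>2 [^]\<^bsub>A \<rho>1 \<rho>2\<^esub> k \<beta>))"
    by (rule N.rnorm_ordprod[OF \<rho> distinct]) (rule pow_norm(1))
  have "rnorm (A \<rho>1 \<rho>2) \<rho> (laurent_term p bs gen A emb res \<rho>1 t c k \<rho>2) =
      rnorm (A \<rho>1 \<rho>2) \<rho> (emb \<rho>1 \<rho>2 (scalar (c k))) * rnorm (A \<rho>1 \<rho>2) \<rho> ?P"
    unfolding term_eq L.R_mult[OF \<rho>2] prod_component limit_emb_component[OF \<rho>2]
    using P by (intro N.rnorm_mult[OF \<rho>] emb_closed[OF \<rho>2 scalar]) simp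
  also have "rnorm (A \<rho>1 \<rho>2) \<rho> (emb \<rho>1 \<rho>2 (scalar (c k))) = vabs (c k)"
    unfolding emb_norm[OF \<rho>2 scalar \<rho>] by (rule dist_rnorm_scalar)
  also have "rnorm (A \<rho>1 \<rho>2) \<rho> ?P = (\<Prod>\<beta>\<in>set bs. phi_norm t \<beta> \<rho> powi k \<beta>)"
    unfolding conjunct2[OF P] by (intro prod.cong refl pow_norm(2))
  finally show "rnorm (A \<rho>1 \<rho>2) \<rho> (laurent_term p bs gen A emb res \<rho>1 t c k \<rho>2) = term_norm t c \<rho> k" .
qed

lemma laurent_series_convergent_iff:
  assumes t: "t \<in> T_plus T N0" and c: "c \<in> laurent_series K bs \<alpha>"
    and unit: "limit_emb p emb \<rho>1 (phi_b bs gen t \<alpha>) \<in> Units (limit_ring p A res \<rho>1)"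
  shows "unconditionally_convergent (limit_ring p A res \<rho>1) (limit_topology p A res \<rho>1)
      (laurent_term p bs gen A emb res \<rho>1 t c) (laurent_indices bs \<alpha>) \<longleftrightarrow>
    (\<forall>\<rho>2\<in>radii_above p \<rho>1. \<forall>\<rho>\<in>{\<rho>1, \<rho>2}. null_family (term_norm t c \<rho>) (laurent_indices bs \<alpha>))"
proof -
  \<comment> \<open>\<open>laurent_term_closed_norm\<close> is stated relative to a component, so
    some radius above \<open>\<rho>1\<close> has to be exhibited.\<close>
  have "1 / real p \<le> \<rho>1" "\<rho>1 < 1"
    using \<rho>1 by (simp_all add: radii_def)
  then have "\<exists>\<rho>2\<in>radii p. \<rho>1 < \<rho>2 \<and> \<rho>2 < 1"
    by (intro radii_dense) simp_all
  then obtain \<rho>2 where "\<rho>2 \<in> radii p" "\<rho>1 < \<rho>2"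
    by blast
  then have \<rho>2: "\<rho>2 \<in> radii_above p \<rho>1"
    by (simp add: radii_above_def)
  have closed: "laurent_term p bs gen A emb res \<rho>1 t c \<in> laurent_indices bs \<alpha> \<rightarrow> carrier (limit_ring p A res \<rho>1)"
    by (intro funcsetI laurent_term_closed_norm(1)[OF t c _ unit \<rho>2])
  have "null_family (\<lambda>k. rnorm (A \<rho>1 \<rho>2) \<rho> (laurent_term p bs gen A emb res \<rho>1 t c k \<rho>2)) (laurent_indices bs \<alpha>) \<longleftrightarrow>
      null_family (term_norm t c \<rho>) (laurent_indices bs \<alpha>)"
    if "\<rho>2 \<in> radii_above p \<rho>1" "\<rho> \<in> {\<rho>1, \<rho>2}" for \<rho>2 \<rho>
    by (rule null_family_cong) (rule laurent_term_closed_norm(2)[OF t c _ unit that])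
  then show ?thesis
    unfolding L.unconditionally_convergent_iff[OF closed] by (intro ball_cong refl) simp
qed

text \<open>phi_t(b_\<alpha>) depends on t only through \<alpha>(t), so here it is b_\<alpha>
  itself, which is invertible in every component.\<close>

lemma phi_b_unit:
  assumes "t \<in> T_plus T N0" "\<alpha> t = 1"
  shows "limit_emb p emb \<rho>1 (phi_b bs gen t \<alpha>) \<in> Units (limit_ring p A res \<rho>1)"
proof (rule L.R_UnitsI)
  show "limit_emb p emb \<rho>1 (phi_b bs gen t \<alpha>) \<in> carrier (limit_ring p A res \<rho>1)"
    by (rule limit_emb_closed[OF phi_b_in_distributions[OF assms(1) \<alpha> K]])
  fix \<rho>2 assume \<rho>2: "\<rho>2 \<in> radii_above p \<rho>1"
  have "phi_b bs gen t \<alpha> = phi_b bs gen (mat 1) \<alpha>"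
    using assms by (simp add: phi_b_eq_axis_family \<alpha> one_T_plus \<alpha>_one)
  then show "limit_emb p emb \<rho>1 (phi_b bs gen t \<alpha>) \<rho>2 \<in> Units (A \<rho>1 \<rho>2)"
    using microlocal[OF \<rho>2] by (simp add: limit_emb_component[OF \<rho>2] microlocalization_def Let_def)
qed

end

end

section \<open>Comparison with the commuting Laurent series\<close>

lemma monomial_le_max:
  fixes x a b :: "'i \<Rightarrow> real"
  assumes I: "finite I" "\<alpha> \<in> I" and k: "\<And>\<beta>. \<beta> \<in> I \<Longrightarrow> \<beta> \<noteq> \<alpha> \<Longrightarrow> 0 \<le> k \<beta>"
    and \<alpha>: "0 < a \<alpha>" "a \<alpha> \<le> x \<alpha>" "x \<alpha> \<le> b \<alpha>"
    and \<beta>: "\<And>\<beta>. \<beta> \<in> I \<Longrightarrow> \<beta> \<noteq> \<alpha> \<Longrightarrow> 0 \<le> x \<beta> \<and> x \<beta> \<le> a \<beta> \<and> x \<beta> \<le> b \<beta>"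
  shows "(\<Prod>\<beta>\<in>I. x \<beta> powi k \<beta>) \<le> max (\<Prod>\<beta>\<in>I. a \<beta> powi k \<beta>) (\<Prod>\<beta>\<in>I. b \<beta> powi k \<beta>)"
proof -
  have split: "(\<Prod>\<beta>\<in>I. y \<beta> powi k \<beta>) = y \<alpha> powi k \<alpha> * (\<Prod>\<beta>\<in>I - {\<alpha>}. y \<beta> powi k \<beta>)" for y :: "'i \<Rightarrow> real"
    by (rule prod.remove[OF I])
  have rest: "(\<Prod>\<beta>\<in>I - {\<alpha>}. x \<beta> powi k \<beta>) \<le> (\<Prod>\<beta>\<in>I - {\<alpha>}. y \<beta> powi k \<beta>)"
    if "\<And>\<beta>. \<beta> \<in> I \<Longrightarrow> \<beta> \<noteq> \<alpha> \<Longrightarrow> x \<beta> \<le> y \<beta>" for y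
    using that \<beta> k by (intro prod_mono) (auto intro!: power_int_mono zero_le_power_int)
  have nonneg: "0 \<le> (\<Prod>\<beta>\<in>I - {\<alpha>}. x \<beta> powi k \<beta>)"
    using \<beta> by (intro prod_nonneg) auto
  show ?thesis
  \<comment> \<open>A power with exponent k \<alpha> is increasing or decreasing in its base
    according to the sign of k \<alpha>, so the bound uses b above x \<alpha> or a below it. The
    other exponents are nonnegative, and there both a and b dominate.\<close>
  proof (cases "0 \<le> k \<alpha>")
    case True
    then have "x \<alpha> powi k \<alpha> \<le> b \<alpha> powi k \<alpha>"
      using \<alpha> by (intro power_int_mono) auto
    then have "(\<Prod>\<beta>\<in>I. x \<beta> powi k \<beta>) \<le> (\<Prod>\<beta>\<in>I. b \<beta> powi k \<beta>)"
      unfolding split using \<alpha> \<beta> nonneg by (intro mult_mono rest) auto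
    then show ?thesis
      by simp
  next
    case False
    then have "x \<alpha> powi k \<alpha> \<le> a \<alpha> powi k \<alpha>"
      using \<alpha> by (intro power_int_antimono) auto
    then have "(\<Prod>\<beta>\<in>I. x \<beta> powi k \<beta>) \<le> (\<Prod>\<beta>\<in>I. a \<beta> powi k \<beta>)"
      unfolding split using \<alpha> \<beta> nonneg by (intro mult_mono rest) auto
    then show ?thesis
      by simp
  qed
qed

context microlocal_setting
begin

lemma vabs_laurent_monomial:
  "vabs (a * (\<Prod>\<beta>\<in>set bs. z \<beta> powi k \<beta>)) = vabs a * (\<Prod>\<beta>\<in>set bs. vabs (z \<beta> :: 'c) powi k \<beta>)"
  by (simp add: vabs_mult vabs_prod vabs_powi)

lemma summable_of_converges_in_R0:
  assumes t: "t \<in> T_plus T N0" and c: "c \<in> laurent_series K bs \<alpha>"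
    and conv: "converges_in_R0 p bs gen \<alpha> A emb res t c"
  shows "\<exists>(\<rho>2::real) (r::nat). 1 / real p < \<rho>2 \<and> \<rho>2 < 1 \<and> 1 \<le> r \<and>
       (\<forall>z. \<rho>2 < vabs (z \<alpha>) \<and> vabs (z \<alpha>) < 1 \<and> (\<forall>\<beta>\<in>set bs - {\<alpha>}. vabs (z \<beta>) \<le> vabs (z \<alpha>) ^ r) \<longrightarrow>
          (\<lambda>k. c k * (\<Prod>\<beta>\<in>set bs. z \<beta> powi k \<beta>)) summable_on laurent_indices bs \<alpha>)"
proof -
  obtain \<rho>1 where \<rho>1: "\<rho>1 \<in> radii p"
    and null: "\<forall>\<rho>2\<in>radii_above p \<rho>1. \<forall>\<rho>\<in>{\<rho>1, \<rho>2}. null_family (term_norm t c \<rho>) (laurent_indices bs \<alpha>)"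
    using conv laurent_series_convergent_iff[OF _ t c] unfolding converges_in_R0_def by blast
  have "\<exists>q. \<forall>\<beta>\<in>set bs. 0 < q \<beta> \<and> (\<forall>\<rho>. 0 < \<rho> \<and> \<rho> < 1 \<longrightarrow> \<rho> ^ q \<beta> \<le> phi_norm t \<beta> \<rho>)"
  proof (intro bchoice ballI)
    fix \<beta> assume "\<beta> \<in> set bs"
    then obtain q where "0 < q" "\<And>\<rho>. 0 < \<rho> \<Longrightarrow> \<rho> < 1 \<Longrightarrow> \<rho> ^ q \<le> phi_norm t \<beta> \<rho>"
      by (rule phi_b_norm_ge[OF t]) (rule that)
    then show "\<exists>q. 0 < q \<and> (\<forall>\<rho>. 0 < \<rho> \<and> \<rho> < 1 \<longrightarrow> \<rho> ^ q \<le> phi_norm t \<beta> \<rho>)"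
      by blast
  qed
  then obtain q where q: "\<forall>\<beta>\<in>set bs. 0 < q \<beta> \<and> (\<forall>\<rho>. 0 < \<rho> \<and> \<rho> < 1 \<longrightarrow> \<rho> ^ q \<beta> \<le> phi_norm t \<beta> \<rho>)" ..
  \<comment> \<open>The sum dominates every q \<beta> at once. The factor 2 turns s^r into at most
    (s^2)^q, which leaves the interval between s^2 and s for choosing a radius a.\<close>
  define r where "r = 2 * (\<Sum>\<beta>\<in>set bs. q \<beta>)"
  have r: "2 * q \<beta> \<le> r" if "\<beta> \<in> set bs" for \<beta>
    using member_le_sum[of \<beta> "set bs" q] that by (simp add: r_def)
  have \<rho>1_bounds: "1 / real p < \<rho>1" "\<rho>1 < 1" "0 < \<rho>1"
    using \<rho>1 radii_bounds[OF \<rho>1] by (simp_all add: radii_def)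
  \<comment> \<open>The square root is the threshold for |z_\<alpha>| because s^2 must exceed
    \<open>\<rho>1\<close>: the radius a > s^2 then lies where the null families are known.\<close>
  have "\<rho>1 < sqrt \<rho>1"
    using \<rho>1_bounds by (intro real_less_rsqrt) (simp add: power2_eq_square)
  then have "1 / real p < sqrt \<rho>1" "sqrt \<rho>1 < 1"
    using \<rho>1_bounds by simp_all
  moreover have "1 \<le> r"
    using r[OF \<alpha>] q \<alpha> by fastforce
  moreover have "(\<lambda>k. c k * (\<Prod>\<beta>\<in>set bs. z \<beta> powi k \<beta>)) summable_on laurent_indices bs \<alpha>"
    if z: "sqrt \<rho>1 < vabs (z \<alpha>)" "vabs (z \<alpha>) < 1" "\<forall>\<beta>\<in>set bs - {\<alpha>}. vabs (z \<beta>) \<le> vabs (z \<alpha>) ^ r" for z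
  proof -
    define s where "s = vabs (z \<alpha>)"
    have "sqrt \<rho>1 < s" and s1: "s < 1"
      using z(1,2) by (simp_all only: s_def)
    then have s: "0 < s" "s < 1"
      using \<open>\<rho>1 < sqrt \<rho>1\<close> \<rho>1_bounds by linarith+
    have "(sqrt \<rho>1)\<^sup>2 < s\<^sup>2"
      using z(1) \<rho>1_bounds by (intro power_strict_mono) (simp_all add: s_def)
    then have s2: "\<rho>1 < s\<^sup>2"
      using \<rho>1_bounds by simp
    have "s\<^sup>2 < s"
      using s by (simp add: power2_eq_square)
    \<comment> \<open>The bound a < s puts the norm of phi_t(b_\<alpha>) at a below s; the bound s^2
      < a lets a^q dominate |z_\<beta>| for the other roots.\<close>
    then have "\<exists>a\<in>radii p. s\<^sup>2 < a \<and> a < s"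
      using s s2 \<rho>1_bounds by (intro radii_dense) simp_all
    then obtain a where a: "a \<in> radii p" "s\<^sup>2 < a" "a < s"
      by blast
    have q\<alpha>: "0 < q \<alpha>"
      using q \<alpha> by blast
    \<comment> \<open>A radius b above the q-th root of s gives b^q \<ge> s, hence a norm of
      phi_t(b_\<alpha>) at least s; b > s keeps the domination at the other roots.\<close>
    have "max s (root (q \<alpha>) s) < 1"
      using s q\<alpha> by simp
    moreover have "1 / real p \<le> max s (root (q \<alpha>) s)"
      using s2 \<rho>1_bounds \<open>s\<^sup>2 < s\<close> by simp
    ultimately have "\<exists>b\<in>radii p. max s (root (q \<alpha>) s) < b \<and> b < 1"
      by (intro radii_dense) simp_all
    then obtain b where b: "b \<in> radii p" "max s (root (q \<alpha>) s) < b" "b < 1"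
      by blast
    have above: "a \<in> radii_above p \<rho>1" "b \<in> radii_above p \<rho>1"
      using a b s2 \<open>s\<^sup>2 < s\<close> by (simp_all add: radii_above_def)
    have a01: "0 < a" "a < 1" and b01: "0 < b" "b < 1"
      using radii_bounds a b by auto
    have "s = root (q \<alpha>) s ^ q \<alpha>"
      using q\<alpha> s by simp
    also have "\<dots> \<le> b ^ q \<alpha>"
      using b s q\<alpha> by (intro power_mono) (auto simp: real_root_ge_zero)
    also have "\<dots> \<le> phi_norm t \<alpha> b"
      using q \<alpha> b01 by blast
    finally have b_\<alpha>: "s \<le> phi_norm t \<alpha> b" .
    have a_\<alpha>: "phi_norm t \<alpha> a \<le> s"
      using phi_b_norm_le[OF t \<alpha> a01] a by simp
    have pos: "0 < phi_norm t \<alpha> a"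
      using q \<alpha> a01 zero_less_power[OF a01(1), of "q \<alpha>"] by (metis less_le_trans)
    have other: "0 \<le> vabs (z \<beta>) \<and> vabs (z \<beta>) \<le> phi_norm t \<beta> a \<and> vabs (z \<beta>) \<le> phi_norm t \<beta> b"
      if \<beta>: "\<beta> \<in> set bs" "\<beta> \<noteq> \<alpha>" for \<beta>
    proof -
      have "vabs (z \<beta>) \<le> s ^ r"
        using z(3) \<beta> by (simp add: s_def)
      also have "\<dots> \<le> s ^ (2 * q \<beta>)"
        using s r[OF \<beta>(1)] by (intro power_decreasing) auto
      also have "\<dots> = (s\<^sup>2) ^ q \<beta>"
        by (simp add: power_mult)
      finally have *: "vabs (z \<beta>) \<le> (s\<^sup>2) ^ q \<beta>" .
      have "(s\<^sup>2) ^ q \<beta> \<le> a ^ q \<beta>" "(s\<^sup>2) ^ q \<beta> \<le> b ^ q \<beta>"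
        using a b s \<open>s\<^sup>2 < s\<close> by (intro power_mono; simp)+
      moreover have "a ^ q \<beta> \<le> phi_norm t \<beta> a" "b ^ q \<beta> \<le> phi_norm t \<beta> b"
        using q \<beta>(1) a01 b01 by blast+
      ultimately show ?thesis
        using * by (meson order_trans zero_le_dist)
    qed
    have le: "vabs (c k * (\<Prod>\<beta>\<in>set bs. z \<beta> powi k \<beta>)) \<le> max (term_norm t c a k) (term_norm t c b k)"
      if k: "k \<in> laurent_indices bs \<alpha>" for k
    proof -
      have "(\<Prod>\<beta>\<in>set bs. vabs (z \<beta>) powi k \<beta>) \<le>
          max (\<Prod>\<beta>\<in>set bs. phi_norm t \<beta> a powi k \<beta>) (\<Prod>\<beta>\<in>set bs. phi_norm t \<beta> b powi k \<beta>)"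
        using laurent_indices_nonneg[OF k] pos a_\<alpha> b_\<alpha> other \<alpha>
        by (intro monomial_le_max[of _ \<alpha>]) (simp_all add: s_def)
      then have "vabs (c k) * (\<Prod>\<beta>\<in>set bs. vabs (z \<beta>) powi k \<beta>) \<le>
          vabs (c k) * max (\<Prod>\<beta>\<in>set bs. phi_norm t \<beta> a powi k \<beta>) (\<Prod>\<beta>\<in>set bs. phi_norm t \<beta> b powi k \<beta>)"
        by (rule mult_left_mono) simp
      then show ?thesis
        unfolding vabs_laurent_monomial by (simp add: max_mult_distrib_left)
    qed
    show ?thesis
      unfolding summable_on_iff_null_family
      by (rule null_family_le[OF _ _ le]) (use null above in blast)+
  qed
  ultimately show ?thesis
    by blast
qed

lemma converges_in_R0_of_summable:
  assumes t: "t \<in> T_plus T N0" and c: "c \<in> laurent_series K bs \<alpha>"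
    and t_\<alpha>: "\<alpha> t = 1" and t_\<beta>: "\<And>\<beta>. \<beta> \<in> set bs \<Longrightarrow> \<beta> \<noteq> \<alpha> \<Longrightarrow> \<exists>m\<ge>r. \<beta> t = of_nat (p ^ m)"
    and r: "1 \<le> r" and \<rho>0: "1 / real p < \<rho>0" "\<rho>0 < 1"
    and summable: "\<And>z. \<rho>0 < vabs (z \<alpha>) \<Longrightarrow> vabs (z \<alpha>) < 1 \<Longrightarrow> \<forall>\<beta>\<in>set bs - {\<alpha>}. vabs (z \<beta>) \<le> vabs (z \<alpha>) ^ r \<Longrightarrow>
      (\<lambda>k. c k * (\<Prod>\<beta>\<in>set bs. z \<beta> powi k \<beta>)) summable_on laurent_indices bs \<alpha>"
  shows "converges_in_R0 p bs gen \<alpha> A emb res t c"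
proof -
  \<comment> \<open>Beyond the r-th root of 1/p one has 1/p \<le> rho^r, as
    \<open>phi_b_norm_le_power\<close> requires.\<close>
  have root: "0 < root r (1 / real p)" "root r (1 / real p) < 1"
    using r p_gt_1 by simp_all
  have "max \<rho>0 (root r (1 / real p)) < 1"
    using \<rho>0 root by simp
  moreover have "1 / real p \<le> max \<rho>0 (root r (1 / real p))"
    using \<rho>0 by simp
  ultimately have "\<exists>\<rho>1\<in>radii p. max \<rho>0 (root r (1 / real p)) < \<rho>1 \<and> \<rho>1 < 1"
    by (intro radii_dense) simp_all
  then obtain \<rho>1 where \<rho>1: "\<rho>1 \<in> radii p" "max \<rho>0 (root r (1 / real p)) < \<rho>1" "\<rho>1 < 1"
    by blast
  \<comment> \<open>The radius \<open>\<rho>1\<close> itself is included, since every component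
    carries the norm at \<open>\<rho>1\<close> besides its own.\<close>
  have null: "null_family (term_norm t c \<rho>) (laurent_indices bs \<alpha>)" if \<rho>: "\<rho> \<in> radii p" "\<rho>1 \<le> \<rho>" for \<rho>
  proof -
    have \<rho>01: "0 < \<rho>" "\<rho> < 1" "\<rho>0 < \<rho>"
      using radii_bounds[OF \<rho>(1)] \<rho>1 \<rho>(2) by auto
    have "root r (1 / real p) ^ r \<le> \<rho> ^ r"
      using root \<rho>1 \<rho>(2) by (intro power_mono) auto
    then have p_\<rho>: "1 / real p \<le> \<rho> ^ r"
      using r by simp
    \<comment> \<open>Radii lie in p^Q, so a point x with |x| = rho exists.\<close>
    obtain e where "e \<in> \<rat>" "\<rho> = real p powr e"
      using \<rho>(1) by (auto simp: radii_def)
    then obtain x :: 'c where x: "vabs x = \<rho>"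
      using value_group[of e] by metis
    \<comment> \<open>The extreme point of the region: |z_\<beta>| attains the bound |z_\<alpha>|^r,
      which is also the bound on the norm of phi_t(b_\<beta>).\<close>
    define z where "z \<beta> = (if \<beta> = \<alpha> then x else x ^ r)" for \<beta>
    have "(\<lambda>k. c k * (\<Prod>\<beta>\<in>set bs. z \<beta> powi k \<beta>)) summable_on laurent_indices bs \<alpha>"
      using \<rho>01 x by (intro summable) (simp_all add: z_def vabs_power)
    then have z_null: "null_family (\<lambda>k. vabs (c k * (\<Prod>\<beta>\<in>set bs. z \<beta> powi k \<beta>))) (laurent_indices bs \<alpha>)"
      by (simp only: summable_on_iff_null_family)
    have z_\<alpha>: "vabs (z \<alpha>) = \<rho>" and z_\<beta>: "\<beta> \<noteq> \<alpha> \<Longrightarrow> vabs (z \<beta>) = \<rho> ^ r" for \<beta>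
      by (simp_all add: z_def x vabs_power)
    have norm_\<alpha>: "phi_norm t \<alpha> \<rho> = \<rho>"
      by (rule phi_b_norm_eq[OF t \<alpha> t_\<alpha> \<rho>01(1,2)])
    have norm_\<beta>: "phi_norm t \<beta> \<rho> \<le> \<rho> ^ r" if \<beta>: "\<beta> \<in> set bs" "\<beta> \<noteq> \<alpha>" for \<beta>
    proof -
      obtain m where m: "r \<le> m" "\<beta> t = of_nat (p ^ m)"
        using t_\<beta>[OF \<beta>] by blast
      have "m < p ^ m"
        using prime_gt_1_nat[OF prime_p] by (intro power_gt_expt) auto
      then show ?thesis
        using m \<rho>01 p_\<rho> by (intro phi_b_norm_le_power[OF t \<beta>(1) m(2)]) auto
    qed
    \<comment> \<open>Nonnegativity of the supremum is read off from its lower bound by a power of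
      rho.\<close>
    have norm_nonneg: "0 \<le> phi_norm t \<beta> \<rho>" if \<beta>: "\<beta> \<in> set bs" for \<beta>
    proof -
      obtain q where "\<And>\<rho>. 0 < \<rho> \<Longrightarrow> \<rho> < 1 \<Longrightarrow> \<rho> ^ q \<le> phi_norm t \<beta> \<rho>"
        by (rule phi_b_norm_ge[OF t \<beta>]) (rule that)
      then have "\<rho> ^ q \<le> phi_norm t \<beta> \<rho>"
        using \<rho>01 by blast
      moreover have "0 \<le> \<rho> ^ q"
        using \<rho>01 by simp
      ultimately show ?thesis
        by (rule order_trans[rotated])
    qed
    have "term_norm t c \<rho> k \<le> vabs (c k * (\<Prod>\<beta>\<in>set bs. z \<beta> powi k \<beta>))"
      if k: "k \<in> laurent_indices bs \<alpha>" for k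
    proof -
      have "phi_norm t \<beta> \<rho> powi k \<beta> \<le> vabs (z \<beta>) powi k \<beta>" if \<beta>: "\<beta> \<in> set bs" for \<beta>
      proof (cases "\<beta> = \<alpha>")
        case True
        then show ?thesis
          by (simp add: norm_\<alpha> z_\<alpha>)
      next
        case False
        then show ?thesis
          using laurent_indices_nonneg[OF k \<beta>] norm_\<beta>[OF \<beta>] norm_nonneg[OF \<beta>]
          by (simp add: z_\<beta> power_int_mono)
      qed
      then have "(\<Prod>\<beta>\<in>set bs. phi_norm t \<beta> \<rho> powi k \<beta>) \<le> (\<Prod>\<beta>\<in>set bs. vabs (z \<beta>) powi k \<beta>)"
        by (intro prod_mono) (simp add: norm_nonneg zero_le_power_int)
      then show ?thesis
        unfolding vabs_laurent_monomial by (rule mult_left_mono) simp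
    qed
    then show ?thesis
      by (intro null_family_le[OF z_null z_null]) simp
  qed
  have "null_family (term_norm t c \<rho>) (laurent_indices bs \<alpha>)"
    if "\<rho>2 \<in> radii_above p \<rho>1" "\<rho> \<in> {\<rho>1, \<rho>2}" for \<rho>2 \<rho>
    using that \<rho>1(1) by (intro null) (auto simp: radii_above_def)
  then show ?thesis
    unfolding converges_in_R0_def
    using laurent_series_convergent_iff[OF \<rho>1(1) t c phi_b_unit[OF \<rho>1(1) t t_\<alpha>]]
      phi_b_unit[OF \<rho>1(1) t t_\<alpha>] \<rho>1(1) by blast
qed

end

section \<open>Extracting parameters and lattices from the reductive setting\<close>

theorem mainTheorem5:
  fixes p :: nat
    and K :: "'c::{alg_closed_field, field_char_0, complete_space} set"
    and G T P N N0 :: "('c ^ 'n::finite ^ 'n) set"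
    and \<Phi> \<Delta> :: "('c ^ 'n ^ 'n \<Rightarrow> 'c) set"
    and U :: "('c ^ 'n ^ 'n \<Rightarrow> 'c) \<Rightarrow> ('c ^ 'n ^ 'n) set"
    and \<alpha> \<iota> l :: "'c ^ 'n ^ 'n \<Rightarrow> 'c"
    and bs :: "('c ^ 'n ^ 'n \<Rightarrow> 'c) list"
    and gen :: "('c ^ 'n ^ 'n \<Rightarrow> 'c) \<Rightarrow> 'c ^ 'n ^ 'n"
    and A :: "real \<Rightarrow> real \<Rightarrow> 'a normed_ring"
    and emb :: "real \<Rightarrow> real \<Rightarrow> ((('c ^ 'n ^ 'n \<Rightarrow> 'c) \<Rightarrow> nat) \<Rightarrow> 'c) \<Rightarrow> 'a"
    and res :: "real \<Rightarrow> real \<Rightarrow> real \<Rightarrow> 'a \<Rightarrow> 'a"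
    and c :: "(('c ^ 'n ^ 'n \<Rightarrow> 'c) \<Rightarrow> int) \<Rightarrow> 'c"
  assumes "is_Cp p TYPE('c)"
    and "finite_extension_of_Qp K"
    and "split_reductive_setting G T P N \<Phi> \<Delta> U"
    and "standard_open_subgroup p N \<Phi> U N0"
    and "\<alpha> \<in> \<Delta>"
    and "root_coordinate T \<alpha> (U \<alpha>) N0 \<iota>"
    and "ell_map N \<Delta> U \<alpha> \<iota> l"
    and "distinct bs" and "set bs = \<Phi>"
    and "\<And>\<beta>. \<beta> \<in> \<Phi> \<Longrightarrow> gen \<beta> \<in> N0 \<inter> U \<beta> \<and> closure (generate GL {gen \<beta>}) = N0 \<inter> U \<beta>"
    and "l (gen \<alpha>) = 1"
    and "microlocalization_system p K bs gen \<alpha> A emb res"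
    and "c \<in> laurent_series K bs \<alpha>"
  shows "c \<in> Robba_N1_ell p K T N0 bs gen \<alpha> A emb res \<longleftrightarrow>
    (\<exists>(\<rho>2::real) (r::nat). 1 / real p < \<rho>2 \<and> \<rho>2 < 1 \<and> 1 \<le> r \<and>
       (\<forall>z :: ('c ^ 'n ^ 'n \<Rightarrow> 'c) \<Rightarrow> 'c.
          \<rho>2 < vabs (z \<alpha>) \<and> vabs (z \<alpha>) < 1 \<and> (\<forall>\<beta>\<in>\<Phi> - {\<alpha>}. vabs (z \<beta>) \<le> vabs (z \<alpha>) ^ r) \<longrightarrow>
          (\<lambda>k. c k * (\<Prod>\<beta>\<in>\<Phi>. z \<beta> powi k \<beta>)) summable_on laurent_indices bs \<alpha>))"
proof -
  note bs = assms(8) and \<Phi> = assms(9)[symmetric] and gen = assms(10) and c = assms(13)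
  interpret Cp_field p "TYPE('c)"
    using assms(1) by unfold_locales
  have torus: "split_torus Qp T" and simple: "simple_roots T \<Phi> \<Delta>" and roots: "\<Phi> = roots_of P T"
    and root_subgroups: "\<And>\<beta>. \<beta> \<in> \<Phi> \<Longrightarrow> root_subgroup N T \<beta> (U \<beta>)"
    using assms(3) by (auto simp: split_reductive_setting_def maximal_split_torus_def)
  have N0: "subgroup N0 GL" and N0_N: "N0 \<subseteq> Qp_points N" and N0_open: "openin (top_of_set (Qp_points N)) N0"
    and N0_bij: "bij_betw (\<lambda>f. ordprod GL f bs) (\<Pi>\<^sub>E \<beta>\<in>\<Phi>. N0 \<inter> U \<beta>) N0"
    using assms(4) bs \<Phi> by (auto simp: standard_open_subgroup_def)
  have characters: "\<Phi> \<subseteq> characters T"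
    by (auto simp: roots roots_of_def)
  have T: "subgroup T GL"
    using torus by (simp add: split_torus_def alg_subgroup_def)
  have \<alpha>: "\<alpha> \<in> \<Phi>"
    using simple assms(5) by (auto simp: simple_roots_def)
  \<comment> \<open>Each root subgroup comes with some parametrization; one is chosen for all
    positive roots simultaneously.\<close>
  have "\<exists>u. \<forall>\<beta>\<in>\<Phi>. alg_iso Qp Ga {\<lambda>x. x} (GL\<lparr>carrier := U \<beta>\<rparr>) GL_coords (u \<beta>) \<and>
      (\<forall>t\<in>T. \<forall>x. t ** u \<beta> x ** matrix_inv t = u \<beta> (\<beta> t * x))"
    by (intro bchoice ballI) (use root_subgroups in \<open>simp add: root_subgroup_def\<close>)
  then obtain u where u: "\<forall>\<beta>\<in>\<Phi>. alg_iso Qp Ga {\<lambda>x. x} (GL\<lparr>carrier := U \<beta>\<rparr>) GL_coords (u \<beta>) \<and>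
      (\<forall>t\<in>T. \<forall>x. t ** u \<beta> x ** matrix_inv t = u \<beta> (\<beta> t * x))" ..
  have U_subgroup: "subgroup (U \<beta>) GL" "U \<beta> \<subseteq> N" if "\<beta> \<in> \<Phi>" for \<beta>
    using root_subgroups[OF that] by (simp_all add: root_subgroup_def alg_subgroup_def)
  have parameter: "root_parameter p TYPE('c) T (U \<beta>) \<beta> (u \<beta>)" if "\<beta> \<in> \<Phi>" for \<beta>
    using u U_subgroup(1)[OF that] that
    by (intro root_parameter.intro root_parameter_axioms.intro Cp_field_axioms) auto
  define y where "y \<beta> = inv_into UNIV (u \<beta>) (gen \<beta>)" for \<beta>
  have gen_eq: "gen \<beta> = u \<beta> (y \<beta>)" if "\<beta> \<in> \<Phi>" for \<beta>
    using gen[OF that] bij_betw_inv_into_right[OF root_parameter.bij_u[OF parameter[OF that]], of "gen \<beta>"]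
    by (simp add: y_def)
  have one_N0: "mat 1 \<in> N0"
    using subgroup.one_closed[OF N0] by simp
  have lattice: "root_lattice p TYPE('c) T (U \<beta>) \<beta> (u \<beta>) N0 (y \<beta>)" if \<beta>: "\<beta> \<in> \<Phi>" for \<beta>
  proof -
    interpret root_parameter p "TYPE('c)" T "U \<beta>" \<beta> "u \<beta>"
      by (rule parameter[OF \<beta>])
    obtain x where x: "x \<noteq> 0" "u \<beta> x \<in> N0"
      using N0_open U_subgroup(2)[OF \<beta>] one_N0 by (rule open_subgroup_nontrivial)
    \<comment> \<open>A trivial generator would make \<open>N0 \<inter> U \<beta>\<close> trivial,
      whereas openness of N0 provides a nontrivial element u \<beta> x.\<close>
    have "y \<beta> \<noteq> 0"
    proof
      assume "y \<beta> = 0"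
      then have "N0 \<inter> U \<beta> = closure (generate GL {mat 1})"
        using gen[OF \<beta>] gen_eq[OF \<beta>] by (simp add: u_0)
      also have "\<dots> \<subseteq> closure {mat 1}"
        by (rule closure_mono[OF generate_GL_trivial])
      finally have "u \<beta> x = u \<beta> 0"
        using x(2) u_in_U[of x] by (auto simp: u_0)
      then show False
        using x(1) by (simp add: u_eq_iff)
    qed
    moreover have "M $ i $ j \<in> Qp" if "M \<in> N0" for M i j
      using that N0_N by (auto simp: Qp_points_def)
    moreover have "closure (generate GL {u \<beta> (y \<beta>)}) = N0 \<inter> U \<beta>"
      using gen[OF \<beta>] gen_eq[OF \<beta>] by simp
    ultimately show ?thesis
      using N0 by (intro root_lattice.intro root_lattice_axioms.intro root_parameter_axioms)
  qed
  have T_one: "mat 1 \<in> T" "mat 1 \<in> Qp_points T"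
    using subgroup.one_closed[OF T] by (simp_all add: Qp_points_def mat_def Qp_0 Qp_1)
  \<comment> \<open>\<alpha>(1) is a nonzero idempotent of the field.\<close>
  have \<alpha>_one: "\<alpha> (mat 1) = 1"
  proof -
    have "\<alpha> \<in> characters T"
      using \<alpha> characters by blast
    then have "\<alpha> (mat 1 ** mat 1) = \<alpha> (mat 1) * \<alpha> (mat 1)" "\<alpha> (mat 1) \<noteq> 0"
      using T_one(1) unfolding characters_def by blast+
    then show ?thesis
      by simp
  qed
  interpret root_coordinates p "TYPE('c)" T N0 bs U u y gen
  proof (intro root_coordinates.intro root_coordinates_axioms.intro Cp_field_axioms)
    show "root_lattice p TYPE('c) T (U \<beta>) \<beta> (u \<beta>) N0 (y \<beta>)" "gen \<beta> = u \<beta> (y \<beta>)" if "\<beta> \<in> set bs" for \<beta>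
      using lattice gen_eq that \<Phi> by simp_all
    show "inj_on (\<lambda>f. ordprod GL f bs) (\<Pi>\<^sub>E \<beta>\<in>set bs. N0 \<inter> U \<beta>)"
      using N0_bij \<Phi> by (simp add: bij_betw_def)
    show "\<beta> t \<noteq> 0" if "\<beta> \<in> set bs" "t \<in> T" for \<beta> t
      using that characters \<Phi> by (auto simp: characters_def)
  qed (rule bs)
  have K: "Qp \<subseteq> K"
    using assms(2) by (simp add: finite_extension_of_Qp_def)
  have one_T_plus: "mat 1 \<in> T_plus T N0"
    using T_one(2) by (auto simp: T_plus_def matrix_inv_mat_1)
  interpret microlocal_setting p "TYPE('c)" T N0 bs U u y gen K \<alpha> A emb res
    using K assms(12) \<alpha> \<Phi> one_T_plus \<alpha>_one
    by (intro microlocal_setting.intro microlocal_setting_axioms.intro root_coordinates_axioms) simp_all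
  show ?thesis
    unfolding \<Phi>
  proof
    assume "c \<in> Robba_N1_ell p K T N0 bs gen \<alpha> A emb res"
    then obtain t where "t \<in> T_plus T N0" "converges_in_R0 p bs gen \<alpha> A emb res t c"
      by (auto simp: Robba_N1_ell_def)
    then show "\<exists>(\<rho>2::real) (r::nat). 1 / real p < \<rho>2 \<and> \<rho>2 < 1 \<and> 1 \<le> r \<and>
       (\<forall>z. \<rho>2 < vabs (z \<alpha>) \<and> vabs (z \<alpha>) < 1 \<and> (\<forall>\<beta>\<in>set bs - {\<alpha>}. vabs (z \<beta>) \<le> vabs (z \<alpha>) ^ r) \<longrightarrow>
          (\<lambda>k. c k * (\<Prod>\<beta>\<in>set bs. z \<beta> powi k \<beta>)) summable_on laurent_indices bs \<alpha>)"
      using summable_of_converges_in_R0[OF _ c] by blast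
  next
    assume "\<exists>(\<rho>2::real) (r::nat). 1 / real p < \<rho>2 \<and> \<rho>2 < 1 \<and> 1 \<le> r \<and>
       (\<forall>z. \<rho>2 < vabs (z \<alpha>) \<and> vabs (z \<alpha>) < 1 \<and> (\<forall>\<beta>\<in>set bs - {\<alpha>}. vabs (z \<beta>) \<le> vabs (z \<alpha>) ^ r) \<longrightarrow>
          (\<lambda>k. c k * (\<Prod>\<beta>\<in>set bs. z \<beta> powi k \<beta>)) summable_on laurent_indices bs \<alpha>)"
    then obtain \<rho>2 r where \<rho>2: "1 / real p < \<rho>2" "\<rho>2 < 1" and r: "1 \<le> r"
      and summable: "\<forall>z. \<rho>2 < vabs (z \<alpha>) \<and> vabs (z \<alpha>) < 1 \<and> (\<forall>\<beta>\<in>set bs - {\<alpha>}. vabs (z \<beta>) \<le> vabs (z \<alpha>) ^ r) \<longrightarrow>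
          (\<lambda>k. c k * (\<Prod>\<beta>\<in>set bs. z \<beta> powi k \<beta>)) summable_on laurent_indices bs \<alpha>"
      by (elim exE conjE)
    have "finite \<Phi>"
      by (simp add: \<Phi>)
    obtain t where t: "t \<in> Qp_points T" "\<alpha> t = 1"
      and t_\<beta>: "\<And>\<beta>. \<beta> \<in> \<Phi> \<Longrightarrow> \<beta> \<noteq> \<alpha> \<Longrightarrow> \<exists>m\<ge>r. \<beta> t = of_nat (p ^ m)"
      using exists_contracting_torus_element[OF torus simple characters \<open>finite \<Phi>\<close> assms(5), of r] by metis
    \<comment> \<open>All values \<beta>(t) are 1 or powers of p, hence natural numbers, as
      \<open>T_plusI\<close> requires.\<close>
    have "\<exists>m. \<beta> t = of_nat m" if "\<beta> \<in> \<Phi>" for \<beta>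
      using t(2) t_\<beta>[OF that] by (cases "\<beta> = \<alpha>") (auto intro: exI[of _ 1])
    then have "t \<in> T_plus T N0"
      using T N0 N0_bij t(1) \<Phi> by (intro T_plusI) (auto simp: bij_betw_def)
    moreover from this have "converges_in_R0 p bs gen \<alpha> A emb res t c"
      using c t(2) t_\<beta> r \<rho>2 summable \<Phi> by (intro converges_in_R0_of_summable[of t c r \<rho>2]) auto
    ultimately show "c \<in> Robba_N1_ell p K T N0 bs gen \<alpha> A emb res"
      using c by (auto simp: Robba_N1_ell_def)
  qed
qed

end
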